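(* There exists $n_0\in\mathbb N$ such that for every $n\ge n_0$ the following holds. Every set $P\subseteq\mathbb R^2$ of $n$ points that is not contained in a single line satisfies $|\mathcal A(P)|\ge n-2$. Furthermore, for a set $P\subseteq\mathbb R^2$ of $n$ points not contained in a single line, $|\mathcal A(P)|=n-2$ holds if and only if $P$ is the set of vertices of a regular $n$-gon.
   Context: For three distinct points $p,q,r\in\mathbb R^2$, $\mathcal A(p,q,r)\in[0,\pi]$ denotes the (unoriented) angle at $q$ determined by the three points, i.e. the angle between the vectors $p-q$ and $r-q$ (the values $0$ and $\pi$ are allowed and are counted as different angles). For a finite set $P\subset\mathbb R^2$, the set of angles determined by $P$ is $$\mathcal A(P):=\{\mathcal A(p,q,r): p,q,r\in P \text{ distinct}\}.$$ *)

theory Defs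
  imports "HOL-Analysis.Analysis"
begin

text \<open>The unoriented angle between two nonzero vectors; the argument of \<^term>\<open>arccos\<close> lies in
  \<open>[-1, 1]\<close> by Cauchy--Schwarz, so the value lies in \<open>[0, pi]\<close>.\<close>

definition vangle :: "real ^ 2 \<Rightarrow> real ^ 2 \<Rightarrow> real" where
  "vangle u v = arccos ((u \<bullet> v) / (norm u * norm v))"

definition angle_at :: "real ^ 2 \<Rightarrow> real ^ 2 \<Rightarrow> real ^ 2 \<Rightarrow> real" where
  "angle_at p q r = vangle (p - q) (r - q)"

definition angle_set :: "(real ^ 2) set \<Rightarrow> real set" where
  "angle_set P = {angle_at p q r | p q r.
     p \<in> P \<and> q \<in> P \<and> r \<in> P \<and> p \<noteq> q \<and> q \<noteq> r \<and> p \<noteq> r}"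

text \<open>Center \<open>c\<close>, circumradius \<open>\<rho>\<close>, and phase \<open>\<theta>\<close>. The two degenerate cases \<open>n = 1, 2\<close> (a point,
  a segment) are excluded.\<close>

definition regular_polygon_vertices :: "nat \<Rightarrow> (real ^ 2) set \<Rightarrow> bool" where
  "regular_polygon_vertices n P \<longleftrightarrow> n \<ge> 3 \<and>
     (\<exists>(c :: real ^ 2) (\<rho> :: real) (\<theta> :: real). \<rho> > 0 \<and>
        P = {c + \<rho> *\<^sub>R vector [cos (\<theta> + 2 * pi * real k / real n),
                           sin (\<theta> + 2 * pi * real k / real n)] | k. k < n})"

end

theory Submission
  imports Defs "HOL-Real_Asymp.Real_Asymp"
begin

text \<open>
  Suppose that \<open>n\<close> points determine fewer than \<open>n\<close> angles. Lifted to the reals these form a set of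
  size \<open>O(n)\<close> in which the difference between the directions of two points, seen from a third
  one, occurs very often: once for every further point.

  A squeezing argument shows that this cannot happen along a large subset of a line seen from two
  essentially different observers: pairs of lifted angles at small distance in rank would
  determine the pair of points up to two choices, and there are too few such pairs. By inversion the
  same holds for circles. Hence a line or circle that contains \<open>n powr (19/20)\<close> of the points contains
  all of them but two, respectively all of them but possibly its centre.

  If there is no such line or circle, some four points form a cluster whose elements are seen from
  all points beyond a horizontal line within very small angles. A weak form of Beck's theorem makes
  these angles differences of many pairs of lifted angles; by pigeonhole many points see two of the
  four under one angle and so lie on a common circle, and after inverting this circle to a line the
  remaining two points serve as observers for the squeezing argument.

  The remaining configurations are almost collinear or concyclic, where the smallest gaps between
  directions are counted exactly.
\<close>

subsection \<open>Counting translates of a finite set of reals\<close>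

text \<open>The order of the reals is needed because rank and monotonicity make no sense for angles
  modulo \<open>pi\<close>; unoriented angles leave sign and half turns open, and two signs times
  eleven multiples of \<open>pi\<close> give the factor 22. The rest is a balance of exponents in
  \<open>squeeze\<close>, where \<open>k\<close> bounds rank distances and \<open>h\<close> the
  gaps. On a line or circle with \<open>t\<close> points all representations count, so
  \<open>k\<close> is of order \<open>n\<close>; then \<open>h\<close> near
  \<open>n powr (1/3)\<close> gives \<open>t ^ 3 = O(n powr (8/3))\<close>. A threshold exponent
  must therefore exceed 8/9, and it must stay below 1 so that the threshold times
  \<open>ln n\<close> is negligible against \<open>n\<close> in the incidence step; 19/20 lies
  between. Without a rich curve the points per angle may be few, and \<open>k\<close> must be far
  smaller. A cluster is a cell of \<open>r\<close> half-planes, about \<open>r ^ 2\<close> cells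
  must be fewer than the points, so \<open>r\<close> is of order \<open>sqrt n\<close>; separating
  all far pairs greedily then gives \<open>k\<close> of order \<open>sqrt n * ln n\<close>. Up to
  constants the final comparison is \<open>n ^ 4\<close> against
  \<open>n ^ 3 * k * (k / h + h ^ 2)\<close>, and \<open>h\<close> near \<open>n powr (1/6)\<close>
  makes the right side smaller.\<close>

lemma card_le_fibres:
  assumes "finite A" "\<And>y. y \<in> F ` A \<Longrightarrow> card {x\<in>A. F x = y} \<le> m"
  shows "card A \<le> m * card (F ` A)"
proof -
  have "A = (\<Union>y\<in>F ` A. {x\<in>A. F x = y})" by auto
  then have "card A \<le> (\<Sum>y\<in>F ` A. card {x\<in>A. F x = y})"
    using card_UN_le[of "F ` A" "\<lambda>y. {x\<in>A. F x = y}"] assms(1) by simp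
  also have "\<dots> \<le> (\<Sum>y\<in>F ` A. m)" by (rule sum_mono) (use assms(2) in blast)
  finally show ?thesis by (simp add: mult.commute)
qed

text \<open>Measures how popular \<open>d\<close> is as a difference in \<open>B\<close>. Closeness
  is expressed by rank because nothing is known about how \<open>B\<close> is distributed; the
  choice \<open>k = card B\<close> admits every representation.\<close>

definition shifts :: "real set \<Rightarrow> nat \<Rightarrow> real \<Rightarrow> real set" where
  "shifts B k d = {b\<in>B. b + d \<in> B \<and> card (B \<inter> {min b (b + d)..max b (b + d)}) \<le> k}"

lemma finite_shifts [simp]: "finite B \<Longrightarrow> finite (shifts B k d)"
  by (simp add: shifts_def)

text \<open>All such \<open>y\<close> lie in the window of the largest one.\<close>

lemma card_rank_above:
  fixes B :: "real set"
  assumes "finite B"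
  shows "card {y\<in>B. x < y \<and> card (B \<inter> {x<..y}) \<le> k} \<le> k"
proof (cases "{y\<in>B. x < y \<and> card (B \<inter> {x<..y}) \<le> k} = {}")
  case False
  let ?S = "{y\<in>B. x < y \<and> card (B \<inter> {x<..y}) \<le> k}"
  have fin: "finite ?S" using assms by simp
  then have m: "Max ?S \<in> ?S" using False by (rule Max_in)
  have "?S \<subseteq> B \<inter> {x<..Max ?S}" using fin by auto
  then have "card ?S \<le> card (B \<inter> {x<..Max ?S})" by (rule card_mono[rotated]) (use assms in simp)
  also have "\<dots> \<le> k" using m by blast
  finally show ?thesis .
next
  case True
  then show ?thesis unfolding True by simp
qed

lemma card_rank_below:
  fixes B :: "real set"
  assumes "finite B"
  shows "card {y\<in>B. y < x \<and> card (B \<inter> {y..<x}) \<le> k} \<le> k"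
proof (cases "{y\<in>B. y < x \<and> card (B \<inter> {y..<x}) \<le> k} = {}")
  case False
  let ?S = "{y\<in>B. y < x \<and> card (B \<inter> {y..<x}) \<le> k}"
  have fin: "finite ?S" using assms by simp
  then have m: "Min ?S \<in> ?S" using False by (rule Min_in)
  have "?S \<subseteq> B \<inter> {Min ?S..<x}" using fin by auto
  then have "card ?S \<le> card (B \<inter> {Min ?S..<x})" by (rule card_mono[rotated]) (use assms in simp)
  also have "\<dots> \<le> k" using m by blast
  finally show ?thesis .
next
  case True
  then show ?thesis unfolding True by simp
qed

text \<open>Double counting of the pairs \<open>(b, b + d)\<close>: each \<open>b\<close> has at
  most \<open>k\<close> partners of small rank distance above it, \<open>k\<close> below it, and
  itself. In \<open>step_one\<close> this limits the number of angles under which a fixed pair of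
  points is seen.\<close>

lemma card_differences_le:
  assumes B: "finite B" and X: "finite X" and R: "\<And>d. d \<in> X \<Longrightarrow> R \<le> real (card (shifts B k d))"
  shows "real (card X) * R \<le> real (card B) * (2 * real k + 1)"
proof -
  have "real (card X) * R \<le> (\<Sum>d\<in>X. real (card (shifts B k d)))"
    using sum_mono[of X "\<lambda>_. R", OF R] by simp
  also have "\<dots> = real (card (SIGMA d:X. shifts B k d))"
    using X B by (simp add: card_SigmaI)
  also have "card (SIGMA d:X. shifts B k d) \<le> card (SIGMA b:B. {y\<in>B. b < y \<and> card (B \<inter> {b<..y}) \<le> k} \<union>
      {y\<in>B. y < b \<and> card (B \<inter> {y..<b}) \<le> k} \<union> {b})" (is "_ \<le> card ?S")
  proof (rule card_inj_on_le)
    show "inj_on (\<lambda>(d,b). (b, b + d)) (SIGMA d:X. shifts B k d)" by (auto simp: inj_on_def)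
    show "finite ?S" using B by auto
    show "(\<lambda>(d,b). (b, b + d)) ` (SIGMA d:X. shifts B k d) \<subseteq> ?S"
    proof (rule image_subsetI)
      fix u assume "u \<in> (SIGMA d:X. shifts B k d)"
      then obtain d b where u: "u = (d, b)" "d \<in> X" "b \<in> shifts B k d" by auto
      then have b: "b \<in> B" "b + d \<in> B" and c: "card (B \<inter> {min b (b + d)..max b (b + d)}) \<le> k"
        by (auto simp: shifts_def)
      have "card (B \<inter> {b<..b+d}) \<le> card (B \<inter> {min b (b + d)..max b (b + d)})"
        "card (B \<inter> {b+d..<b}) \<le> card (B \<inter> {min b (b + d)..max b (b + d)})"
        using B by (auto intro!: card_mono)
      with b c show "(case u of (d, b) \<Rightarrow> (b, b + d)) \<in> ?S" by (auto simp: u)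
    qed
  qed
  also have "card ?S = (\<Sum>b\<in>B. card ({y\<in>B. b < y \<and> card (B \<inter> {b<..y}) \<le> k} \<union>
      {y\<in>B. y < b \<and> card (B \<inter> {y..<b}) \<le> k} \<union> {b}))" using B by (simp add: card_SigmaI)
  also have "\<dots> \<le> (\<Sum>b\<in>B. k + k + 1)"
  proof (rule sum_mono)
    fix b assume "b \<in> B"
    show "card ({y\<in>B. b < y \<and> card (B \<inter> {b<..y}) \<le> k} \<union>
      {y\<in>B. y < b \<and> card (B \<inter> {y..<b}) \<le> k} \<union> {b}) \<le> k + k + 1"
      using card_rank_above[OF B, of b k] card_rank_below[OF B, of b k]
      by (intro order_trans[OF card_Un_le] add_mono) auto
  qed
  finally show ?thesis by (simp add: algebra_simps)
qed

text \<open>At the maximum of \<open>I\<close> the value is unspecified; uses are guarded by a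
  larger element of \<open>I\<close>.\<close>

definition nxt :: "real set \<Rightarrow> real \<Rightarrow> real" where "nxt I x = Min {y\<in>I. x < y}"

lemma nxt:
  assumes "finite I" "y \<in> I" "x < y"
  shows "nxt I x \<in> I" "x < nxt I x" "nxt I x \<le> y"
proof -
  have "nxt I x \<in> {y\<in>I. x < y}" unfolding nxt_def by (rule Min_in) (use assms in auto)
  then show "nxt I x \<in> I" "x < nxt I x" by auto
  show "nxt I x \<le> y" unfolding nxt_def by (rule Min_le) (use assms in auto)
qed

text \<open>The half-open gaps are disjoint and lie between the images of the least and the greatest
  element of \<open>I\<close>. Both images are within a window of \<open>k\<close> elements from the
  common base \<open>b\<close>, so at most \<open>2 * k\<close> elements of \<open>B\<close> are
  available to fill the gaps.\<close>

lemma card_wide_gaps: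
  fixes f :: "real \<Rightarrow> real"
  assumes B: "finite B" and I: "finite I" and mono: "\<And>x y. x \<in> I \<Longrightarrow> y \<in> I \<Longrightarrow> x < y \<Longrightarrow> f x < f y"
    and win: "\<And>x. x \<in> I \<Longrightarrow> card (B \<inter> {min b (f x)..max b (f x)}) \<le> k"
  shows "card {x\<in>I. (\<exists>y\<in>I. x < y) \<and> h < card (B \<inter> {f x<..f (nxt I x)})} * h \<le> 2 * k"
proof (cases "I = {}")
  case False
  define J where "J = {x\<in>I. (\<exists>y\<in>I. x < y) \<and> h < card (B \<inter> {f x<..f (nxt I x)})}"
  have J: "finite J" "J \<subseteq> I" using I by (auto simp: J_def)
  have nx: "nxt I x \<in> I" "x < nxt I x" if "x \<in> J" for x
    using that nxt[OF I] by (auto simp: J_def)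
  have mono': "f x \<le> f y" if "x \<in> I" "y \<in> I" "x \<le> y" for x y
    using mono[OF that(1,2)] that by (cases "x = y") auto
  have disj: "(B \<inter> {f x<..f (nxt I x)}) \<inter> (B \<inter> {f y<..f (nxt I y)}) = {}"
    if "x \<in> J" "y \<in> J" "x \<noteq> y" for x y
  proof -
    have *: "(B \<inter> {f x<..f (nxt I x)}) \<inter> (B \<inter> {f y<..f (nxt I y)}) = {}"
      if "x \<in> J" "y \<in> J" "x < y" for x y
    proof -
      have "nxt I x \<le> y" by (rule nxt(3)[OF I]) (use that J in auto)
      then have "f (nxt I x) \<le> f y" using mono' nx(1)[OF that(1)] that J by auto
      then show ?thesis by auto
    qed
    show ?thesis using *[of x y] *[of y x] that by (cases "x < y") auto
  qed
  have m: "Min I \<in> I" "Max I \<in> I" using I False by auto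
  have "card J * h = (\<Sum>x\<in>J. h)" by simp
  also have "\<dots> \<le> (\<Sum>x\<in>J. card (B \<inter> {f x<..f (nxt I x)}))"
    by (rule sum_mono) (auto simp: J_def)
  also have "\<dots> = card (\<Union>x\<in>J. B \<inter> {f x<..f (nxt I x)})"
    by (rule card_UN_disjoint[symmetric]) (use J B disj in auto)
  also have "\<dots> \<le> card ((B \<inter> {min b (f (Min I))..max b (f (Min I))}) \<union> (B \<inter> {min b (f (Max I))..max b (f (Max I))}))"
  proof (rule card_mono)
    show "(\<Union>x\<in>J. B \<inter> {f x<..f (nxt I x)}) \<subseteq> (B \<inter> {min b (f (Min I))..max b (f (Min I))}) \<union> (B \<inter> {min b (f (Max I))..max b (f (Max I))})"
    proof clarify
      fix x z assume x: "x \<in> J" and z: "z \<in> B" "z \<in> {f x<..f (nxt I x)}"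
        and nz: "z \<notin> {min b (f (Max I))..max b (f (Max I))}"
      have "f (Min I) \<le> f x" using mono'[of "Min I" x] m x J I by auto
      moreover have "f (nxt I x) \<le> f (Max I)" using mono'[of "nxt I x" "Max I"] m nx[OF x] I by auto
      ultimately show "z \<in> {min b (f (Min I))..max b (f (Min I))}" using z nz by auto
    qed
  qed (use B in auto)
  also have "\<dots> \<le> k + k" by (rule order_trans[OF card_Un_le] add_mono win m)+
  finally show ?thesis by (simp add: J_def)
qed simp

text \<open>Counting quadruples: each pair \<open>(b, \<beta>)\<close> of base points places the points of \<open>T\<close> whose
  \<open>s\<close>- and \<open>t\<close>-shifts stay in \<open>B\<close> into short windows of \<open>B\<close>, so consecutive ones are mostly of
  small rank; and a pair of small-rank pairs determines the two points up to two choices.\<close>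

lemma squeeze:
  fixes s t :: "real \<Rightarrow> real"
  assumes B: "finite B" and T: "finite T"
    and ms: "\<And>x y. x \<in> T \<Longrightarrow> y \<in> T \<Longrightarrow> x < y \<Longrightarrow> s x < s y"
    and mt: "\<And>x y. x \<in> T \<Longrightarrow> y \<in> T \<Longrightarrow> x < y \<Longrightarrow> t x < t y"
    and R: "0 \<le> R" "\<And>x. x \<in> T \<Longrightarrow> R \<le> real (card (shifts B k (s x)))"
      "\<And>x. x \<in> T \<Longrightarrow> R \<le> real (card (shifts B k (t x)))"
    and types: "\<And>d d'. card {(x,y). x \<in> T \<and> y \<in> T \<and> x < y \<and> s y - s x = d \<and> t y - t x = d'} \<le> 2"
    and h: "h \<ge> 1"
  shows "real (card T) * R\<^sup>2 \<le> (real (card B))\<^sup>2 * (1 + 4 * real k / real h + 2 * (real h)\<^sup>2)"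
proof -
  \<comment> \<open>For a base pair \<open>(b, c)\<close>: the points whose two shifts can start
    there. Each image \<open>b + s x\<close> and \<open>c + t x\<close> is then within
    \<open>k\<close> elements of its base.\<close>
  define I where "I = (\<lambda>(b,c). {x\<in>T. b \<in> shifts B k (s x) \<and> c \<in> shifts B k (t x)})"
  define nx where "nx = (\<lambda>p x. nxt (I p) x)"
  define PR where "PR = {(x,y). x \<in> B \<and> y \<in> B \<and> x < y \<and> card (B \<inter> {x<..y}) \<le> h}"
  define G where "G = (\<lambda>p. {x\<in>I p. (\<exists>y\<in>I p. x < y) \<and> card (B \<inter> {fst p + s x<..fst p + s (nx p x)}) \<le> h
     \<and> card (B \<inter> {snd p + t x<..snd p + t (nx p x)}) \<le> h})"
  have finI: "finite (I p)" for p using T by (auto simp: I_def split: prod.splits)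
  have IT: "I p \<subseteq> T" for p by (auto simp: I_def split: prod.splits)
  have finG: "finite (G p)" for p using finI by (auto simp: G_def)
  have "real (card T) * R\<^sup>2 = (\<Sum>x\<in>T. R * R)" by (simp add: power2_eq_square)
  also have "\<dots> \<le> (\<Sum>x\<in>T. real (card (shifts B k (s x))) * real (card (shifts B k (t x))))"
    by (intro sum_mono mult_mono) (use R in auto)
  also have "\<dots> = real (card (SIGMA x:T. shifts B k (s x) \<times> shifts B k (t x)))"
    using T B by (simp add: card_SigmaI)
  also have "card (SIGMA x:T. shifts B k (s x) \<times> shifts B k (t x)) = card (SIGMA p:B\<times>B. I p)"
    by (rule bij_betw_same_card[of "\<lambda>(x,p). (p,x)"], rule bij_betwI[where g = "\<lambda>(p,x). (x,p)"])
       (auto simp: I_def shifts_def)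
  also have "\<dots> = (\<Sum>p\<in>B\<times>B. card (I p))" using B finI by (simp add: card_SigmaI)
  also have "real \<dots> \<le> (\<Sum>p\<in>B\<times>B. (1 + 4 * real k / real h) + real (card (G p)))"
    unfolding of_nat_sum
  proof (rule sum_mono)
    fix p assume "p \<in> B \<times> B"
    define b c where "b = fst p" and "c = snd p"
    let ?J = "{x\<in>I p. \<exists>y\<in>I p. x < y}"
    let ?Bs = "{x\<in>I p. (\<exists>y\<in>I p. x < y) \<and> h < card (B \<inter> {b + s x<..b + s (nxt (I p) x)})}"
    let ?Bt = "{x\<in>I p. (\<exists>y\<in>I p. x < y) \<and> h < card (B \<inter> {c + t x<..c + t (nxt (I p) x)})}"
    have mem: "b \<in> shifts B k (s x)" "c \<in> shifts B k (t x)" if "x \<in> I p" for x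
      using that by (auto simp: I_def b_def c_def split: prod.splits)
    have "card ?Bs * h \<le> 2 * k"
      by (rule card_wide_gaps[OF B finI, where b = b]) (use ms mem IT in \<open>auto simp: shifts_def subset_iff\<close>)
    then have 1: "real (card ?Bs) \<le> 2 * real k / real h"
      using h by (simp add: field_simps flip: of_nat_mult of_nat_le_iff)
    have "card ?Bt * h \<le> 2 * k"
      by (rule card_wide_gaps[OF B finI, where b = c]) (use mt mem IT in \<open>auto simp: shifts_def subset_iff\<close>)
    then have 2: "real (card ?Bt) \<le> 2 * real k / real h"
      using h by (simp add: field_simps flip: of_nat_mult of_nat_le_iff)
    \<comment> \<open>What is missing from \<open>G p\<close> is the maximum, which has no
      successor, and the points followed by a wide gap in one of the two images.\<close>
    have "I p \<subseteq> {Max (I p)} \<union> (G p \<union> (?Bs \<union> ?Bt))"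
    proof
      fix x assume x: "x \<in> I p"
      show "x \<in> {Max (I p)} \<union> (G p \<union> (?Bs \<union> ?Bt))"
      proof (cases "\<exists>y\<in>I p. x < y")
        case False
        then have "x = Max (I p)" using x finI[of p] by (metis Max_eqI leI)
        then show ?thesis by simp
      next
        case True
        then show ?thesis using x by (auto simp: G_def nx_def b_def c_def not_le)
      qed
    qed
    then have "card (I p) \<le> card ({Max (I p)} \<union> (G p \<union> (?Bs \<union> ?Bt)))"
      by (rule card_mono[rotated]) (use finI finG in auto)
    also have "\<dots> \<le> 1 + (card (G p) + (card ?Bs + card ?Bt))"
      using card_Un_le[of "{Max (I p)}" "G p \<union> (?Bs \<union> ?Bt)"] card_Un_le[of "G p" "?Bs \<union> ?Bt"]
        card_Un_le[of ?Bs ?Bt] by simp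
    finally have "real (card (I p)) \<le> 1 + (real (card (G p)) + (real (card ?Bs) + real (card ?Bt)))"
      by linarith
    then show "real (card (I p)) \<le> (1 + 4 * real k / real h) + real (card (G p))"
      using 1 2 by (simp add: field_simps)
  qed
  also have "\<dots> = (real (card B))\<^sup>2 * (1 + 4 * real k / real h) + real (\<Sum>p\<in>B\<times>B. card (G p))"
    by (simp add: sum.distrib card_cartesian_product power2_eq_square algebra_simps)
  also have "(\<Sum>p\<in>B\<times>B. card (G p)) = card (SIGMA p:B\<times>B. G p)" using B finG by (simp add: card_SigmaI)
  also have "\<dots> \<le> 2 * (card B * h)\<^sup>2"
  proof -
    let ?A = "SIGMA p:B\<times>B. G p"
    let ?F = "\<lambda>(p,x). ((fst p + s x, fst p + s (nx p x)), (snd p + t x, snd p + t (nx p x)))"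
    have finA: "finite ?A" using B finG by auto
    have props: "nx p x \<in> I p \<and> x < nx p x \<and> x \<in> I p \<and> x \<in> T \<and> nx p x \<in> T" if "x \<in> G p" for p x
      using that nxt[OF finI, of _ p x] IT[of p] unfolding G_def nx_def by blast
    have finPR: "finite PR" by (rule finite_subset[of _ "B \<times> B"]) (use B in \<open>auto simp: PR_def\<close>)
    have "PR = (SIGMA x:B. {y\<in>B. x < y \<and> card (B \<inter> {x<..y}) \<le> h})" by (auto simp: PR_def)
    then have "card PR = (\<Sum>x\<in>B. card {y\<in>B. x < y \<and> card (B \<inter> {x<..y}) \<le> h})"
      using B by (simp add: card_SigmaI)
    also have "\<dots> \<le> (\<Sum>x\<in>B. h)" by (intro sum_mono card_rank_above B)
    finally have cPR: "card PR \<le> card B * h" by simp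
    have "?F ` ?A \<subseteq> PR \<times> PR"
    proof (rule image_subsetI)
      fix u assume "u \<in> ?A"
      then obtain b c x where u: "u = ((b,c),x)" and bc: "b \<in> B" "c \<in> B" and x: "x \<in> G (b,c)" by auto
      note p = props[OF x]
      have "b + s x \<in> B" "b + s (nx (b,c) x) \<in> B" "c + t x \<in> B" "c + t (nx (b,c) x) \<in> B"
        using p by (auto simp: I_def shifts_def)
      moreover have "s x < s (nx (b,c) x)" "t x < t (nx (b,c) x)" using p ms mt by auto
      ultimately show "?F u \<in> PR \<times> PR"
        using x by (auto simp: u PR_def G_def)
    qed
    then have cF: "card (?F ` ?A) \<le> (card B * h)\<^sup>2"
      using card_mono[of "PR \<times> PR" "?F ` ?A"] finPR cPR
      by (auto simp: card_cartesian_product power2_eq_square intro: order_trans mult_le_mono)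
    \<comment> \<open>The two small-rank pairs fix the differences of \<open>s\<close> and of
      \<open>t\<close> between \<open>x\<close> and its successor, so \<open>types\<close> leaves
      two choices; the base points are then recovered by subtraction.\<close>
    have "card ?A \<le> 2 * card (?F ` ?A)"
    proof (rule card_le_fibres[OF finA])
      fix y assume "y \<in> ?F ` ?A"
      obtain a1 a2 c1 c2 where y: "y = ((a1,a2),(c1,c2))" by (metis surj_pair)
      let ?ty = "{(x,x'). x \<in> T \<and> x' \<in> T \<and> x < x' \<and> s x' - s x = a2 - a1 \<and> t x' - t x = c2 - c1}"
      have "card {w\<in>?A. ?F w = y} \<le> card ?ty"
      proof (rule card_inj_on_le[where f = "\<lambda>(p,x). (x, nx p x)"])
        show "inj_on (\<lambda>(p,x). (x, nx p x)) {w\<in>?A. ?F w = y}"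
          by (auto simp: inj_on_def y)
        show "(\<lambda>(p,x). (x, nx p x)) ` {w\<in>?A. ?F w = y} \<subseteq> ?ty"
          using props by (fastforce simp: y)
        show "finite ?ty" by (rule finite_subset[of _ "T \<times> T"]) (use T in auto)
      qed
      also have "\<dots> \<le> 2" by (rule types)
      finally show "card {w\<in>?A. ?F w = y} \<le> 2" .
    qed
    with cF show ?thesis by linarith
  qed
  finally show ?thesis by (simp add: power_mult_distrib algebra_simps)
qed

subsection \<open>Angles of a line seen from two observers\<close>

text \<open>The direction in which the observer \<open>Complex a h\<close> sees the real number
  \<open>x\<close>, measured from the perpendicular onto the axis. The height \<open>h\<close> is
  signed; for a negative one the view decreases in \<open>x\<close>.\<close>

definition view :: "real \<Rightarrow> real \<Rightarrow> real \<Rightarrow> real" where "view a h x = arctan ((x - a) / h)"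

lemma view_bounds: "- (pi/2) < view a h x" "view a h x < pi/2"
  using arctan_bounded by (auto simp: view_def)

lemma view_less:
  assumes "h \<noteq> 0" "x < y"
  shows "sgn h * view a h x < sgn h * view a h y"
proof (cases "h > 0")
  case True
  then show ?thesis using assms by (simp add: view_def arctan_less_iff divide_strict_right_mono)
next
  case False
  then show ?thesis using assms
    by (simp add: view_def arctan_less_iff divide_strict_right_mono_neg)
qed

text \<open>Sine and cosine of the angle between \<open>(1, u)\<close> and \<open>(1, v)\<close>
  are, up to a common positive factor, \<open>v - u\<close> and \<open>1 + u * v\<close>. Clearing
  denominators gives a relation bilinear in \<open>x\<close> and \<open>y\<close>.\<close>

lemma view_diff:
  assumes "h \<noteq> 0" "x \<noteq> y"
  shows "sin (view a h y - view a h x) \<noteq> 0"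
    "cos (view a h y - view a h x) * (h * (y - x)) = sin (view a h y - view a h x) * (h\<^sup>2 + (x - a) * (y - a))"
proof -
  define d u v where "d = view a h y - view a h x" and "u = (x - a) / h" and "v = (y - a) / h"
  define q where "q = sqrt (1 + u\<^sup>2) * sqrt (1 + v\<^sup>2)"
  have q: "q > 0" by (simp add: q_def add_pos_nonneg)
  have sq: "sqrt (1 + u\<^sup>2) > 0" "sqrt (1 + v\<^sup>2) > 0" by (simp_all add: add_pos_nonneg)
  have d: "d = arctan v - arctan u" by (simp add: d_def view_def u_def v_def)
  have s: "sin d = (v - u) / q" "cos d = (1 + u * v) / q"
    unfolding d sin_diff cos_diff sin_arctan cos_arctan q_def using sq by (simp_all add: field_simps)
  have "v - u = (y - x) / h" by (simp add: u_def v_def diff_divide_distrib)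
  then show "sin (view a h y - view a h x) \<noteq> 0"
    using s q assms by (simp add: d_def[symmetric])
  have "h\<^sup>2 * (1 + u * v) = h\<^sup>2 + (x - a) * (y - a)"
    using assms by (simp add: u_def v_def field_simps power2_eq_square)
  note e1 = this
  have e2: "h\<^sup>2 * (v - u) = h * (y - x)"
    using assms by (simp add: u_def v_def field_simps power2_eq_square)
  show "cos (view a h y - view a h x) * (h * (y - x)) = sin (view a h y - view a h x) * (h\<^sup>2 + (x - a) * (y - a))"
    unfolding d_def[symmetric] e1[symmetric] e2[symmetric] s by simp
qed

lemma quadratic_three_roots:
  fixes A B C :: real
  assumes "A * x1\<^sup>2 + B * x1 + C = 0" "A * x2\<^sup>2 + B * x2 + C = 0" "A * x3\<^sup>2 + B * x3 + C = 0"
    and "x1 \<noteq> x2" "x1 \<noteq> x3" "x2 \<noteq> x3"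
  shows "A = 0 \<and> B = 0 \<and> C = 0"
proof -
  have 1: "(x1 - x2) * (A * (x1 + x2) + B) = 0" using assms(1,2) by (simp add: algebra_simps power2_eq_square)
  have 2: "(x1 - x3) * (A * (x1 + x3) + B) = 0" using assms(1,3) by (simp add: algebra_simps power2_eq_square)
  have e: "A * (x1 + x2) + B = 0" "A * (x1 + x3) + B = 0" using 1 2 assms(4,5) by auto
  have "A * (x2 - x3) = (A * (x1 + x2) + B) - (A * (x1 + x3) + B)" by (simp add: algebra_simps)
  then have "A * (x2 - x3) = 0" using e by simp
  then have "A = 0" using assms(6) by simp
  with e assms(1) show ?thesis by simp
qed

lemma card_ge_3E:
  assumes "\<not> card A \<le> 2"
  obtains x y z where "x \<in> A" "y \<in> A" "z \<in> A" "x \<noteq> y" "x \<noteq> z" "y \<noteq> z"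
proof -
  have "3 \<le> card A" using assms by simp
  then obtain S where S: "S \<subseteq> A" "card S = 3" by (meson obtain_subset_with_card_n)
  then obtain x y z where "S = {x,y,z}" "x \<noteq> y" "y \<noteq> z" "x \<noteq> z" by (metis card_3_iff)
  then show ?thesis using that S by blast
qed

text \<open>For fixed \<open>d\<close> and \<open>d'\<close> the two equations make \<open>y\<close> the image of \<open>x\<close> under two elliptic
  Moebius maps with fixed points \<open>a \<plusminus> \<i> h\<close> and \<open>b \<plusminus> \<i> k\<close>; maps with different fixed points
  agree at most twice.\<close>

lemma view_types:
  assumes h: "h \<noteq> 0" "k \<noteq> 0" and ne: "\<not> (a = b \<and> h\<^sup>2 = k\<^sup>2)"
  shows "card {(x,y). x \<in> T \<and> y \<in> T \<and> x < y \<and> view a h y - view a h x = d \<and> view b k y - view b k x = d'} \<le> 2"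
proof (rule ccontr)
  let ?S = "{(x,y). x \<in> T \<and> y \<in> T \<and> x < y \<and> view a h y - view a h x = d \<and> view b k y - view b k x = d'}"
  assume "\<not> card ?S \<le> 2"
  then obtain p1 p2 p3 where p: "p1 \<in> ?S" "p2 \<in> ?S" "p3 \<in> ?S" "p1 \<noteq> p2" "p1 \<noteq> p3" "p2 \<noteq> p3"
    by (rule card_ge_3E)
  have inj: "y = y'" if "view a h y = view a h y'" for y y'
    using view_less[OF h(1), of y y' a] view_less[OF h(1), of y' y a] that by (cases y y' rule: linorder_cases) auto
  \<comment> \<open>For fixed \<open>d\<close> the first point determines the second, since views
    are injective.\<close>
  have fst_ne: "fst p \<noteq> fst q" if "p \<in> ?S" "q \<in> ?S" "p \<noteq> q" for p q
    using that inj by (auto simp: prod_eq_iff split: prod.splits)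
  \<comment> \<open>Scaled cotangents: with them each view equation becomes a fractional linear
    relation between \<open>x\<close> and \<open>y\<close>, and eliminating \<open>y\<close> leaves
    a quadratic in \<open>x\<close>.\<close>
  define e f where "e = h * cos d / sin d" and "f = k * cos d' / sin d'"
  have eq: "((a - e) - (b - f)) * (fst p)\<^sup>2 +
     (- (a - e) * (b + f) - (h\<^sup>2 + a\<^sup>2) + (b - f) * (a + e) + (k\<^sup>2 + b\<^sup>2)) * fst p +
     ((h\<^sup>2 + a\<^sup>2) * (b + f) - (k\<^sup>2 + b\<^sup>2) * (a + e)) = 0" if pS: "p \<in> ?S" for p
  proof -
    obtain x y where xy: "p = (x,y)" "x < y" "view a h y - view a h x = d" "view b k y - view b k x = d'"
      using pS by (cases p) auto
    have "sin d \<noteq> 0" "sin d' \<noteq> 0" "cos d * (h * (y - x)) = sin d * (h\<^sup>2 + (x - a) * (y - a))"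
      "cos d' * (k * (y - x)) = sin d' * (k\<^sup>2 + (x - b) * (y - b))"
      using view_diff[OF h(1), of x y a] view_diff[OF h(2), of x y b] xy by auto
    then have "e * (y - x) = h\<^sup>2 + (x - a) * (y - a)" "f * (y - x) = k\<^sup>2 + (x - b) * (y - b)"
      by (auto simp: e_def f_def field_simps)
    then have 1: "y * (x - a - e) = (a - e) * x - (h\<^sup>2 + a\<^sup>2)"
      and 2: "y * (x - b - f) = (b - f) * x - (k\<^sup>2 + b\<^sup>2)"
      by (simp_all add: algebra_simps power2_eq_square)
    have "((a - e) * x - (h\<^sup>2 + a\<^sup>2)) * (x - b - f) = ((b - f) * x - (k\<^sup>2 + b\<^sup>2)) * (x - a - e)"
      unfolding 1[symmetric] 2[symmetric] by (simp add: mult_ac)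
    then show ?thesis by (simp add: xy algebra_simps power2_eq_square)
  qed
  note zz = quadratic_three_roots[OF eq[OF p(1)] eq[OF p(2)] eq[OF p(3)] fst_ne[OF p(1,2,4)] fst_ne[OF p(1,3,5)]
      fst_ne[OF p(2,3,6)]]
  then have z: "(a - e) - (b - f) = 0" "- (a - e) * (b + f) - (h\<^sup>2 + a\<^sup>2) + (b - f) * (a + e) + (k\<^sup>2 + b\<^sup>2) = 0"
    "(h\<^sup>2 + a\<^sup>2) * (b + f) - (k\<^sup>2 + b\<^sup>2) * (a + e) = 0" by blast+
  \<comment> \<open>The quadratic vanishes identically, so \<open>a - e\<close> and
    \<open>b - f\<close> agree. Expressed through this common value, the other two coefficients give
    \<open>a = b\<close> times a positive factor.\<close>
  define q where "q = a - e"
  have ef: "e = a - q" "f = b - q" using z(1) by (simp_all add: q_def)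
  have z2: "2 * q * (a - b) = (h\<^sup>2 + a\<^sup>2) - (k\<^sup>2 + b\<^sup>2)"
    using z(2) unfolding ef by (simp add: algebra_simps)
  have z3: "(h\<^sup>2 + a\<^sup>2) * (2 * b - q) = (k\<^sup>2 + b\<^sup>2) * (2 * a - q)"
    using z(3) unfolding ef by (simp add: algebra_simps)
  have "(a - b) * (k\<^sup>2 + (b - q)\<^sup>2) = 0"
  proof -
    have "((h\<^sup>2 + a\<^sup>2) - (k\<^sup>2 + b\<^sup>2)) * (2 * b - q) = (k\<^sup>2 + b\<^sup>2) * (2 * (a - b))"
      using z3 by (simp add: algebra_simps)
    then have "2 * q * (a - b) * (2 * b - q) = (k\<^sup>2 + b\<^sup>2) * (2 * (a - b))" by (simp only: z2)
    then show ?thesis by (simp add: algebra_simps power2_eq_square)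
  qed
  moreover have "k\<^sup>2 + (b - q)\<^sup>2 > 0" using h by (simp add: add_pos_nonneg)
  ultimately have "a = b" by auto
  with z2 ne show False by simp
qed

text \<open>Reading a pair backwards turns a shift by \<open>- d\<close> into one by
  \<open>d\<close>.\<close>

lemma card_shifts_uminus:
  assumes "\<And>x. x \<in> B \<Longrightarrow> - x \<in> B"
  shows "card (shifts B k (- d)) = card (shifts B k d)"
  by (rule bij_betw_same_card[of "\<lambda>b. b - d"], rule bij_betwI[where g = "\<lambda>b. b + d"])
     (auto simp: shifts_def min.commute max.commute)

text \<open>Views from below the axis are decreasing, so both are multiplied by the sign of the
  height; by \<open>card_shifts_uminus\<close> this leaves the counts of shifts unchanged. The
  constants \<open>c\<close> and \<open>c'\<close> cancel in differences.\<close>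

lemma squeeze_views:
  assumes B: "finite B" "\<And>x. x \<in> B \<Longrightarrow> - x \<in> B" and T: "finite T"
    and h: "h \<noteq> 0" "k \<noteq> 0" and ne: "\<not> (a = b \<and> h\<^sup>2 = k\<^sup>2)"
    and R: "0 \<le> R" "\<And>x. x \<in> T \<Longrightarrow> R \<le> real (card (shifts B w (view a h x + c)))"
      "\<And>x. x \<in> T \<Longrightarrow> R \<le> real (card (shifts B w (view b k x + c')))"
    and m: "m \<ge> 1"
  shows "real (card T) * R\<^sup>2 \<le> (real (card B))\<^sup>2 * (1 + 4 * real w / real m + 2 * (real m)\<^sup>2)"
proof -
  have sg: "sgn h = 1 \<or> sgn h = -1" "sgn k = 1 \<or> sgn k = -1" using h by (auto simp: sgn_if)
  have sh: "card (shifts B w (sgn z * x)) = card (shifts B w x)" if "sgn z = 1 \<or> sgn z = -1" for x z :: real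
    using that card_shifts_uminus[of B w x] B(2) by auto
  show ?thesis
  proof (rule squeeze[OF B(1) T, where s = "\<lambda>x. sgn h * (view a h x + c)" and t = "\<lambda>x. sgn k * (view b k x + c')"])
    fix d d'
    have "{(x, y). x \<in> T \<and> y \<in> T \<and> x < y \<and> sgn h * (view a h y + c) - sgn h * (view a h x + c) = d \<and>
       sgn k * (view b k y + c') - sgn k * (view b k x + c') = d'} =
       {(x, y). x \<in> T \<and> y \<in> T \<and> x < y \<and> view a h y - view a h x = sgn h * d \<and> view b k y - view b k x = sgn k * d'}"
      using sg by (auto simp: algebra_simps)
    then show "card {(x, y). x \<in> T \<and> y \<in> T \<and> x < y \<and> sgn h * (view a h y + c) - sgn h * (view a h x + c) = d \<and>
       sgn k * (view b k y + c') - sgn k * (view b k x + c') = d'} \<le> 2"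
      using view_types[OF h ne] by simp
  next
    show "\<And>x. x \<in> T \<Longrightarrow> R \<le> real (card (shifts B w (sgn h * (view a h x + c))))"
      "\<And>x. x \<in> T \<Longrightarrow> R \<le> real (card (shifts B w (sgn k * (view b k x + c'))))"
      using R sh sg by auto
  qed (use view_less h R m in \<open>auto simp: distrib_left\<close>)
qed

subsection \<open>Rich lines and circles\<close>

text \<open>The factor \<open>\<rho>\<close> may be negative, so \<open>d\<close> is an oriented
  angle between lines, known modulo half turns only; \<open>p = r\<close> is allowed and puts
  multiples of \<open>pi\<close> into \<open>B\<close>. The range 10 covers the sums of views and
  arguments formed below, which stay within \<open>2 * pi\<close>.\<close>

definition holds_angles :: "complex set \<Rightarrow> real set \<Rightarrow> bool" where
  "holds_angles P B \<longleftrightarrow> finite B \<and> (\<forall>x\<in>B. - x \<in> B) \<and>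
     (\<forall>p\<in>P. \<forall>q\<in>P. \<forall>r\<in>P. \<forall>d \<rho>. q \<noteq> p \<longrightarrow> q \<noteq> r \<longrightarrow> \<bar>d\<bar> \<le> 10 \<longrightarrow>
        r - q = of_real \<rho> * cis d * (p - q) \<longrightarrow> d \<in> B)"

lemma holds_anglesD:
  assumes "holds_angles P B"
  shows "finite B" "x \<in> B \<Longrightarrow> - x \<in> B"
    "p \<in> P \<Longrightarrow> q \<in> P \<Longrightarrow> r \<in> P \<Longrightarrow> q \<noteq> p \<Longrightarrow> q \<noteq> r \<Longrightarrow> \<bar>d\<bar> \<le> 10 \<Longrightarrow> r - q = of_real \<rho> * cis d * (p - q) \<Longrightarrow> d \<in> B"
  using assms unfolding holds_angles_def by blast+

text \<open>Polar form of the vector from the observer to \<open>x\<close>, where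
  \<open>- \<i> * h\<close> points to the foot of the perpendicular; it turns differences of
  arctangents into rotations.\<close>

lemma view_cis:
  assumes "h \<noteq> 0"
  obtains \<rho> where "\<rho> > 0" "of_real x - Complex a h = - \<i> * of_real h * of_real \<rho> * cis (view a h x)"
proof
  define u where "u = (x - a) / h"
  have p: "sqrt (1 + u\<^sup>2) > 0" by (simp add: add_pos_nonneg)
  then show "sqrt (1 + u\<^sup>2) > 0" .
  have "of_real (sqrt (1 + u\<^sup>2)) * cis (view a h x) = Complex 1 u"
    using p by (simp add: complex_eq_iff view_def u_def[symmetric] cos_arctan sin_arctan)
  then show "of_real x - Complex a h = - \<i> * of_real h * of_real (sqrt (1 + u\<^sup>2)) * cis (view a h x)"
    using assms by (simp add: mult.assoc complex_eq_iff u_def)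
qed

lemma view_ratio:
  assumes "h \<noteq> 0"
  obtains \<rho> where "\<rho> > 0" "of_real y - Complex a h = of_real \<rho> * cis (view a h y - view a h x) * (of_real x - Complex a h)"
proof -
  obtain r s where rs: "r > 0" "s > 0"
    and x: "of_real x - Complex a h = - \<i> * of_real h * of_real r * cis (view a h x)"
    and y: "of_real y - Complex a h = - \<i> * of_real h * of_real s * cis (view a h y)"
    using view_cis[OF assms] by metis
  have "cis (view a h y) = cis (view a h y - view a h x) * cis (view a h x)" by (simp add: cis_mult)
  then have "of_real y - Complex a h = of_real (s / r) * cis (view a h y - view a h x) * (of_real x - Complex a h)"
    unfolding x y using rs by simp
  then show ?thesis using that[of "s / r"] rs by simp
qed

lemma inj_view: "h \<noteq> 0 \<Longrightarrow> inj (view a h)"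
  by (rule injI) (metis less_irrefl linorder_neqE_linordered_idom view_less)

lemma card_shifts_ge:
  assumes "finite B" "\<And>u. u \<in> U \<Longrightarrow> f u \<in> B \<and> f u + d \<in> B" "inj_on f U"
  shows "card U \<le> card (shifts B (card B) d)"
proof (rule card_inj_on_le[OF assms(3)])
  show "f ` U \<subseteq> shifts B (card B) d"
    using assms by (auto simp: shifts_def intro!: card_mono)
qed (use assms in auto)

text \<open>Only differences of views are angles, hence the view of a base point \<open>x0\<close>
  is subtracted. The shift from \<open>x0\<close> to \<open>x\<close> then has \<open>card T\<close>
  representations, one for every point \<open>u\<close> serving as the common other leg of the two
  angles. The hypothesis \<open>ne\<close> excludes equal observers and mirror images in the line,
  which see the same angles up to sign.\<close>

lemma rich_line:
  assumes P: "holds_angles P B" and d: "d \<noteq> 0" and T: "finite T" "\<And>x. x \<in> T \<Longrightarrow> p + of_real x * d \<in> P"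
    and ab: "a \<in> P" "b \<in> P" "(a - p) / d = Complex a1 h" "(b - p) / d = Complex b1 k" "h \<noteq> 0" "k \<noteq> 0"
    and ne: "\<not> (a1 = b1 \<and> h\<^sup>2 = k\<^sup>2)" and m: "m \<ge> (1::nat)"
  shows "real (card T) * (real (card T))\<^sup>2 \<le> (real (card B))\<^sup>2 * (1 + 4 * real (card B) / real m + 2 * (real m)\<^sup>2)"
proof (cases "T = {}")
  case False
  then obtain x0 where x0: "x0 \<in> T" by blast
  note PD = holds_anglesD[OF P]
  have diff: "view a1 h x - view a1 h y \<in> B" if "x \<in> T" "y \<in> T" "a \<in> P" "(a - p) / d = Complex a1 h" "h \<noteq> 0"
    for x y a a1 h
  proof -
    obtain \<rho> where r: "of_real x - Complex a1 h = of_real \<rho> * cis (view a1 h x - view a1 h y) * (of_real y - Complex a1 h)"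
      using view_ratio[OF \<open>h \<noteq> 0\<close>, of x a1 y] by blast
    have a: "a = p + Complex a1 h * d" using that(4) d by (simp add: field_simps)
    have "p + of_real x * d - a = d * (of_real x - Complex a1 h)" "p + of_real y * d - a = d * (of_real y - Complex a1 h)"
      by (simp_all add: a algebra_simps)
    then have "p + of_real x * d - a = of_real \<rho> * cis (view a1 h x - view a1 h y) * (p + of_real y * d - a)"
      using r by simp
    moreover have "a \<noteq> p + of_real x * d" for x
    proof
      assume "a = p + of_real x * d"
      then have "Complex a1 h = of_real x" using d by (simp add: a)
      then show False using \<open>h \<noteq> 0\<close> by (simp add: complex_eq_iff)
    qed
    moreover have "\<bar>view a1 h x - view a1 h y\<bar> \<le> 10"
      using view_bounds[of a1 h x] view_bounds[of a1 h y] pi_less_4 unfolding abs_le_iff by linarith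
    ultimately show ?thesis using PD(3)[OF T(2)[OF that(2)] that(3) T(2)[OF that(1)]] by blast
  qed
  have rep: "real (card T) \<le> real (card (shifts B (card B) (view a1 h x + (- view a1 h x0))))"
    if "x \<in> T" "a \<in> P" "(a - p) / d = Complex a1 h" "h \<noteq> 0" for x a a1 h
    unfolding of_nat_le_iff
  proof (rule card_shifts_ge[where f = "\<lambda>u. view a1 h x0 - view a1 h u"])
    show "inj_on (\<lambda>u. view a1 h x0 - view a1 h u) T"
      using inj_view[OF that(4), of a1] by (auto simp: inj_on_def inj_def)
    show "view a1 h x0 - view a1 h u \<in> B \<and> view a1 h x0 - view a1 h u + (view a1 h x + (- view a1 h x0)) \<in> B"
      if "u \<in> T" for u
      using diff[OF x0 that \<open>a \<in> P\<close> \<open>(a - p) / d = _\<close> \<open>h \<noteq> 0\<close>] diff[OF \<open>x \<in> T\<close> that \<open>a \<in> P\<close> \<open>(a - p) / d = _\<close> \<open>h \<noteq> 0\<close>]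
      by simp
  qed (rule PD(1))
  show ?thesis
    by (rule squeeze_views[OF PD(1,2) T(1) ab(5,6) ne _ rep[OF _ ab(1,3,5)] rep[OF _ ab(2,4,6)] m]) auto
qed auto

text \<open>The inversion \<open>v \<mapsto> q / (v - p)\<close> maps the circle through \<open>p\<close> with centre \<open>p - q\<close> to the line
  \<open>Re = -1/2\<close>; a point \<open>x\<close> off the circle and the point \<open>\<infinity>\<close> become the two observers.\<close>

lemma rich_circle:
  assumes P: "holds_angles P B" and q: "q \<noteq> 0" and p: "p \<in> P"
    and T: "finite T" "\<And>x. x \<in> T \<Longrightarrow> p + q / Complex (-1/2) x \<in> P"
    and x: "x \<in> P" "cmod (x - (p - q)) \<noteq> cmod q" "x \<noteq> p - q" and m: "m \<ge> (1::nat)"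
  shows "real (card T) * (real (card T) - 1)\<^sup>2 \<le> (real (card B))\<^sup>2 * (1 + 4 * real (card B) / real m + 2 * (real m)\<^sup>2)"
proof (cases "card T \<le> 1")
  case True
  then have "card T = 0 \<or> card T = 1" by auto
  then show ?thesis by auto
next
  case False
  note PD = holds_anglesD[OF P]
  have other: "\<exists>z\<in>T. z \<noteq> y" for y
  proof (rule ccontr)
    assume "\<not> (\<exists>z\<in>T. z \<noteq> y)"
    then have "T \<subseteq> {y}" by auto
    then have "card T \<le> card {y}" by (rule card_mono[rotated]) simp
    with False show False by simp
  qed
  define v where "v = (\<lambda>y. p + q / Complex (-1/2) y)"
  have vP: "v y \<in> P" if "y \<in> T" for y using T(2)[OF that] by (simp add: v_def)
  have w0: "Complex (-1/2) y \<noteq> 0" for y by (simp add: complex_eq_iff)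
  have vp: "v y \<noteq> p" for y using q w0 by (simp add: v_def)
  have xp: "x \<noteq> p" using x(2) by auto
  define a where "a = q / (x - p)"
  have a0: "a \<noteq> 0" using q xp by (simp add: a_def)
  have xa: "x = p + q / a" using xp q by (simp add: a_def)
  define a1 h where "a1 = Im a" and "h = - (Re a + 1/2)"
  have wa: "Complex (-1/2) y - a = \<i> * (of_real y - Complex a1 h)" for y
    by (simp add: complex_eq_iff a1_def h_def)
  have w1: "Complex (-1/2) y = \<i> * (of_real y - Complex 0 (-1/2))" for y
    by (simp add: complex_eq_iff)
  have h: "h \<noteq> 0"
  proof
    assume "h = 0"
    then have "Re a = -1/2" by (simp add: h_def)
    then have "cmod (1 + a) = cmod a" by (simp add: cmod_def)
    have "x - (p - q) = q * (1 + a) / a" using a0 by (simp add: xa field_simps)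
    then have "cmod (x - (p - q)) = cmod q" using \<open>cmod (1 + a) = cmod a\<close> a0
      by (simp add: norm_mult norm_divide)
    with x(2) show False by simp
  qed
  \<comment> \<open>The mirror image of the observer 0 in the line is -1, and this is where the
    inversion sends the centre \<open>p - q\<close>; any other point off the circle gives an
    essentially different observer.\<close>
  have ne: "\<not> (0 = a1 \<and> (-1/2)\<^sup>2 = h\<^sup>2)"
  proof
    assume "0 = a1 \<and> (-1/2)\<^sup>2 = h\<^sup>2"
    then have i: "Im a = 0" and "h\<^sup>2 = (1/2)\<^sup>2" by (auto simp: a1_def power2_eq_square)
    then have "h = 1/2 \<or> h = - (1/2)" using power2_eq_iff by blast
    then have "Re a = -1 \<or> Re a = 0" by (auto simp: h_def)
    then have "a = -1 \<or> a = 0" using i by (auto simp: complex_eq_iff)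
    then have "x = p - q" using a0 by (simp add: xa)
    with x(3) show False by simp
  qed
  let ?t0 = "view 0 (-1/2)"
  have vv: "v y \<noteq> v z" if "y \<noteq> z" for y z
    using that q by (simp add: v_def divide_cancel_left)
  have vdiff: "v z - v y = q * (\<i> * of_real (y - z)) / (Complex (-1/2) y * Complex (-1/2) z)" for y z
  proof -
    have "\<i> * of_real (y - z) = Complex (-1/2) y - Complex (-1/2) z" by (simp add: complex_eq_iff)
    then show ?thesis using w0[of y] w0[of z] by (simp only:) (simp add: v_def field_simps)
  qed
  have b10: "\<bar>?t0 y - ?t0 z\<bar> \<le> 10" for y z
    using view_bounds[of 0 "-1/2" y] view_bounds[of 0 "-1/2" z] pi_less_4 unfolding abs_le_iff by linarith
  \<comment> \<open>Inversion reverses the orientation of directions from \<open>p\<close>, so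
    differences of the view from 0 are angles at \<open>p\<close>.\<close>
  have diff: "?t0 y - ?t0 z \<in> B" if "y \<in> T" "z \<in> T" for y z
  proof -
    obtain \<rho> where r: "\<rho> > 0" "of_real y - Complex 0 (-1/2) = of_real \<rho> * cis (?t0 y - ?t0 z) * (of_real z - Complex 0 (-1/2))"
      using view_ratio[of "-1/2" y 0 z] by auto
    have "Complex (-1/2) y = of_real \<rho> * cis (?t0 y - ?t0 z) * Complex (-1/2) z"
      unfolding w1[of y] w1[of z] r(2) by simp
    then have "v z - p = of_real \<rho> * cis (?t0 y - ?t0 z) * (v y - p)"
      using w0[of y] w0[of z] r(1) by (simp add: v_def field_simps)
    then show ?thesis using PD(3)[OF vP[OF that(1)] p vP[OF that(2)]] vp b10 by metis
  qed
  have rep1: "real (card T) - 1 \<le> real (card (shifts B (card B) (?t0 y + (- ?t0 y0))))" if "y \<in> T" "y0 \<in> T" for y y0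
  proof -
    have "card T \<le> card (shifts B (card B) (?t0 y + (- ?t0 y0)))"
    proof (rule card_shifts_ge[where f = "\<lambda>u. ?t0 y0 - ?t0 u"])
      show "inj_on (\<lambda>u. ?t0 y0 - ?t0 u) T"
        using inj_view[of "-1/2" 0] by (auto simp: inj_on_def inj_def)
      show "?t0 y0 - ?t0 u \<in> B \<and> ?t0 y0 - ?t0 u + (?t0 y + (- ?t0 y0)) \<in> B" if "u \<in> T" for u
        using diff[OF \<open>y0 \<in> T\<close> that] diff[OF \<open>y \<in> T\<close> that] by simp
    qed (rule PD(1))
    then show ?thesis by linarith
  qed
  define c where "c = Arg (1 / (a * \<i>))"
  define K where "K = cmod (1 / (a * \<i>))"
  have ca: "1 / (a * \<i>) = of_real K * cis c"
    unfolding c_def K_def by (rule rcis_cmod_Arg[symmetric, unfolded rcis_def])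
  have cb: "- pi < c" "c \<le> pi" by (auto simp: c_def Arg_bounded)
  \<comment> \<open>The inscribed angle over the chord from \<open>p\<close> to \<open>v z\<close>,
    seen from another point \<open>v y\<close>; it does not depend on \<open>y\<close>.\<close>
  have base: "pi/2 + ?t0 z \<in> B" if z: "z \<in> T" for z
  proof -
    obtain y where y: "y \<in> T" "y \<noteq> z" using other by blast
    obtain \<rho> where r: "\<rho> > 0" "of_real z - Complex 0 (-1/2) = - \<i> * of_real (-1/2) * of_real \<rho> * cis (?t0 z)"
      using view_cis[of "-1/2" z 0] by auto
    have wz: "Complex (-1/2) z = of_real (- \<rho> / 2) * cis (?t0 z)" unfolding w1[of z] r(2) by (simp add: mult.assoc)
    have c: "cis (pi/2 + ?t0 z) = \<i> * cis (?t0 z)" by (simp flip: cis_mult)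
    have "of_real (- \<rho> / (2 * (y - z))) * cis (pi/2 + ?t0 z) * (v z - v y) =
        (of_real (- \<rho> / 2) * cis (?t0 z)) * (\<i> * \<i>) * q / (Complex (-1/2) y * Complex (-1/2) z)"
    proof -
      define D where "D = complex_of_real (y - z)"
      have D: "D \<noteq> 0" "of_real (- \<rho> / (2 * (y - z))) = complex_of_real (- \<rho> / 2) / D"
        using y(2) by (auto simp: D_def)
      show ?thesis unfolding vdiff c D(2) D_def[symmetric] using D(1) by (simp add: mult_ac)
    qed
    also have "\<dots> = p - v y" unfolding wz[symmetric] using w0[of z] by (simp add: v_def)
    finally have "p - v y = of_real (- \<rho> / (2 * (y - z))) * cis (pi/2 + ?t0 z) * (v z - v y)" by simp
    moreover have "\<bar>pi/2 + ?t0 z\<bar> \<le> 10"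
      using view_bounds[of 0 "-1/2" z] pi_less_4 unfolding abs_le_iff by linarith
    ultimately show ?thesis using PD(3)[OF vP[OF z] vP[OF y(1)] p] vp[of y] vv[OF y(2)] by blast
  qed
  have xv: "x \<noteq> v y" for y
  proof
    assume "x = v y"
    then have "a = Complex (-1/2) y" using q by (simp add: xa v_def divide_cancel_left)
    then have "Re a = -1/2" by simp
    then show False using h by (simp add: h_def)
  qed
  \<comment> \<open>The angle at \<open>v y\<close> between \<open>v z\<close> and \<open>x\<close>
    splits into a part depending on \<open>y\<close>, a part depending on \<open>z\<close>, and a
    constant.\<close>
  have shifted: "view a1 h y + ?t0 z + c \<in> B" if yz: "y \<in> T" "z \<in> T" "y \<noteq> z" for y z
  proof -
    obtain \<rho> where r: "\<rho> > 0" "of_real z - Complex 0 (-1/2) = - \<i> * of_real (-1/2) * of_real \<rho> * cis (?t0 z)"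
      using view_cis[of "-1/2" z 0] by auto
    have wz: "Complex (-1/2) z = of_real (- \<rho> / 2) * cis (?t0 z)" unfolding w1[of z] r(2) by (simp add: mult.assoc)
    obtain \<sigma> where s: "\<sigma> > 0" "of_real y - Complex a1 h = - \<i> * of_real h * of_real \<sigma> * cis (view a1 h y)"
      using view_cis[OF h, of y a1] by auto
    have way: "Complex (-1/2) y - a = of_real (h * \<sigma>) * cis (view a1 h y)" unfolding wa[of y] s(2) by (simp add: mult.assoc)
    have "x - v y = q * (Complex (-1/2) y - a) / (Complex (-1/2) y * a)"
      using w0[of y] a0 by (simp add: v_def xa field_simps)
    also have "\<dots> = (Complex (-1/2) y - a) * Complex (-1/2) z * (1 / (a * \<i>)) / of_real (y - z) * (v z - v y)"
    proof -
      define D where "D = complex_of_real (y - z)"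
      have "D \<noteq> 0" using yz(3) by (simp add: D_def)
      then show ?thesis unfolding vdiff D_def[symmetric] using w0[of y] w0[of z] a0 by simp (simp only: mult.commute)
    qed
    also have "\<dots> = of_real (h * \<sigma> * (- \<rho> / 2) * K / (y - z)) *
        (cis (view a1 h y) * cis (?t0 z) * cis c) * (v z - v y)"
      unfolding ca way wz by simp
    finally have "x - v y = of_real (h * \<sigma> * (- \<rho> / 2) * K / (y - z)) *
        cis (view a1 h y + ?t0 z + c) * (v z - v y)" by (simp add: cis_mult)
    moreover have "\<bar>view a1 h y + ?t0 z + c\<bar> \<le> 10"
      using view_bounds[of 0 "-1/2" z] view_bounds[of a1 h y] cb pi_less_4 unfolding abs_le_iff by linarith
    ultimately show ?thesis
      using PD(3)[OF vP[OF yz(2)] vP[OF yz(1)] x(1)] vv[OF yz(3)] xv[of y] by metis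
  qed
  \<comment> \<open>Subtracting the inscribed angle removes \<open>z\<close>, so every
    \<open>z\<close> other than \<open>y\<close> yields a representation of the same shift.\<close>
  have rep2: "real (card T) - 1 \<le> real (card (shifts B (card B) (view a1 h y + (c - pi/2))))" if y: "y \<in> T" for y
  proof -
    have "card (T - {y}) \<le> card (shifts B (card B) (view a1 h y + (c - pi/2)))"
    proof (rule card_shifts_ge[where f = "\<lambda>u. pi/2 + ?t0 u"])
      show "inj_on (\<lambda>u. pi/2 + ?t0 u) (T - {y})"
        using inj_view[of "-1/2" 0] by (auto simp: inj_on_def inj_def)
      show "pi/2 + ?t0 u \<in> B \<and> pi/2 + ?t0 u + (view a1 h y + (c - pi/2)) \<in> B" if "u \<in> T - {y}" for u
        using base[of u] shifted[OF y, of u] that by (auto simp: algebra_simps)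
    qed (rule PD(1))
    then show ?thesis using y T(1) by simp
  qed
  obtain y0 where y0: "y0 \<in> T" using other by blast
  show ?thesis
    by (rule squeeze_views[OF PD(1,2) T(1) _ h ne _ rep1[OF _ y0] rep2 m]) (use False in auto)
qed

subsection \<open>Point-line incidences by repeated bisection\<close>

text \<open>The \<open>k\<close>-th smallest value of \<open>f\<close> on \<open>S\<close>, counted
  with multiplicity.\<close>

definition rank_value :: "'a set \<Rightarrow> nat \<Rightarrow> ('a \<Rightarrow> real) \<Rightarrow> real" where
  "rank_value S k f = Min {f q | q. q \<in> S \<and> k \<le> card {p\<in>S. f p \<le> f q}}"

lemma rank_value:
  assumes S: "finite S" and k: "1 \<le> k" "k \<le> card S"
  shows "rank_value S k f \<in> f ` S" "k \<le> card {p\<in>S. f p \<le> rank_value S k f}"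
    "k \<le> card {p\<in>S. f p \<le> y} \<Longrightarrow> rank_value S k f \<le> y"
    "card {p\<in>S. f p < rank_value S k f} < k"
proof -
  let ?V = "{f q | q. q \<in> S \<and> k \<le> card {p\<in>S. f p \<le> f q}}"
  have fin: "finite ?V" using S by auto
  have le: "\<exists>v\<in>?V. v \<le> y" if y: "k \<le> card {p\<in>S. f p \<le> y}" for y
  proof -
    let ?Y = "{p\<in>S. f p \<le> y}"
    have "?Y \<noteq> {}" using k y by (metis card.empty not_one_le_zero order_trans)
    then obtain q where q: "q \<in> ?Y" "f q = Max (f ` ?Y)"
      using Max_in[of "f ` ?Y"] S by (auto simp: image_iff)
    have "?Y \<subseteq> {p\<in>S. f p \<le> f q}" using S q(2) by auto
    then have "card ?Y \<le> card {p\<in>S. f p \<le> f q}" by (rule card_mono[rotated]) (use S in auto)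
    then have "k \<le> card {p\<in>S. f p \<le> f q}" using y by linarith
    then show ?thesis using q(1) by blast
  qed
  have "{p\<in>S. f p \<le> Max (f ` S)} = S" using S by auto
  then obtain v where "v \<in> ?V" using le[of "Max (f ` S)"] k by auto
  then have "rank_value S k f \<in> ?V" unfolding rank_value_def using fin Min_in by blast
  then show 1: "rank_value S k f \<in> f ` S" "k \<le> card {p\<in>S. f p \<le> rank_value S k f}" by auto
  show 2: "rank_value S k f \<le> y" if "k \<le> card {p\<in>S. f p \<le> y}" for y
    using le[OF that] fin Min_le unfolding rank_value_def by (meson order_trans)
  show "card {p\<in>S. f p < rank_value S k f} < k"
  proof (rule ccontr)
    let ?Y = "{p\<in>S. f p < rank_value S k f}"
    assume "\<not> ?thesis"
    then have c: "k \<le> card ?Y" by simp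
    then have ne: "?Y \<noteq> {}" using k by (metis card.empty not_one_le_zero order_trans)
    have m: "Max (f ` ?Y) \<in> f ` ?Y" using ne S by (intro Max_in) auto
    have "?Y \<subseteq> {p\<in>S. f p \<le> Max (f ` ?Y)}" using S by auto
    then have "card ?Y \<le> card {p\<in>S. f p \<le> Max (f ` ?Y)}" by (rule card_mono[rotated]) (use S in auto)
    then have "rank_value S k f \<le> Max (f ` ?Y)" using 2 c by simp
    then show False using m by auto
  qed
qed

lemma rank_value_perturb:
  assumes S: "finite S" and k: "1 \<le> k" "k \<le> card S" and e: "\<And>p. p \<in> S \<Longrightarrow> g p \<le> f p + e"
  shows "rank_value S k g \<le> rank_value S k f + e"
proof (rule rank_value(3)[OF S k])
  have "g p \<le> rank_value S k f + e" if "p \<in> S" "f p \<le> rank_value S k f" for p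
    using e[OF that(1)] that(2) by linarith
  then have "{p\<in>S. f p \<le> rank_value S k f} \<subseteq> {p\<in>S. g p \<le> rank_value S k f + e}" by blast
  then have "card {p\<in>S. f p \<le> rank_value S k f} \<le> card {p\<in>S. g p \<le> rank_value S k f + e}"
    by (rule card_mono[rotated]) (use S in simp)
  then show "k \<le> card {p\<in>S. g p \<le> rank_value S k f + e}" using rank_value(2)[OF S k, of f] by linarith
qed

text \<open>Points tied at the rank value are divided arbitrarily between the two parts, which makes
  the size of the lower part exactly \<open>k\<close>.\<close>

lemma split_at_rank:
  assumes S: "finite S" and k: "1 \<le> k" "k \<le> card S"
  obtains S1 where "S1 \<subseteq> S" "card S1 = k" "\<And>p. p \<in> S1 \<Longrightarrow> f p \<le> rank_value S k f"
    "\<And>p. p \<in> S - S1 \<Longrightarrow> rank_value S k f \<le> f p"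
proof -
  let ?m = "rank_value S k f"
  have "card {p\<in>S. f p < ?m} \<le> k" using rank_value(4)[OF S k, of f] by simp
  moreover have "{p\<in>S. f p < ?m} \<subseteq> {p\<in>S. f p \<le> ?m}" by (auto simp: less_imp_le)
  ultimately obtain S1 where S1: "{p\<in>S. f p < ?m} \<subseteq> S1" "S1 \<subseteq> {p\<in>S. f p \<le> ?m}" "card S1 = k"
    using exists_subset_between[of "{p\<in>S. f p < ?m}" k "{p\<in>S. f p \<le> ?m}"] rank_value(2)[OF S k, of f] S
    by auto
  show ?thesis
  proof (rule that[of S1])
    show "?m \<le> f p" if "p \<in> S - S1" for p
    proof (rule ccontr)
      assume "\<not> ?m \<le> f p"
      then have "p \<in> {p\<in>S. f p < ?m}" using that by simp
      then show False using S1(1) that by blast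
    qed
  qed (use S1 in auto)
qed

text \<open>A change of slope moves each intercept by at most \<open>M\<close> times that change,
  and order statistics inherit this Lipschitz bound.\<close>

lemma continuous_rank_value:
  fixes S :: "(real \<times> real) set"
  assumes S: "finite S" and k: "1 \<le> k" "k \<le> card S"
  shows "continuous_on UNIV (\<lambda>s. rank_value S k (\<lambda>p. snd p - s * fst p))"
proof -
  define M where "M = (\<Sum>p\<in>S. \<bar>fst p\<bar>)"
  have M: "\<bar>fst p\<bar> \<le> M" if "p \<in> S" for p
    unfolding M_def using member_le_sum[OF that, of "\<lambda>p. \<bar>fst p\<bar>"] S by simp
  have "0 \<le> M" by (simp add: M_def sum_nonneg)
  have one: "rank_value S k (\<lambda>p. snd p - s * fst p) \<le> rank_value S k (\<lambda>p. snd p - t * fst p) + M * \<bar>s - t\<bar>" for s t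
  proof (rule rank_value_perturb[OF S k])
    fix p assume "p \<in> S"
    have "(t - s) * fst p \<le> \<bar>t - s\<bar> * \<bar>fst p\<bar>" by (metis abs_ge_self abs_mult)
    also have "\<dots> \<le> \<bar>t - s\<bar> * M" using M[OF \<open>p \<in> S\<close>] by (simp add: mult_left_mono)
    also have "\<dots> = M * \<bar>s - t\<bar>" by (subst abs_minus_commute) (rule mult.commute)
    finally show "snd p - s * fst p \<le> snd p - t * fst p + M * \<bar>s - t\<bar>"
      unfolding left_diff_distrib by linarith
  qed
  have "M-lipschitz_on UNIV (\<lambda>s. rank_value S k (\<lambda>p. snd p - s * fst p))"
  proof (rule lipschitz_onI[OF _ \<open>0 \<le> M\<close>])
    fix s t :: real
    show "dist (rank_value S k (\<lambda>p. snd p - s * fst p)) (rank_value S k (\<lambda>p. snd p - t * fst p)) \<le> M * dist s t"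
      unfolding dist_real_def
    proof (rule abs_leI)
      have "M * \<bar>t - s\<bar> = M * \<bar>s - t\<bar>" by (subst abs_minus_commute) (rule refl)
      then show "rank_value S k (\<lambda>p. snd p - s * fst p) - rank_value S k (\<lambda>p. snd p - t * fst p) \<le> M * \<bar>s - t\<bar>"
        "- (rank_value S k (\<lambda>p. snd p - s * fst p) - rank_value S k (\<lambda>p. snd p - t * fst p)) \<le> M * \<bar>s - t\<bar>"
        using one[of s t] one[of t s] by linarith+
    qed
  qed
  then show ?thesis by (rule lipschitz_on_continuous_on)
qed

text \<open>Lines are coded by slope and intercept, so vertical ones are absent. Incidences are
  counted for sets with distinct first coordinates, on which a vertical line carries at most one
  point.\<close>

definition on_line :: "real \<times> real \<Rightarrow> real \<times> real \<Rightarrow> bool" where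
  "on_line l p \<longleftrightarrow> snd p = fst l * fst p + snd l"

text \<open>A ham sandwich cut for two sets separated by a vertical line. \<open>S\<close> bounds
  the slopes of all segments from \<open>L\<close> to \<open>R\<close>, so at slope
  \<open>- S\<close> no intercept of \<open>L\<close> is above one of \<open>R\<close>, at slope
  \<open>S\<close> none is below, and the intermediate value theorem applies.\<close>

lemma simultaneous_bisection:
  fixes L R :: "(real \<times> real) set"
  assumes L: "finite L" "1 \<le> k" "k \<le> card L" and R: "finite R" "1 \<le> m" "m \<le> card R"
    and sep: "\<And>p q. p \<in> L \<Longrightarrow> q \<in> R \<Longrightarrow> fst p < fst q"
  obtains a b where "rank_value L k (\<lambda>p. snd p - a * fst p) = b" "rank_value R m (\<lambda>p. snd p - a * fst p) = b"
proof -
  let ?F = "\<lambda>s. rank_value L k (\<lambda>p. snd p - s * fst p)"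
  let ?G = "\<lambda>s. rank_value R m (\<lambda>p. snd p - s * fst p)"
  define S where "S = (\<Sum>(p,q)\<in>L\<times>R. \<bar>snd q - snd p\<bar> / (fst q - fst p))"
  have nn: "0 \<le> \<bar>snd q - snd p\<bar> / (fst q - fst p)" if "p \<in> L" "q \<in> R" for p q
    using sep[OF that] by simp
  have S: "\<bar>snd q - snd p\<bar> \<le> S * (fst q - fst p)" if "p \<in> L" "q \<in> R" for p q
  proof -
    have "\<bar>snd q - snd p\<bar> / (fst q - fst p) \<le> S"
      unfolding S_def
      using member_le_sum[of "(p,q)" "L \<times> R" "\<lambda>(p,q). \<bar>snd q - snd p\<bar> / (fst q - fst p)"] that nn L R by auto
    then show ?thesis using sep[OF that] by (simp add: pos_divide_le_eq)
  qed
  have S0: "0 \<le> S" unfolding S_def by (rule sum_nonneg) (use nn in auto)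
  have c: "continuous_on {-S..S} (\<lambda>s. ?F s - ?G s)"
    using continuous_rank_value[OF L] continuous_rank_value[OF R]
    by (intro continuous_on_diff) (auto intro: continuous_on_subset)
  have ex: "\<exists>p\<in>L. ?F s = snd p - s * fst p" "\<exists>q\<in>R. ?G s = snd q - s * fst q" for s
    using rank_value(1)[OF L, of "\<lambda>p. snd p - s * fst p"] rank_value(1)[OF R, of "\<lambda>p. snd p - s * fst p"]
    by (simp_all only: image_iff)
  have lo: "?F (-S) - ?G (-S) \<le> 0"
  proof -
    obtain p where p: "p \<in> L" "?F (-S) = snd p - (-S) * fst p" using ex(1)[of "-S"] by (rule bexE)
    obtain q where q: "q \<in> R" "?G (-S) = snd q - (-S) * fst q" using ex(2)[of "-S"] by (rule bexE)
    have "snd p - snd q \<le> S * fst q - S * fst p" "snd q - snd p \<le> S * fst q - S * fst p"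
      using S[OF p(1) q(1)] unfolding right_diff_distrib by linarith+
    then show ?thesis unfolding p(2) q(2) by linarith
  qed
  have hi: "0 \<le> ?F S - ?G S"
  proof -
    obtain p where p: "p \<in> L" "?F S = snd p - S * fst p" using ex(1)[of "S"] by (rule bexE)
    obtain q where q: "q \<in> R" "?G S = snd q - S * fst q" using ex(2)[of "S"] by (rule bexE)
    have "snd p - snd q \<le> S * fst q - S * fst p" "snd q - snd p \<le> S * fst q - S * fst p"
      using S[OF p(1) q(1)] unfolding right_diff_distrib by linarith+
    then show ?thesis unfolding p(2) q(2) by linarith
  qed
  have "\<exists>x\<ge>-S. x \<le> S \<and> ?F x - ?G x = 0" by (rule IVT'[OF lo hi _ c]) (use S0 in linarith)
  then obtain a where "?F a - ?G a = 0" by (elim exE conjE)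
  then have "?G a = ?F a" by linarith
  then show ?thesis by (rule that[OF refl])
qed

lemma affine_sign:
  fixes c d :: real
  assumes "c \<noteq> 0 \<or> d \<noteq> 0" and "\<And>x y. x \<in> X \<Longrightarrow> y \<in> Y \<Longrightarrow> x < y"
  shows "(\<forall>x\<in>X. 0 < c * x + d) \<or> (\<forall>x\<in>X. c * x + d < 0) \<or> (\<forall>y\<in>Y. 0 < c * y + d) \<or> (\<forall>y\<in>Y. c * y + d < 0)"
proof (rule ccontr)
  assume "\<not> ?thesis"
  then obtain x1 x2 y1 y2 where xy: "x1 \<in> X" "x2 \<in> X" "y1 \<in> Y" "y2 \<in> Y"
    and s: "c * x1 + d \<le> 0" "0 \<le> c * x2 + d" "c * y1 + d \<le> 0" "0 \<le> c * y2 + d"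
    by (meson not_le)
  have lt: "x1 < y1" "x1 < y2" "x2 < y1" "x2 < y2" using assms(2) xy by auto
  show False
  proof (cases c "0::real" rule: linorder_cases)
    case equal
    then show ?thesis using s assms(1) by auto
  next
    case greater
    then have "c * x2 < c * y1" using lt by simp
    then show ?thesis using s by linarith
  next
    case less
    then have "c * y2 < c * x1" using lt by simp
    then show ?thesis using s by linarith
  qed
qed

text \<open>A non-vertical line other than the bisecting line \<open>h\<close> meets \<open>h\<close> at most once, hence stays on
  one side of \<open>h\<close> above the left half or above the right half.\<close>

lemma four_partition:
  fixes P :: "(real \<times> real) set"
  assumes P: "finite P" and inj: "inj_on fst P"
  obtains h and X :: "nat \<Rightarrow> (real \<times> real) set" where "P = (\<Union>i<4. X i)" "disjoint_family_on X {..<4}"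
    "\<And>i. i < 4 \<Longrightarrow> 4 * card (X i) \<le> card P + 3" "\<And>l. l \<noteq> h \<Longrightarrow> \<exists>i<4. \<forall>p\<in>X i. \<not> on_line l p"
proof (cases "card P \<le> 1")
  case True
  show ?thesis
  proof (rule that[of "\<lambda>i. if i = 0 then P else {}" "(0,0)"])
    show "4 * card (if i = 0 then P else {}) \<le> card P + 3" for i :: nat using True by auto
    show "\<exists>i<4::nat. \<forall>p\<in>(if i = 0 then P else {}). \<not> on_line l p" for l by (rule exI[of _ "1::nat"]) simp
    show "P = (\<Union>i<4::nat. if i = 0 then P else {})" by (auto split: if_splits)
    show "disjoint_family_on (\<lambda>i::nat. if i = 0 then P else {}) {..<4}" by (simp add: disjoint_family_on_def)
  qed
next
  case False
  define k where "k = (card P + 1) div 2"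
  have k: "1 \<le> k" "k \<le> card P" using False by (auto simp: k_def)
  obtain L where L: "L \<subseteq> P" "card L = k" "\<And>p. p \<in> L \<Longrightarrow> fst p \<le> rank_value P k fst"
    "\<And>p. p \<in> P - L \<Longrightarrow> rank_value P k fst \<le> fst p" using split_at_rank[OF P k, of fst] by metis
  define R where "R = P - L"
  have fin: "finite L" "finite R" using P L by (auto simp: R_def intro: finite_subset)
  have cR: "card R = card P - k" using L P by (simp add: R_def card_Diff_subset fin)
  have sep: "fst p < fst q" if "p \<in> L" "q \<in> R" for p q
  proof -
    have "fst p \<le> fst q" using L(3)[OF that(1)] L(4)[of q] that by (auto simp: R_def)
    moreover have "fst p \<noteq> fst q" using that L(1) inj by (auto simp: R_def dest: inj_onD)
    ultimately show ?thesis by simp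
  qed
  define kl kr where "kl = (card L + 1) div 2" and "kr = (card R + 1) div 2"
  have R1: "1 \<le> card R" using False by (simp add: cR k_def)
  have kl: "1 \<le> kl" "kl \<le> card L" using k L(2) by (auto simp: kl_def)
  have kr: "1 \<le> kr" "kr \<le> card R" using R1 by (auto simp: kr_def)
  obtain a b where ab: "rank_value L kl (\<lambda>p. snd p - a * fst p) = b" "rank_value R kr (\<lambda>p. snd p - a * fst p) = b"
    using simultaneous_bisection[OF fin(1) kl fin(2) kr sep] by metis
  obtain L1 where L1: "L1 \<subseteq> L" "card L1 = kl" "\<And>p. p \<in> L1 \<Longrightarrow> snd p - a * fst p \<le> b"
      "\<And>p. p \<in> L - L1 \<Longrightarrow> b \<le> snd p - a * fst p"
    using split_at_rank[OF fin(1) kl, of "\<lambda>p. snd p - a * fst p"] ab(1) by metis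
  obtain R1 where R1: "R1 \<subseteq> R" "card R1 = kr" "\<And>p. p \<in> R1 \<Longrightarrow> snd p - a * fst p \<le> b"
      "\<And>p. p \<in> R - R1 \<Longrightarrow> b \<le> snd p - a * fst p"
    using split_at_rank[OF fin(2) kr, of "\<lambda>p. snd p - a * fst p"] ab(2) by metis
  define X where "X = (\<lambda>i::nat. if i = 0 then L1 else if i = 1 then L - L1 else if i = 2 then R1 else R - R1)"
  have X: "X 0 = L1" "X 1 = L - L1" "X 2 = R1" "X 3 = R - R1" by (auto simp: X_def)
  have four: "{..<4::nat} = {0,1,2,3}" by auto
  have cards: "card (X 0) = kl" "card (X 1) = card L - kl" "card (X 2) = kr" "card (X 3) = card R - kr"
    unfolding X using L1(1,2) R1(1,2) card_Diff_subset[of L1 L] card_Diff_subset[of R1 R]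
      finite_subset[OF L1(1) fin(1)] finite_subset[OF R1(1) fin(2)] by simp_all
  show ?thesis
  proof (rule that[of X "(a,b)"])
    have "(\<Union>i<4. X i) = X 0 \<union> (X 1 \<union> (X 2 \<union> X 3))" unfolding four by blast
    then show "P = (\<Union>i<4. X i)" unfolding X using L(1) L1(1) R1(1) R_def by blast
    have "L1 \<inter> (L - L1) = {}" "L1 \<inter> R1 = {}" "L1 \<inter> (R - R1) = {}" "(L - L1) \<inter> R1 = {}"
      "(L - L1) \<inter> (R - R1) = {}" "R1 \<inter> (R - R1) = {}"
      using L1(1) R1(1) R_def by blast+
    then show "disjoint_family_on X {..<4}" unfolding four disjoint_family_on_def ball_simps X
      by (simp only: Int_commute) blast
    fix i :: nat assume "i < 4"
    then have "i = 0 \<or> i = 1 \<or> i = 2 \<or> i = 3" by auto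
    \<comment> \<open>Halving twice with rounding up loses at most 3 in
      \<open>4 * card (X i)\<close>.\<close>
    moreover have half: "2 * ((c + 1) div 2) \<le> c + 1" "2 * (c - (c + 1) div 2) \<le> c + 1" for c :: nat
      by presburger+
    have "2 * card L \<le> card P + 1" "2 * card R \<le> card P + 1"
      unfolding L(2) cR k_def by (rule half)+
    then have "4 * kl \<le> card P + 3" "4 * (card L - kl) \<le> card P + 3"
      "4 * kr \<le> card P + 3" "4 * (card R - kr) \<le> card P + 3"
      using half[of "card L"] half[of "card R"] unfolding kl_def[symmetric] kr_def[symmetric] by linarith+
    ultimately show "4 * card (X i) \<le> card P + 3" using cards by (elim disjE) simp_all
  next
    fix l assume l: "l \<noteq> (a,b)"
    \<comment> \<open>\<open>c * x + d\<close> is the height of \<open>l\<close> above the bisecting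
      line at abscissa \<open>x\<close>.\<close>
    define c d where "c = fst l - a" and "d = snd l - b"
    have cd: "c \<noteq> 0 \<or> d \<noteq> 0" using l by (auto simp: c_def d_def prod_eq_iff)
    have on: "snd p - a * fst p - b = c * fst p + d" if "on_line l p" for p
      using that by (simp add: on_line_def c_def d_def left_diff_distrib)
    consider "\<forall>x\<in>fst ` L. 0 < c * x + d" | "\<forall>x\<in>fst ` L. c * x + d < 0"
      | "\<forall>x\<in>fst ` R. 0 < c * x + d" | "\<forall>x\<in>fst ` R. c * x + d < 0"
    proof -
      have "x < y" if "x \<in> fst ` L" "y \<in> fst ` R" for x y using that sep by blast
      from affine_sign[OF cd this] show ?thesis using that by blast
    qed
    then show "\<exists>i<4. \<forall>p\<in>X i. \<not> on_line l p"
    proof cases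
      case 1
      have "\<not> on_line l p" if "p \<in> X 0" for p
      proof
        assume o: "on_line l p"
        have p: "p \<in> L1" "p \<in> L" using that L1(1) unfolding X by auto
        have "0 < c * fst p + d" using 1 p(2) by simp
        then show False using on[OF o] L1(3)[OF p(1)] by linarith
      qed
      then show ?thesis by (intro exI[of _ "0"] conjI) simp_all
    next
      case 2
      have "\<not> on_line l p" if "p \<in> X 1" for p
      proof
        assume o: "on_line l p"
        have p: "p \<in> L - L1" "p \<in> L" using that L1(1) unfolding X by auto
        have "c * fst p + d < 0" using 2 p(2) by simp
        then show False using on[OF o] L1(4)[OF p(1)] by linarith
      qed
      then show ?thesis by (intro exI[of _ "1"] conjI) simp_all
    next
      case 3
      have "\<not> on_line l p" if "p \<in> X 2" for p
      proof
        assume o: "on_line l p"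
        have p: "p \<in> R1" "p \<in> R" using that R1(1) unfolding X by auto
        have "0 < c * fst p + d" using 3 p(2) by simp
        then show False using on[OF o] R1(3)[OF p(1)] by linarith
      qed
      then show ?thesis by (intro exI[of _ "2"] conjI) simp_all
    next
      case 4
      have "\<not> on_line l p" if "p \<in> X 3" for p
      proof
        assume o: "on_line l p"
        have p: "p \<in> R - R1" "p \<in> R" using that R1(1) unfolding X by auto
        have "c * fst p + d < 0" using 4 p(2) by simp
        then show False using on[OF o] R1(4)[OF p(1)] by linarith
      qed
      then show ?thesis by (intro exI[of _ "3"] conjI) simp_all
    qed
  qed
qed

abbreviation pts :: "(real \<times> real) set \<Rightarrow> real \<times> real \<Rightarrow> nat" where
  "pts P l \<equiv> card {p\<in>P. on_line l p}"

lemma on_line_unique: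
  assumes "on_line l p" "on_line l q" "on_line l' p" "on_line l' q" "fst p \<noteq> fst q"
  shows "l = l'"
proof -
  have "(fst l - fst l') * (fst p - fst q) = 0" using assms by (simp add: on_line_def algebra_simps)
  then have "fst l = fst l'" using assms by simp
  moreover from this have "snd l = snd l'" using assms by (simp add: on_line_def)
  ultimately show ?thesis by (simp add: prod_eq_iff)
qed

lemma card_off_diagonal:
  assumes "finite A"
  shows "real (card {(p,q). p \<in> A \<and> q \<in> A \<and> p \<noteq> q}) = real (card A) * (real (card A) - 1)"
proof -
  have "{(p,q). p \<in> A \<and> q \<in> A \<and> p \<noteq> q} = A \<times> A - (\<lambda>x. (x,x)) ` A" by auto
  then have "card {(p,q). p \<in> A \<and> q \<in> A \<and> p \<noteq> q} = card (A \<times> A) - card ((\<lambda>x. (x,x)) ` A)"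
    using assms by (simp only:) (rule card_Diff_subset, auto)
  also have "card ((\<lambda>x. (x,x)) ` A) = card A" by (rule card_image) (simp add: inj_on_def)
  finally have "card {(p,q). p \<in> A \<and> q \<in> A \<and> p \<noteq> q} = card A * card A - card A" by (simp add: card_cartesian_product)
  moreover have "card A \<le> card A * card A" by (cases "card A") auto
  ultimately show ?thesis by (simp add: of_nat_diff algebra_simps)
qed

text \<open>Two points lie on at most one of the lines, so the lines own disjoint sets of ordered
  pairs; and \<open>x \<le> 1 + x * (x - 1) / 2\<close> for a line with \<open>x\<close>
  points.\<close>

lemma incidences_trivial:
  assumes P: "finite P" "inj_on fst P" and F: "finite F"
  shows "(\<Sum>l\<in>F. real (pts P l)) \<le> real (card F) + real (card P) * (real (card P) - 1) / 2"
proof -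
  define D where "D = {(p,q). p \<in> P \<and> q \<in> P \<and> p \<noteq> q}"
  have finD: "finite D" by (rule finite_subset[of _ "P \<times> P"]) (use P in \<open>auto simp: D_def\<close>)
  have cD: "real (card D) = real (card P) * (real (card P) - 1)"
    unfolding D_def by (rule card_off_diagonal[OF P(1)])
  define E where "E = (\<lambda>l. {(p,q)\<in>D. on_line l p \<and> on_line l q})"
  have cE: "real (card (E l)) = real (pts P l) * (real (pts P l) - 1)" for l
  proof -
    have "E l = {(p,q). p \<in> {p\<in>P. on_line l p} \<and> q \<in> {p\<in>P. on_line l p} \<and> p \<noteq> q}"
      by (auto simp: E_def D_def)
    then show ?thesis using card_off_diagonal[of "{p\<in>P. on_line l p}"] P(1) by simp
  qed
  have uniq: "l = l'" if "x \<in> E l" "x \<in> E l'" for l l' x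
  proof -
    obtain p q where pq: "p \<in> P" "q \<in> P" "p \<noteq> q" "on_line l p" "on_line l q" "on_line l' p" "on_line l' q"
      using \<open>x \<in> E l\<close> \<open>x \<in> E l'\<close> unfolding E_def D_def by blast
    have "fst p \<noteq> fst q" using pq(1-3) P(2) by (meson inj_onD)
    with pq(4-7) show ?thesis by (rule on_line_unique)
  qed
  have "(\<Sum>l\<in>F. card (E l)) = card (\<Union>l\<in>F. E l)"
  proof (rule card_UN_disjoint[symmetric, OF F])
    have "E l \<subseteq> D" for l by (auto simp: E_def)
    then show "\<forall>l\<in>F. finite (E l)" using finD finite_subset by blast
    show "\<forall>l\<in>F. \<forall>l'\<in>F. l \<noteq> l' \<longrightarrow> E l \<inter> E l' = {}"
      using uniq by blast
  qed
  also have "\<dots> \<le> card D" by (rule card_mono[OF finD]) (auto simp: E_def)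
  finally have "(\<Sum>l\<in>F. real (card (E l))) \<le> real (card D)" by (metis of_nat_le_iff of_nat_sum)
  then have s: "(\<Sum>l\<in>F. real (card (E l)) / 2) \<le> real (card D) / 2"
    by (simp add: sum_divide_distrib[symmetric])
  have "(\<Sum>l\<in>F. real (pts P l)) \<le> (\<Sum>l\<in>F. 1 + real (card (E l)) / 2)"
  proof (rule sum_mono)
    fix l
    define x where "x = pts P l"
    have "0 \<le> (real x - 1) * (real x - 2)"
    proof (cases "x \<le> 1")
      case True
      then show ?thesis by (intro mult_nonpos_nonpos) simp_all
    next
      case False
      then have "2 \<le> x" by simp
      then show ?thesis by (intro mult_nonneg_nonneg) simp_all
    qed
    then have "real x \<le> 1 + real x * (real x - 1) / 2" by (simp add: field_simps)
    then show "real (pts P l) \<le> 1 + real (card (E l)) / 2"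
      by (simp only: cE x_def)
  qed
  also have "\<dots> \<le> real (card F) + real (card D) / 2" using s by (simp add: sum.distrib)
  finally show ?thesis by (simp add: cD)
qed

text \<open>Each of the \<open>j\<close> rounds of quartering pays at most \<open>card P\<close> for
  the bisecting lines, at most triples the number of pairs of a line and a part met by it, and
  divides the quadratic term by 4.\<close>

lemma incidences_bound:
  assumes "finite P" "inj_on fst P" "finite F"
  shows "(\<Sum>l\<in>F. real (pts P l)) \<le> real (card P) * real j + 3 ^ j * real (card F)
      + real (card P) * (real (card P) - 1) / (2 * 4 ^ j)"
  using assms
proof (induction j arbitrary: P F)
  case 0
  then show ?case using incidences_trivial[of P F] by simp
next
  case (Suc j)
  obtain h and X :: "nat \<Rightarrow> (real \<times> real) set" where X: "P = (\<Union>i<4. X i)" "disjoint_family_on X {..<4}"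
    "\<And>i. i < 4 \<Longrightarrow> 4 * card (X i) \<le> card P + 3" "\<And>l. l \<noteq> h \<Longrightarrow> \<exists>i<4. \<forall>p\<in>X i. \<not> on_line l p"
    using four_partition[OF Suc.prems(1,2)] by metis
  have sub: "X i \<subseteq> P" if "i < 4" for i using that X(1) by auto
  have finX: "finite (X i)" if "i < 4" for i using sub[OF that] Suc.prems(1) finite_subset by blast
  have injX: "inj_on fst (X i)" if "i < 4" for i using sub[OF that] Suc.prems(2) inj_on_subset by blast
  have cX: "(\<Sum>i<4. card (X i)) = card P"
    unfolding X(1) by (rule card_UN_disjoint'[symmetric, OF X(2)]) (use finX in auto)
  define F' where "F' = F - {h}"
  have finF': "finite F'" using Suc.prems by (simp add: F'_def)
  define Fi where "Fi = (\<lambda>i. {l\<in>F'. \<exists>p\<in>X i. on_line l p})"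
  have finFi: "finite (Fi i)" for i using finF' by (simp add: Fi_def)
  have pts: "pts P l = (\<Sum>i<4. pts (X i) l)" for l
  proof -
    have "{p\<in>P. on_line l p} = (\<Union>i<4. {p\<in>X i. on_line l p})" using X(1) by auto
    moreover have "disjoint_family_on (\<lambda>i. {p\<in>X i. on_line l p}) {..<4}"
      using X(2) by (auto simp: disjoint_family_on_def)
    ultimately show ?thesis using card_UN_disjoint'[of "\<lambda>i. {p\<in>X i. on_line l p}" "{..<4}"] finX by simp
  qed
  have sF: "(\<Sum>i<4. card (Fi i)) \<le> 3 * card F"
  proof -
    have "(\<Sum>i<4. card (Fi i)) = (\<Sum>i<4. \<Sum>l\<in>F'. if \<exists>p\<in>X i. on_line l p then 1 else 0)"
      unfolding card_eq_sum Fi_def by (intro sum.cong refl sum.inter_filter finF')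
    also have "\<dots> = (\<Sum>l\<in>F'. \<Sum>i<4. if \<exists>p\<in>X i. on_line l p then 1 else 0)" by (rule sum.swap)
    also have "\<dots> \<le> (\<Sum>l\<in>F'. 3)"
    proof (rule sum_mono)
      fix l assume "l \<in> F'"
      then obtain i where i: "i < 4" "\<forall>p\<in>X i. \<not> on_line l p" using X(4)[of l] by (auto simp: F'_def)
      have "(\<Sum>i<4. if \<exists>p\<in>X i. on_line l p then 1 else (0::nat)) =
          (\<Sum>i\<in>{..<4}-{i}. if \<exists>p\<in>X i. on_line l p then 1 else 0)"
        by (subst sum.remove[of _ i]) (use i in auto)
      also have "\<dots> \<le> (\<Sum>i\<in>{..<4}-{i}. 1)" by (rule sum_mono) auto
      also have "\<dots> = 3" using i by simp
      finally show "(\<Sum>i<4. if \<exists>p\<in>X i. on_line l p then 1 else (0::nat)) \<le> 3" .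
    qed
    also have "\<dots> \<le> 3 * card F" using card_mono[of F F'] Suc.prems by (auto simp: F'_def)
    finally show ?thesis .
  qed
  have "(\<Sum>l\<in>F. real (pts P l)) \<le> real (card P) + (\<Sum>l\<in>F'. real (pts P l))"
  proof (cases "h \<in> F")
    case True
    have "pts P h \<le> card P" by (rule card_mono) (use Suc.prems in auto)
    then show ?thesis using sum.remove[OF Suc.prems(3) True, of "\<lambda>l. real (pts P l)"] by (simp add: F'_def)
  next
    case False
    then show ?thesis by (simp add: F'_def)
  qed
  also have "(\<Sum>l\<in>F'. real (pts P l)) = (\<Sum>i<4. \<Sum>l\<in>F'. real (pts (X i) l))"
    unfolding pts of_nat_sum by (rule sum.swap)
  also have "\<dots> = (\<Sum>i<4. \<Sum>l\<in>Fi i. real (pts (X i) l))"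
  proof (rule sum.cong[OF refl])
    fix i
    have z: "pts (X i) l = 0" if "l \<in> F' - Fi i" for l
    proof -
      have "{p\<in>X i. on_line l p} = {}" using that by (auto simp: Fi_def)
      then show ?thesis by (simp only: card.empty)
    qed
    show "(\<Sum>l\<in>F'. real (pts (X i) l)) = (\<Sum>l\<in>Fi i. real (pts (X i) l))"
      by (rule sum.mono_neutral_right) (use finF' z in \<open>auto simp: Fi_def\<close>)
  qed
  also have "\<dots> \<le> (\<Sum>i<4. real (card (X i)) * real j + 3 ^ j * real (card (Fi i))
      + real (card (X i)) * (real (card P) - 1) / (2 * 4 ^ Suc j))"
  proof (rule sum_mono)
    fix i :: nat assume "i \<in> {..<4}"
    then have i: "i < 4" by simp
    have "real (4 * card (X i)) \<le> real (card P + 3)" using X(3)[OF i] by (rule of_nat_mono)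
    \<comment> \<open>The rounding loss of 3 is exactly absorbed by writing the quadratic term as
      \<open>x * (x - 1)\<close>.\<close>
    then have "real (card (X i)) - 1 \<le> (real (card P) - 1) / 4" by simp
    then have "real (card (X i)) * (real (card (X i)) - 1) \<le> real (card (X i)) * ((real (card P) - 1) / 4)"
      by (rule mult_left_mono) simp
    then have "real (card (X i)) * (real (card (X i)) - 1) / (2 * 4 ^ j) \<le> real (card (X i)) * ((real (card P) - 1) / 4) / (2 * 4 ^ j)"
      by (rule divide_right_mono) simp
    then show "(\<Sum>l\<in>Fi i. real (pts (X i) l)) \<le> real (card (X i)) * real j + 3 ^ j * real (card (Fi i))
      + real (card (X i)) * (real (card P) - 1) / (2 * 4 ^ Suc j)"
      using Suc.IH[OF finX[OF i] injX[OF i] finFi[of i]] by simp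
  qed
  also have "\<dots> = real (card P) * real j + 3 ^ j * real (\<Sum>i<4. card (Fi i)) + real (card P) * (real (card P) - 1) / (2 * 4 ^ Suc j)"
    by (simp add: sum.distrib sum_distrib_left sum_distrib_right sum_divide_distrib flip: cX)
  also have "3 ^ j * real (\<Sum>i<4. card (Fi i)) \<le> 3 ^ j * real (3 * card F)"
    by (rule mult_left_mono, unfold of_nat_le_iff, rule sF) simp
  finally show ?case by (simp add: algebra_simps)
qed

definition line_through :: "real \<times> real \<Rightarrow> real \<times> real \<Rightarrow> real \<times> real" where
  "line_through p q = (let a = (snd q - snd p) / (fst q - fst p) in (a, snd p - a * fst p))"

lemma on_line_through:
  assumes "fst p \<noteq> fst q"
  shows "on_line (line_through p q) p" "on_line (line_through p q) q"
proof -
  define a where "a = (snd q - snd p) / (fst q - fst p)"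
  have "a * (fst q - fst p) = snd q - snd p" using assms by (simp add: a_def)
  then have "snd q = a * fst q + (snd p - a * fst p)" unfolding right_diff_distrib by linarith
  then show "on_line (line_through p q) p" "on_line (line_through p q) q"
    unfolding on_line_def line_through_def Let_def a_def[symmetric] fst_conv snd_conv by simp_all
qed

lemma sum_powers_three_quarters: "L \<le> Suc J \<Longrightarrow> (\<Sum>j=L..J. (3/4::real) ^ j) \<le> 4 * (3/4) ^ L - 4 * (3/4) ^ Suc J"
proof (induction J)
  case 0
  then have "L = 0 \<or> L = 1" by auto
  then show ?case by auto
next
  case (Suc J)
  show ?case
  proof (cases "L = Suc (Suc J)")
    case False
    then have "L \<le> Suc J" using Suc.prems by simp
    then have "(\<Sum>j=L..Suc J. (3/4::real) ^ j) = (\<Sum>j=L..J. (3/4::real) ^ j) + (3/4) ^ Suc J"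
      by (simp add: sum.cl_ivl_Suc)
    also have "\<dots> \<le> 4 * (3/4) ^ L - 4 * (3/4) ^ Suc J + (3/4) ^ Suc J" using Suc.IH[OF \<open>L \<le> Suc J\<close>] by simp
    finally show ?thesis by simp
  qed simp
qed

lemma sum_powers_three: "(\<Sum>j=L..J. (3::real) ^ j) \<le> 3 ^ Suc J / 2"
proof -
  have "(\<Sum>j=L..J. (3::real) ^ j) \<le> (\<Sum>j=0..J. 3 ^ j)" by (rule sum_mono2) auto
  also have "\<dots> \<le> 3 ^ Suc J / 2" by (induction J) (auto simp: sum.cl_ivl_Suc)
  finally show ?thesis .
qed

text \<open>Dyadic summation of the incidence bound: a weak form of Beck's theorem.\<close>

theorem few_pairs_on_rich_lines:
  assumes P: "finite P" "inj_on fst P" and M: "\<And>l. real (pts P l) \<le> M" and J: "2 * 3 ^ J \<le> M" "M < 2 * 3 ^ Suc J"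
  shows "real (card {(p,q). p \<in> P \<and> q \<in> P \<and> p \<noteq> q \<and> 2 * 3 ^ L \<le> pts P (line_through p q)})
    \<le> 9 * real (card P) * real J * M + 24 * (real (card P))\<^sup>2 * (3/4) ^ L"
proof (cases "L \<le> J")
  case False
  have "{(p,q). p \<in> P \<and> q \<in> P \<and> p \<noteq> q \<and> 2 * 3 ^ L \<le> pts P (line_through p q)} = {}"
  proof -
    have "\<not> 2 * 3 ^ L \<le> pts P l" for l
    proof
      assume "2 * 3 ^ L \<le> pts P l"
      then have "real (2 * 3 ^ L) \<le> real (pts P l)" by (rule of_nat_mono)
      also have "\<dots> \<le> M" by (rule M)
      also have "\<dots> < 2 * 3 ^ Suc J" by (rule J)
      also have "\<dots> \<le> 2 * 3 ^ L" using False power_increasing[of "Suc J" L "3::real"] by simp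
      finally show False by simp
    qed
    then show ?thesis by blast
  qed
  moreover have "0 \<le> M" using J(1) by (smt (verit) zero_le_power)
  ultimately show ?thesis by (simp only: card.empty) simp
next
  case True
  let ?n = "real (card P)"
  let ?bad = "{(p,q). p \<in> P \<and> q \<in> P \<and> p \<noteq> q \<and> 2 * 3 ^ L \<le> pts P (line_through p q)}"
  define F where "F = (\<lambda>j. {l. 2 * 3 ^ j \<le> pts P l \<and> pts P l < 2 * 3 ^ Suc j})"
  define V where "V = (\<lambda>l. {p\<in>P. on_line l p})"
  have finV: "finite (V l)" for l using P by (simp add: V_def)
  have finF: "finite (F j)" for j
  proof (rule finite_subset[of _ "(\<lambda>(p,q). line_through p q) ` (P \<times> P)"])
    show "F j \<subseteq> (\<lambda>(p,q). line_through p q) ` (P \<times> P)"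
    proof
      fix l assume "l \<in> F j"
      then have "2 * 3 ^ j \<le> card (V l)" by (simp add: F_def V_def)
      moreover have "1 \<le> (3::nat) ^ j" by simp
      ultimately have "2 \<le> card (V l)" by linarith
      then obtain S where "S \<subseteq> V l" "card S = 2" by (meson obtain_subset_with_card_n)
      then obtain p q where pq: "p \<in> V l" "q \<in> V l" "p \<noteq> q" by (metis card_2_iff insert_subset)
      then have ne: "fst p \<noteq> fst q" using P(2) by (auto simp: V_def dest: inj_onD)
      have "l = line_through p q"
        by (rule on_line_unique[OF _ _ on_line_through[OF ne] ne]) (use pq in \<open>auto simp: V_def\<close>)
      then show "l \<in> (\<lambda>(p,q). line_through p q) ` (P \<times> P)" using pq by (auto simp: V_def)
    qed
  qed (use P in auto)
  have "?bad \<subseteq> (\<Union>j\<in>{L..J}. \<Union>l\<in>F j. V l \<times> V l)"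
  proof
    fix x assume "x \<in> ?bad"
    then obtain p q where x: "x = (p,q)" and pq: "p \<in> P" "q \<in> P" "p \<noteq> q" and b: "2 * 3 ^ L \<le> pts P (line_through p q)"
      by blast
    define l where "l = line_through p q"
    have ne: "fst p \<noteq> fst q" using pq P(2) by (auto dest: inj_onD)
    have V: "p \<in> V l" "q \<in> V l" using on_line_through[OF ne] pq by (auto simp: V_def l_def)
    define j where "j = Max {j. 2 * 3 ^ j \<le> pts P l}"
    have up: "j \<le> J" if "2 * 3 ^ j \<le> pts P l" for j
    proof (rule ccontr)
      assume "\<not> j \<le> J"
      then have "2 * 3 ^ Suc J \<le> (2 * 3 ^ j :: real)" using power_increasing[of "Suc J" j "3::real"] by simp
      also have "\<dots> \<le> real (pts P l)" using of_nat_mono[OF that, where ?'a = real] by simp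
      also have "\<dots> \<le> M" by (rule M)
      finally show False using J(2) by simp
    qed
    then have fin: "finite {j. 2 * 3 ^ j \<le> pts P l}" by (auto intro: finite_subset[of _ "{..J}"])
    have L: "L \<in> {j. 2 * 3 ^ j \<le> pts P l}" using b by (simp add: l_def)
    then have j: "2 * 3 ^ j \<le> pts P l" using Max_in[OF fin] unfolding j_def by blast
    have "L \<le> j" unfolding j_def by (rule Max_ge[OF fin L])
    have "pts P l < 2 * 3 ^ Suc j"
    proof (rule ccontr)
      assume "\<not> ?thesis"
      then have "Suc j \<le> j" unfolding j_def by (intro Max_ge[OF fin]) (simp add: j_def)
      then show False by simp
    qed
    then have "l \<in> F j" using j by (simp add: F_def)
    then show "x \<in> (\<Union>j\<in>{L..J}. \<Union>l\<in>F j. V l \<times> V l)" using V \<open>L \<le> j\<close> up[OF j] x by auto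
  qed
  then have "card ?bad \<le> card (\<Union>j\<in>{L..J}. \<Union>l\<in>F j. V l \<times> V l)"
    by (rule card_mono[rotated]) (use finF finV in auto)
  also have "\<dots> \<le> (\<Sum>j=L..J. card (\<Union>l\<in>F j. V l \<times> V l))" by (rule card_UN_le) simp
  also have "\<dots> \<le> (\<Sum>j=L..J. \<Sum>l\<in>F j. card (V l \<times> V l))" by (intro sum_mono card_UN_le finF)
  finally have "real (card ?bad) \<le> (\<Sum>j=L..J. \<Sum>l\<in>F j. real (pts P l) * real (pts P l))"
    by (simp only: card_cartesian_product V_def of_nat_le_iff flip: of_nat_mult of_nat_sum)
  also have "\<dots> \<le> (\<Sum>j=L..J. 12 * ?n * real J * 3 ^ j + 6 * ?n\<^sup>2 * (3/4) ^ j)"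
  proof (rule sum_mono)
    fix j assume j: "j \<in> {L..J}"
    let ?S = "\<Sum>l\<in>F j. real (pts P l)"
    have Fl: "2 * 3 ^ j \<le> real (pts P l) \<and> real (pts P l) \<le> 6 * 3 ^ j" if "l \<in> F j" for l
    proof -
      have "2 * 3 ^ j \<le> pts P l" "pts P l \<le> 6 * 3 ^ j" using that by (auto simp: F_def)
      then have "real (2 * 3 ^ j) \<le> real (pts P l)" "real (pts P l) \<le> real (6 * 3 ^ j)" unfolding of_nat_le_iff .
      then show ?thesis by simp
    qed
    \<comment> \<open>Each line of the class has at least \<open>2 * 3 ^ j\<close> points, so the
      term \<open>3 ^ j * card (F j)\<close> of the incidence bound is at most half of the
      incidences and can be absorbed; this is the reason for the factor 2 in the thresholds.\<close>
    have "(\<Sum>l\<in>F j. 2 * 3 ^ j) \<le> ?S" by (rule sum_mono) (use Fl in blast)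
    then have "2 * (3 ^ j * real (card (F j))) \<le> ?S" by (simp add: mult_ac)
    moreover have "?S \<le> ?n * real j + 3 ^ j * real (card (F j)) + ?n * (?n - 1) / (2 * 4 ^ j)"
      by (rule incidences_bound[OF P finF])
    ultimately have "?S \<le> 2 * (?n * real j) + 2 * (?n * (?n - 1) / (2 * 4 ^ j))" by linarith
    also have "2 * (?n * (?n - 1) / (2 * 4 ^ j)) = ?n * (?n - 1) / 4 ^ j" by simp
    also have "\<dots> \<le> ?n\<^sup>2 / 4 ^ j" by (intro divide_right_mono) (simp_all add: power2_eq_square algebra_simps)
    also have "2 * (?n * real j) \<le> 2 * (?n * real J)" using j by (intro mult_left_mono) auto
    finally have S: "?S \<le> 2 * (?n * real J) + ?n\<^sup>2 / 4 ^ j" by simp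
    have "(\<Sum>l\<in>F j. real (pts P l) * real (pts P l)) \<le> (\<Sum>l\<in>F j. 6 * 3 ^ j * real (pts P l))"
      by (intro sum_mono mult_right_mono) (use Fl in auto)
    also have "\<dots> = 6 * 3 ^ j * ?S" by (simp add: sum_distrib_left)
    also have "\<dots> \<le> 6 * 3 ^ j * (2 * (?n * real J) + ?n\<^sup>2 / 4 ^ j)" using S by (intro mult_left_mono) auto
    also have "\<dots> = 12 * ?n * real J * 3 ^ j + 6 * ?n\<^sup>2 * (3/4) ^ j"
      unfolding power_divide distrib_left by simp
    finally show "(\<Sum>l\<in>F j. real (pts P l) * real (pts P l)) \<le> 12 * ?n * real J * 3 ^ j + 6 * ?n\<^sup>2 * (3/4) ^ j" .
  qed
  also have "\<dots> = 12 * ?n * real J * (\<Sum>j=L..J. 3 ^ j) + 6 * ?n\<^sup>2 * (\<Sum>j=L..J. (3/4) ^ j)"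
    by (simp add: sum.distrib sum_distrib_left)
  also have "\<dots> \<le> 12 * ?n * real J * (3/4 * M) + 6 * ?n\<^sup>2 * (4 * (3/4) ^ L)"
  proof (intro add_mono mult_left_mono)
    show "(\<Sum>j=L..J. (3::real) ^ j) \<le> 3/4 * M" using sum_powers_three[of L J] J(1) by simp
    show "(\<Sum>j=L..J. (3/4::real) ^ j) \<le> 4 * (3/4) ^ L"
    proof -
      have "0 \<le> (3/4::real) ^ Suc J" by simp
      then show ?thesis using sum_powers_three_quarters[OF le_SucI[OF True]] by linarith
    qed
  qed auto
  finally show ?thesis by (simp add: mult_ac)
qed

subsection \<open>Clusters seen under small angles\<close>

text \<open>The new condition \<open>j\<close> splits exactly the patterns that occur on both of its
  sides.\<close>

lemma card_patterns_insert:
  fixes Q :: "'i \<Rightarrow> 'a \<Rightarrow> bool"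
  assumes "finite I"
  shows "card ((\<lambda>x. {i\<in>insert j I. Q i x}) ` X) \<le> card ((\<lambda>x. {i\<in>I. Q i x}) ` X) +
    card ((\<lambda>x. {i\<in>I. Q i x}) ` {x\<in>X. Q j x} \<inter> (\<lambda>x. {i\<in>I. Q i x}) ` {x\<in>X. \<not> Q j x})"
proof -
  let ?p = "\<lambda>x. {i\<in>I. Q i x}"
  let ?A = "?p ` {x\<in>X. Q j x}" and ?B = "?p ` {x\<in>X. \<not> Q j x}"
  have fin: "finite ?A" "finite ?B" by (rule finite_subset[of _ "Pow I"]; use assms in auto)+
  have "(\<lambda>x. {i\<in>insert j I. Q i x}) ` X \<subseteq> insert j ` ?A \<union> ?B"
  proof (rule image_subsetI)
    fix x assume "x \<in> X"
    show "{i\<in>insert j I. Q i x} \<in> insert j ` ?A \<union> ?B"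
    proof (cases "Q j x")
      case True
      then have "{i\<in>insert j I. Q i x} = insert j (?p x)" by auto
      then show ?thesis using \<open>x \<in> X\<close> True by blast
    next
      case False
      then have "{i\<in>insert j I. Q i x} = ?p x" by auto
      then show ?thesis using \<open>x \<in> X\<close> False by blast
    qed
  qed
  then have "card ((\<lambda>x. {i\<in>insert j I. Q i x}) ` X) \<le> card (insert j ` ?A \<union> ?B)"
    by (rule card_mono[rotated]) (use fin in auto)
  also have "\<dots> \<le> card (insert j ` ?A) + card ?B" by (rule card_Un_le)
  also have "\<dots> \<le> card ?A + card ?B" using card_image_le[OF fin(1)] by simp
  also have "\<dots> = card (?A \<union> ?B) + card (?A \<inter> ?B)" by (rule card_Un_Int[OF fin])
  also have "?A \<union> ?B = ?p ` X" by blast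
  finally show ?thesis .
qed

text \<open>On the segment from \<open>x\<close> to \<open>y\<close> the function \<open>f j\<close>
  has a zero, while each \<open>f i\<close> with \<open>i \<in> I\<close> keeps the sign that it has
  at both ends.\<close>

lemma affine_zero_between:
  fixes f :: "'i \<Rightarrow> 'a::real_vector \<Rightarrow> real"
  assumes aff: "\<And>i u x y. f i ((1 - u) *\<^sub>R x + u *\<^sub>R y) = (1 - u) * f i x + u * f i y"
    and same: "\<And>i. i \<in> I \<Longrightarrow> 0 \<le> f i x \<longleftrightarrow> 0 \<le> f i y" and j: "0 \<le> f j x" "f j y < 0"
  obtains w where "f j w = 0" "\<And>i. i \<in> I \<Longrightarrow> 0 \<le> f i w \<longleftrightarrow> 0 \<le> f i x"
proof -
  define u where "u = f j x / (f j x - f j y)"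
  have u: "0 \<le> u" "u < 1" using j by (simp_all add: u_def divide_less_eq)
  define w where "w = (1 - u) *\<^sub>R x + u *\<^sub>R y"
  have "u * (f j x - f j y) = f j x" using j by (simp add: u_def)
  then have "f j w = 0" unfolding w_def aff by (simp add: algebra_simps)
  moreover have "0 \<le> f i w \<longleftrightarrow> 0 \<le> f i x" if "i \<in> I" for i
  proof (cases "0 \<le> f i x")
    case True
    then have "0 \<le> f i y" using same[OF that] by simp
    then have "0 \<le> (1 - u) * f i x + u * f i y" using True u by (intro add_nonneg_nonneg mult_nonneg_nonneg) auto
    then show ?thesis using True by (simp add: w_def aff)
  next
    case False
    then have "f i y < 0" using same[OF that] by simp
    then have "u * f i y \<le> 0" using u by (simp add: mult_nonneg_nonpos)
    moreover have "(1 - u) * f i x < 0" using False u by (simp add: mult_pos_neg)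
    ultimately show ?thesis using False by (simp add: w_def aff)
  qed
  ultimately show ?thesis by (rule that)
qed

text \<open>A pattern split by \<open>j\<close> is realised at the unique zero of the function
  \<open>j\<close>, so each new condition adds at most one pattern.\<close>

lemma card_patterns_real:
  fixes a b :: "'i \<Rightarrow> real"
  assumes "finite I"
  shows "card (range (\<lambda>t. {i\<in>I. 0 \<le> a i * t + b i})) \<le> card I + 1"
  using assms
proof (induction I rule: finite_induct)
  case empty
  then show ?case by simp
next
  case (insert j I)
  let ?p = "\<lambda>t. {i\<in>I. 0 \<le> a i * t + b i}"
  have "?p ` {x\<in>UNIV. 0 \<le> a j * x + b j} \<inter> ?p ` {x\<in>UNIV. \<not> 0 \<le> a j * x + b j} \<subseteq> {?p (- b j / a j)}"
  proof
    fix S assume "S \<in> ?p ` {x\<in>UNIV. 0 \<le> a j * x + b j} \<inter> ?p ` {x\<in>UNIV. \<not> 0 \<le> a j * x + b j}"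
    then obtain x y where xy: "S = ?p x" "?p x = ?p y" "0 \<le> a j * x + b j" "a j * y + b j < 0" by auto
    have aj: "a j \<noteq> 0" using xy(3,4) by auto
    have same: "0 \<le> a i * x + b i \<longleftrightarrow> 0 \<le> a i * y + b i" if "i \<in> I" for i
      using xy(2) that by blast
    obtain w where w: "a j * w + b j = 0" "\<And>i. i \<in> I \<Longrightarrow> 0 \<le> a i * w + b i \<longleftrightarrow> 0 \<le> a i * x + b i"
      by (rule affine_zero_between[of "\<lambda>i t. a i * t + b i" I x y j])
         (use same xy(3,4) in \<open>simp_all add: algebra_simps\<close>)
    have "w = - b j / a j" using w(1) aj by (simp add: field_simps)
    then show "S \<in> {?p (- b j / a j)}" using w(2) xy(1) by auto
  qed
  then have "card (?p ` {x\<in>UNIV. 0 \<le> a j * x + b j} \<inter> ?p ` {x\<in>UNIV. \<not> 0 \<le> a j * x + b j}) \<le> 1"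
    using card_mono[of "{?p (- b j / a j)}"] by fastforce
  then show ?case
    using card_patterns_insert[OF insert.hyps(1), of j "\<lambda>i t. 0 \<le> a i * t + b i" UNIV] insert by simp
qed

text \<open>A pattern split by \<open>j\<close> is realised on the line where \<open>f j\<close>
  vanishes, and along that line at most \<open>card I + 1\<close> patterns occur.\<close>

lemma card_patterns_plane:
  fixes a b c :: "'i \<Rightarrow> real"
  assumes "finite I"
  shows "card (range (\<lambda>z. {i\<in>I. 0 \<le> a i * Re z + b i * Im z + c i})) \<le> (card I)\<^sup>2 + 1"
  using assms
proof (induction I rule: finite_induct)
  case empty
  then show ?case by simp
next
  case (insert j I)
  define f where "f = (\<lambda>i z. a i * Re z + b i * Im z + c i)"
  let ?p = "\<lambda>z. {i\<in>I. 0 \<le> f i z}"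
  let ?A = "?p ` {z\<in>UNIV. 0 \<le> f j z} \<inter> ?p ` {z\<in>UNIV. \<not> 0 \<le> f j z}"
  have sub: "\<exists>w. f j w = 0 \<and> ?p w = S \<and> (a j \<noteq> 0 \<or> b j \<noteq> 0)" if S: "S \<in> ?A" for S
  proof -
    obtain x y where xy: "S = ?p x" "?p x = ?p y" "0 \<le> f j x" "f j y < 0" using S by auto
    have same: "0 \<le> f i x \<longleftrightarrow> 0 \<le> f i y" if "i \<in> I" for i
      using xy(2) that by blast
    have aff: "f i ((1 - u) *\<^sub>R x + u *\<^sub>R y) = (1 - u) * f i x + u * f i y" for i u x y
      by (simp add: f_def algebra_simps)
    obtain w where w: "f j w = 0" "\<And>i. i \<in> I \<Longrightarrow> 0 \<le> f i w \<longleftrightarrow> 0 \<le> f i x"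
      using affine_zero_between[of f I x y j, OF aff same xy(3,4)] by blast
    have "a j \<noteq> 0 \<or> b j \<noteq> 0" using xy(3,4) by (auto simp: f_def)
    then show ?thesis using w xy(1) by blast
  qed
  have "card ?A \<le> card I + 1"
  proof (cases "?A = {}")
    case False
    then obtain S where "S \<in> ?A" by blast
    from sub[OF this] obtain w0 where w0: "f j w0 = 0" and ab: "a j \<noteq> 0 \<or> b j \<noteq> 0" by blast
    define u where "u = Complex (- b j) (a j)"
    have par: "\<exists>t. w = w0 + of_real t * u" if "f j w = 0" for w
    proof -
      have "a j * Re (w - w0) + b j * Im (w - w0) = f j w - f j w0"
        unfolding f_def minus_complex.sel right_diff_distrib by linarith
      then have e: "a j * Re (w - w0) + b j * Im (w - w0) = 0" using that w0 by simp
      have "\<exists>t. Re (w - w0) = - b j * t \<and> Im (w - w0) = a j * t"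
      proof (cases "a j = 0")
        case True
        then have "b j \<noteq> 0" "Im (w - w0) = 0" using ab e by auto
        then show ?thesis using True by (intro exI[of _ "- Re (w - w0) / b j"]) simp
      next
        case False
        have e': "a j * Re (w - w0) = - (b j * Im (w - w0))" using e by linarith
        have "Re (w - w0) = (a j * Re (w - w0)) / a j" using False by simp
        also have "\<dots> = - b j * (Im (w - w0) / a j)" unfolding e' by simp
        finally have "Re (w - w0) = - b j * (Im (w - w0) / a j)" .
        moreover have "Im (w - w0) = a j * (Im (w - w0) / a j)" using False by simp
        ultimately show ?thesis by blast
      qed
      then obtain t where "Re (w - w0) = - b j * t" "Im (w - w0) = a j * t" by blast
      then have "w - w0 = of_real t * u" by (intro complex_eqI) (simp_all add: u_def)
      then have "w = w0 + of_real t * u" by (metis add.commute diff_add_cancel)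
      then show ?thesis by blast
    qed
    let ?q = "\<lambda>t. {i\<in>I. 0 \<le> (a i * Re u + b i * Im u) * t + f i w0}"
    have "f i (w0 + of_real t * u) = (a i * Re u + b i * Im u) * t + f i w0" for i t
      unfolding f_def by (simp add: algebra_simps)
    then have pq: "?p (w0 + of_real t * u) = ?q t" for t by simp
    have "?A \<subseteq> range ?q"
    proof
      fix S assume "S \<in> ?A"
      from sub[OF this] obtain w where "f j w = 0" "?p w = S" by blast
      moreover from this obtain t where "w = w0 + of_real t * u" using par by blast
      ultimately have "S = ?q t" using pq[of t] by simp
      then show "S \<in> range ?q" by blast
    qed
    then have "card ?A \<le> card (range ?q)"
      by (rule card_mono[rotated]) (rule finite_subset[of _ "Pow I"], use insert.hyps in auto)
    also have "\<dots> \<le> card I + 1" by (rule card_patterns_real[OF insert.hyps(1)])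
    finally show ?thesis .
  qed (simp only: card.empty)
  moreover have "(card I)\<^sup>2 + 1 + (card I + 1) \<le> (card (insert j I))\<^sup>2 + 1"
    using insert.hyps by (simp add: power2_eq_square)
  ultimately show ?case
    using card_patterns_insert[OF insert.hyps(1), of j "\<lambda>i z. 0 \<le> f i z" UNIV] insert.IH
    unfolding f_def[symmetric] by (simp add: f_def)
qed

text \<open>By averaging, some \<open>w\<close> separates at least the fraction
  \<open>D / card W\<close> of the elements of \<open>E\<close> that are still unseparated; such
  choices are repeated \<open>r\<close> times.\<close>

lemma greedy_separation:
  fixes sep :: "'w \<Rightarrow> 'e \<Rightarrow> bool"
  assumes W: "finite W" "W \<noteq> {}" and E: "finite E" and D: "D \<le> real (card W)"
    and far: "\<And>e. e \<in> E \<Longrightarrow> D \<le> real (card {w\<in>W. sep w e})"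
  shows "\<exists>R\<subseteq>W. card R \<le> r \<and> real (card {e\<in>E. \<forall>w\<in>R. \<not> sep w e}) \<le> real (card E) * (1 - D / real (card W)) ^ r"
proof (induction r)
  case 0
  show ?case by (intro exI[of _ "{}"]) auto
next
  case (Suc r)
  then obtain R where R: "R \<subseteq> W" "card R \<le> r" "real (card {e\<in>E. \<forall>w\<in>R. \<not> sep w e}) \<le> real (card E) * (1 - D / real (card W)) ^ r"
    by blast
  let ?E = "{e\<in>E. \<forall>w\<in>R. \<not> sep w e}"
  have finE: "finite ?E" using E by simp
  have cW: "real (card W) > 0" using W by (simp add: card_gt_0_iff)
  have "\<exists>w\<in>W. real (card ?E) * D / real (card W) \<le> real (card {e\<in>?E. sep w e})"
  proof (rule ccontr)
    assume "\<not> ?thesis"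
    then have lt: "real (card {e\<in>?E. sep w e}) < real (card ?E) * D / real (card W)" if "w \<in> W" for w
      using that by (meson not_le)
    have "real (card ?E) * D = (\<Sum>e\<in>?E. D)" by simp
    also have "\<dots> \<le> (\<Sum>e\<in>?E. real (card {w\<in>W. sep w e}))" by (rule sum_mono) (use far in auto)
    also have "\<dots> = (\<Sum>e\<in>?E. \<Sum>w\<in>W. if sep w e then 1 else 0)"
      by (rule sum.cong[OF refl]) (simp add: sum.inter_filter[OF W(1), symmetric])
    also have "\<dots> = (\<Sum>w\<in>W. \<Sum>e\<in>?E. if sep w e then 1 else 0)" by (rule sum.swap)
    also have "\<dots> = (\<Sum>w\<in>W. real (card {e\<in>?E. sep w e}))"
      by (rule sum.cong[OF refl]) (simp only: sum.inter_filter[OF finE, symmetric] sum_constant mult_1_right)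
    also have "\<dots> < (\<Sum>w\<in>W. real (card ?E) * D / real (card W))" by (rule sum_strict_mono[OF W lt])
    also have "\<dots> = real (card ?E) * D" using cW by simp
    finally show False by simp
  qed
  then obtain w where w: "w \<in> W" "real (card ?E) * D / real (card W) \<le> real (card {e\<in>?E. sep w e})" by blast
  have "{e\<in>E. \<forall>w\<in>insert w R. \<not> sep w e} = ?E - {e\<in>?E. sep w e}" by auto
  then have "card {e\<in>E. \<forall>w\<in>insert w R. \<not> sep w e} = card ?E - card {e\<in>?E. sep w e}"
    using E by (simp only:) (rule card_Diff_subset, auto)
  moreover have "card {e\<in>?E. sep w e} \<le> card ?E" by (rule card_mono[OF finE]) auto
  ultimately have "real (card {e\<in>E. \<forall>w\<in>insert w R. \<not> sep w e}) = real (card ?E) - real (card {e\<in>?E. sep w e})"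
    by (simp add: of_nat_diff)
  also have "\<dots> \<le> real (card ?E) * (1 - D / real (card W))" using w(2) by (simp add: right_diff_distrib)
  also have "\<dots> \<le> real (card E) * (1 - D / real (card W)) ^ r * (1 - D / real (card W))"
    using R(3) D cW by (intro mult_right_mono) (simp_all add: divide_le_eq)
  finally have "real (card {e\<in>E. \<forall>w\<in>insert w R. \<not> sep w e}) \<le> real (card E) * (1 - D / real (card W)) ^ Suc r"
    by (simp add: mult_ac)
  moreover have "insert w R \<subseteq> W" using w R by auto
  moreover have "card (insert w R) \<le> Suc r" using R(2) card_insert_le_m1[of "Suc r" R w] by simp
  ultimately show ?case by blast
qed

text \<open>At most \<open>r\<close> half-planes, chosen greedily, separate every pair of points
  that at least \<open>D\<close> half-planes separate. They distinguish at most
  \<open>r\<^sup>2 + 1\<close> classes of points, so some class has more than \<open>m\<close>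
  elements; pairs in one class are not separated by the chosen half-planes, hence by fewer than
  \<open>D\<close> of all.\<close>

theorem cluster_exists:
  fixes a b c :: "'w \<Rightarrow> real"
  assumes W: "finite W" "W \<noteq> {}" and Q: "finite Q" and D: "D \<le> real (card W)"
    and r: "(real (card Q))\<^sup>2 * (1 - D / real (card W)) ^ r < 1" and m: "m * (r\<^sup>2 + 1) < card Q"
  obtains C where "C \<subseteq> Q" "m < card C"
    "\<And>x y. x \<in> C \<Longrightarrow> y \<in> C \<Longrightarrow>
      real (card {w\<in>W. (0 \<le> a w * Re x + b w * Im x + c w) \<noteq> (0 \<le> a w * Re y + b w * Im y + c w)}) < D"
proof -
  define f where "f = (\<lambda>w z. a w * Re z + b w * Im z + c w)"
  define sep where "sep = (\<lambda>w (x,y). (0 \<le> f w x) \<noteq> (0 \<le> f w y))"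
  define E where "E = {e\<in>Q\<times>Q. D \<le> real (card {w\<in>W. sep w e})}"
  have E: "finite E" using Q by (simp add: E_def)
  obtain R where R: "R \<subseteq> W" "card R \<le> r" "real (card {e\<in>E. \<forall>w\<in>R. \<not> sep w e}) \<le> real (card E) * (1 - D / real (card W)) ^ r"
    using greedy_separation[OF W E D, of sep r] by (auto simp: E_def)
  have cW: "real (card W) > 0" using W by (simp add: card_gt_0_iff)
  have "card E \<le> card (Q \<times> Q)" by (rule card_mono) (use Q in \<open>auto simp: E_def\<close>)
  then have "real (card E) \<le> (real (card Q))\<^sup>2"
    by (simp add: card_cartesian_product power2_eq_square flip: of_nat_mult)
  then have "real (card E) * (1 - D / real (card W)) ^ r \<le> (real (card Q))\<^sup>2 * (1 - D / real (card W)) ^ r"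
    using D cW by (intro mult_right_mono) (simp_all add: divide_le_eq)
  then have "real (card {e\<in>E. \<forall>w\<in>R. \<not> sep w e}) < 1" using R(3) r by linarith
  then have "card {e\<in>E. \<forall>w\<in>R. \<not> sep w e} = 0" by simp
  then have none: "{e\<in>E. \<forall>w\<in>R. \<not> sep w e} = {}" using E by simp
  let ?p = "\<lambda>z. {w\<in>R. 0 \<le> f w z}"
  have finR: "finite R" using R(1) W finite_subset by blast
  have "card (?p ` Q) \<le> card (range ?p)"
    by (rule card_mono) (auto intro!: finite_subset[of "range ?p" "Pow R"] simp: finR)
  also have "\<dots> \<le> (card R)\<^sup>2 + 1" unfolding f_def by (rule card_patterns_plane[OF finR])
  also have "\<dots> \<le> r\<^sup>2 + 1" using R(2) by (simp add: power_mono)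
  finally have cp: "card (?p ` Q) \<le> r\<^sup>2 + 1" .
  have "\<exists>S\<in>?p ` Q. m < card {x\<in>Q. ?p x = S}"
  proof (rule ccontr)
    assume "\<not> ?thesis"
    then have "card Q \<le> m * card (?p ` Q)" by (intro card_le_fibres Q) auto
    also have "\<dots> \<le> m * (r\<^sup>2 + 1)" using cp by (rule mult_le_mono2)
    finally show False using m by simp
  qed
  then obtain S where S: "m < card {x\<in>Q. ?p x = S}" by blast
  show ?thesis
  proof (rule that[of "{x\<in>Q. ?p x = S}"])
    fix x y assume xy: "x \<in> {x\<in>Q. ?p x = S}" "y \<in> {x\<in>Q. ?p x = S}"
    then have "\<not> sep w (x,y)" if "w \<in> R" for w
      using that unfolding sep_def by blast
    then have "(x,y) \<notin> E" using none by blast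
    then show "real (card {w\<in>W. (0 \<le> a w * Re x + b w * Im x + c w) \<noteq> (0 \<le> a w * Re y + b w * Im y + c w)}) < D"
      using xy by (auto simp: E_def sep_def f_def)
  qed (use S in auto)
qed

subsection \<open>Few angles force a rich line or circle\<close>

text \<open>The direction of \<open>x\<close> from \<open>v\<close>, measured from the downward
  vertical, for \<open>x\<close> below \<open>v\<close>. Below \<open>v\<close> there is a
  continuous choice of the angle, so a difference of slants is the angle at \<open>v\<close> without
  any correction by full turns.\<close>

definition slant :: "complex \<Rightarrow> complex \<Rightarrow> real" where
  "slant v x = arctan ((Re x - Re v) / (Im v - Im x))"

lemma slant_bounds: "- (pi/2) < slant v x" "slant v x < pi/2"
  using arctan_bounded by (auto simp: slant_def)

lemma slant_cis:
  assumes "Im x < Im v"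
  obtains \<rho> where "\<rho> > 0" "x - v = - \<i> * of_real \<rho> * cis (slant v x)"
proof -
  define Y u where "Y = Im v - Im x" and "u = (Re x - Re v) / Y"
  have Y: "Y > 0" using assms by (simp add: Y_def)
  have s: "sqrt (1 + u\<^sup>2) > 0" by (simp add: add_pos_nonneg)
  have "of_real (sqrt (1 + u\<^sup>2)) * cis (slant v x) = Complex 1 u"
    using s by (simp add: complex_eq_iff slant_def Y_def[symmetric] u_def[symmetric] cos_arctan sin_arctan)
  then have "- \<i> * of_real (Y * sqrt (1 + u\<^sup>2)) * cis (slant v x) = - \<i> * of_real Y * Complex 1 u"
    by (simp add: mult.assoc)
  also have "\<dots> = x - v" using Y by (simp add: complex_eq_iff u_def) (simp add: Y_def)
  finally show ?thesis using that[of "Y * sqrt (1 + u\<^sup>2)"] Y s by simp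
qed

lemma slant_ratio:
  assumes "Im x < Im v" "Im q < Im v"
  obtains \<rho> where "\<rho> > 0" "x - v = of_real \<rho> * cis (slant v x - slant v q) * (q - v)"
proof -
  obtain r where r: "r > 0" "x - v = - \<i> * of_real r * cis (slant v x)" using slant_cis[OF assms(1)] .
  obtain s where s: "s > 0" "q - v = - \<i> * of_real s * cis (slant v q)" using slant_cis[OF assms(2)] .
  have "cis (slant v x) = cis (slant v x - slant v q) * cis (slant v q)" by (simp add: cis_mult)
  then have "x - v = of_real (r / s) * cis (slant v x - slant v q) * (q - v)"
    unfolding r(2) s(2) using s(1) by simp
  then show ?thesis using that[of "r / s"] r s by simp
qed

text \<open>A threshold direction cuts out a half-plane with boundary through \<open>v\<close>;
  thresholds outside the range of \<open>slant\<close> give constant conditions. This makes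
  \<open>cluster_exists\<close> applicable to angles.\<close>

lemma slant_half_plane:
  obtains a b c where "\<And>x. Im x < Im v \<Longrightarrow> s \<le> slant v x \<longleftrightarrow> 0 \<le> a * Re x + b * Im x + (c::real)"
proof -
  consider "pi/2 \<le> s" | "s \<le> - (pi/2)" | "- (pi/2) < s" "s < pi/2" by linarith
  then show ?thesis
  proof cases
    case 1
    then have "\<not> s \<le> slant v x" for x using slant_bounds(2)[of v x] by linarith
    then show ?thesis using that[of 0 0 "-1"] by simp
  next
    case 2
    then have "s \<le> slant v x" for x using slant_bounds(1)[of v x] by linarith
    then show ?thesis using that[of 0 0 0] by simp
  next
    case 3
    show ?thesis
    proof (rule that[of 1 "tan s" "- Re v - tan s * Im v"])
      fix x assume "Im x < Im v"
      then have Y: "Im v - Im x > 0" by simp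
      have "s = arctan (tan s)" using arctan_tan[OF 3] by simp
      then have "s \<le> slant v x \<longleftrightarrow> tan s \<le> (Re x - Re v) / (Im v - Im x)"
        unfolding slant_def by (metis arctan_le_iff)
      also have "\<dots> \<longleftrightarrow> tan s * (Im v - Im x) \<le> Re x - Re v" using Y by (simp add: pos_le_divide_eq)
      also have "\<dots> \<longleftrightarrow> 0 \<le> 1 * Re x + tan s * Im x + (- Re v - tan s * Im v)"
        unfolding right_diff_distrib by linarith
      finally show "s \<le> slant v x \<longleftrightarrow> 0 \<le> 1 * Re x + tan s * Im x + (- Re v - tan s * Im v)" .
    qed
  qed
qed

lemma slant_diff_in:
  assumes P: "holds_angles P B" and "v \<in> P" "x \<in> P" "q \<in> P" "Im x < Im v" "Im q < Im v"
  shows "slant v x - slant v q \<in> B"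
proof -
  obtain \<rho> where "x - v = of_real \<rho> * cis (slant v x - slant v q) * (q - v)"
    using slant_ratio[OF assms(5,6)] by blast
  moreover have "\<bar>slant v x - slant v q\<bar> \<le> 10"
    using slant_bounds[of v x] slant_bounds[of v q] pi_less_4 unfolding abs_le_iff by linarith
  ultimately show ?thesis using holds_anglesD(3)[OF P assms(4,2,3)] assms(5,6) by blast
qed

text \<open>A row that fails has at least \<open>card Q / 2\<close> bad entries, so at most
  \<open>2/25\<close> of the rows fail, which is less than a tenth.\<close>

lemma many_good_rows:
  assumes V: "finite V" and Q: "finite Q" "Q \<noteq> {}" and bad: "bad \<subseteq> V \<times> Q"
    and c: "25 * real (card bad) \<le> real (card V) * real (card Q)"
  shows "real (card {v\<in>V. real (card Q) / 2 \<le> real (card {q\<in>Q. (v,q) \<notin> bad})}) \<ge> 9/10 * real (card V)"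
proof -
  define G where "G = {v\<in>V. real (card Q) / 2 \<le> real (card {q\<in>Q. (v,q) \<notin> bad})}"
  define W where "W = V - G"
  define N where "N = (\<lambda>v. {q\<in>Q. (v,q) \<in> bad})"
  have fin: "finite bad" "finite W" "\<And>v. finite (N v)" using bad V Q finite_subset by (auto simp: W_def N_def)
  have N: "real (card Q) / 2 \<le> real (card (N v))" if "v \<in> W" for v
  proof -
    have lt: "real (card {q\<in>Q. (v,q) \<notin> bad}) < real (card Q) / 2" using that by (auto simp: W_def G_def)
    have "Q = {q\<in>Q. (v,q) \<notin> bad} \<union> N v" by (auto simp: N_def)
    then have "card Q \<le> card {q\<in>Q. (v,q) \<notin> bad} + card (N v)" by (metis card_Un_le)
    then show ?thesis using lt by linarith
  qed
  have "real (card W) * (real (card Q) / 2) = (\<Sum>v\<in>W. real (card Q) / 2)" by simp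
  also have "\<dots> \<le> (\<Sum>v\<in>W. real (card (N v)))" by (rule sum_mono) (rule N)
  also have "\<dots> = real (card (SIGMA v:W. N v))" using fin by (simp add: card_SigmaI)
  also have "\<dots> \<le> real (card bad)" unfolding of_nat_le_iff by (rule card_mono[OF fin(1)]) (auto simp: N_def)
  finally have "25 * (real (card W) * (real (card Q) / 2)) \<le> real (card V) * real (card Q)" using c by linarith
  moreover have "25 * (real (card W) * (real (card Q) / 2)) = (25 / 2 * real (card W)) * real (card Q)" by simp
  ultimately have "(25 / 2 * real (card W)) * real (card Q) \<le> real (card V) * real (card Q)" by linarith
  moreover have "real (card Q) > 0" using Q by (simp add: card_gt_0_iff)
  ultimately have "25 / 2 * real (card W) \<le> real (card V)" by (simp only: mult_le_cancel_right_pos)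
  moreover have "card W = card V - card G" unfolding W_def by (rule card_Diff_subset) (use V in \<open>auto simp: G_def\<close>)
  moreover have "card G \<le> card V" by (rule card_mono) (use V in \<open>auto simp: G_def\<close>)
  ultimately have "real (card G) \<ge> 9/10 * real (card V)" by (simp add: of_nat_diff)
  then show ?thesis by (simp add: G_def)
qed

lemma cis_eqD:
  assumes "of_real r * cis a = of_real s * cis b" "r > 0" "s > (0::real)" "\<bar>a - b\<bar> < 4 * pi"
  obtains m :: int where "m \<in> {-1,0,1}" "a = b + 2 * pi * of_int m"
proof -
  have "cmod (of_real r * cis a) = cmod (of_real s * cis b)" using assms(1) by simp
  then have "r = s" using assms(2,3) by (simp add: norm_mult)
  then have "cis a = cis b" using assms by simp
  then have "sin a = sin b \<and> cos a = cos b" by (simp add: complex_eq_iff)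
  then obtain m where m: "a = b + 2 * pi * of_int m" unfolding sin_cos_eq_iff by (auto simp: mult.assoc)
  have "2 * pi * \<bar>of_int m\<bar> < 2 * pi * 2" using assms(4) by (simp add: m abs_mult)
  then have "\<bar>real_of_int m\<bar> < 2" using mult_less_cancel_left_pos[of "2 * pi" "\<bar>real_of_int m\<bar>" 2] by simp
  then have "m \<in> {-1,0,1}" by auto
  then show ?thesis using that m by blast
qed

lemma pigeonhole_fibre:
  assumes "finite A" "finite S" "f ` A \<subseteq> S" "A \<noteq> {}"
  obtains y where "y \<in> S" "card A \<le> card S * card {x\<in>A. f x = y}"
proof -
  have "\<exists>y\<in>S. card A \<le> card S * card {x\<in>A. f x = y}"
  proof (rule ccontr)
    assume "\<not> ?thesis"
    then have lt: "card S * card {x\<in>A. f x = y} < card A" if "y \<in> S" for y using that by (meson not_le)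
    have S: "S \<noteq> {}" using assms by auto
    have "card A = (\<Sum>y\<in>S. card {x\<in>A. f x = y})"
      using sum.group[OF assms(1,2,3), of "\<lambda>_. 1::nat"] by simp
    then have "card S * card A = (\<Sum>y\<in>S. card S * card {x\<in>A. f x = y})" by (simp add: sum_distrib_left)
    also have "\<dots> < (\<Sum>y\<in>S. card A)" by (rule sum_strict_mono[OF assms(2) S lt])
    finally show False by simp
  qed
  then show ?thesis using that by blast
qed

text \<open>All \<open>v \<in> U\<close> see \<open>x\<close> and \<open>y\<close> under the same angle \<open>g\<close>; inversion at \<open>x\<close> carries \<open>U\<close> to a line
  through \<open>1 / (y - x)\<close>, viewed from the images of \<open>z\<close> and \<open>z'\<close>.\<close>

lemma pencil_bound:
  assumes B: "finite B" "\<And>x. x \<in> B \<Longrightarrow> - x \<in> B" and U: "finite U" "U \<noteq> {}"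
    and lower: "\<And>v. v \<in> U \<Longrightarrow> Im x < Im v \<and> Im y < Im v \<and> Im z < Im v \<and> Im z' < Im v"
    and ne: "x \<noteq> y" "x \<noteq> z" "x \<noteq> z'" "y \<noteq> z" "y \<noteq> z'" "z \<noteq> z'"
    and g: "\<And>v. v \<in> U \<Longrightarrow> slant v y - slant v x = g"
    and e1: "\<And>v. v \<in> U \<Longrightarrow> Im ((1/(v-x) - 1/(y-x)) / (1/(z-x) - 1/(y-x))) \<noteq> 0"
    and e2: "\<And>v. v \<in> U \<Longrightarrow> Im ((1/(v-x) - 1/(y-x)) / (1/(z'-x) - 1/(y-x))) \<noteq> 0"
    and e3: "\<And>v. v \<in> U \<Longrightarrow> cmod (1/(v-x) - 1/(z-x)) \<noteq> cmod (1/(v-x) - 1/(z'-x))"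
    and R: "0 \<le> R" "\<And>v. v \<in> U \<Longrightarrow> R \<le> real (card (shifts B k (slant v z - slant v x)))"
      "\<And>v. v \<in> U \<Longrightarrow> R \<le> real (card (shifts B k (slant v z' - slant v x)))"
    and m: "m \<ge> (1::nat)"
  shows "real (card U) * R\<^sup>2 \<le> 9 * ((real (card B))\<^sup>2 * (1 + 4 * real k / real m + 2 * (real m)\<^sup>2))"
proof -
  \<comment> \<open>Direction of the image line: \<open>1 / (v - x) - 1 / (y - x)\<close> is a
    positive multiple of \<open>d\<close> when \<open>v\<close> sees the pair under the angle
    \<open>g\<close>.\<close>
  define d where "d = - cis g / (y - x)"
  define w where "w = (\<lambda>v. 1 / (v - x))"
  have d0: "d \<noteq> 0" using ne by (simp add: d_def)
  have vx: "v \<noteq> x" if "v \<in> U" for v using lower[OF that] by auto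
  have wdiff: "w v - 1 / (p - x) = (p - v) / ((v - x) * (p - x))" if "v \<in> U" "p \<noteq> x" for v p
  proof -
    have "v - x \<noteq> 0" "p - x \<noteq> 0" using vx[OF that(1)] that(2) by auto
    then show ?thesis by (simp add: w_def diff_frac_eq)
  qed
  have "\<exists>t. w v = 1 / (y - x) + of_real t * d" if v: "v \<in> U" for v
  proof -
    have "Im y < Im v" "Im x < Im v" using lower[OF v] by auto
    then obtain \<rho> where r: "\<rho> > 0" "y - v = of_real \<rho> * cis (slant v y - slant v x) * (x - v)"
      using slant_ratio by blast
    have "w v - 1 / (y - x) = (y - v) / ((v - x) * (y - x))" using wdiff[OF v] ne(1) by simp
    also have "\<dots> = of_real \<rho> * d" unfolding r(2) g[OF v] d_def
      using vx[OF v] ne by (simp add: divide_simps) (simp add: algebra_simps)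
    finally show ?thesis by (intro exI[of _ \<rho>]) (simp add: algebra_simps)
  qed
  then obtain \<tau> where \<tau>: "w v = 1 / (y - x) + of_real (\<tau> v) * d" if "v \<in> U" for v by metis
  have inj: "inj_on \<tau> U"
  proof (rule inj_onI)
    fix u v assume uv: "u \<in> U" "v \<in> U" "\<tau> u = \<tau> v"
    then have "w u = w v" using \<tau> by simp
    then show "u = v" using vx[OF uv(1)] vx[OF uv(2)] by (simp add: w_def)
  qed
  have observer: "\<exists>a h. (1 / (p - x) - 1 / (y - x)) = Complex a h * d" for p
    by (rule exI[of _ "Re ((1 / (p - x) - 1 / (y - x)) / d)"], rule exI[of _ "Im ((1 / (p - x) - 1 / (y - x)) / d)"])
       (use d0 in simp)
  obtain a1 h1 where o1: "1 / (z - x) - 1 / (y - x) = Complex a1 h1 * d" using observer by blast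
  obtain a2 h2 where o2: "1 / (z' - x) - 1 / (y - x) = Complex a2 h2 * d" using observer by blast
  have wo: "w v - 1 / (p - x) = d * (of_real (\<tau> v) - Complex a h)"
    if "v \<in> U" "1 / (p - x) - 1 / (y - x) = Complex a h * d" for v p a h
  proof -
    have "w v - 1 / (p - x) = (w v - 1 / (y - x)) - (1 / (p - x) - 1 / (y - x))" by simp
    also have "\<dots> = d * (of_real (\<tau> v) - Complex a h)" unfolding that(2) using \<tau>[OF that(1)] by (simp add: algebra_simps)
    finally show ?thesis .
  qed
  obtain v0 where v0: "v0 \<in> U" using U by blast
  have hz: "h \<noteq> 0" if "Im ((1/(v0-x) - 1/(y-x)) / (1/(p-x) - 1/(y-x))) \<noteq> 0" "1 / (p - x) - 1 / (y - x) = Complex a h * d" for p a h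
  proof
    assume "h = 0"
    then have "Complex a h = of_real a" by (simp add: complex_eq_iff)
    moreover have "1/(v0-x) - 1/(y-x) = of_real (\<tau> v0) * d" using \<tau>[OF v0] by (simp add: w_def)
    ultimately have "(1/(v0-x) - 1/(y-x)) / (1/(p-x) - 1/(y-x)) = of_real (\<tau> v0 / a)" using that(2) d0 by simp
    then show False using that(1) by (simp only: Im_complex_of_real)
  qed
  have h1: "h1 \<noteq> 0" by (rule hz[OF e1[OF v0] o1])
  have h2: "h2 \<noteq> 0" by (rule hz[OF e2[OF v0] o2])
  \<comment> \<open>Mirror-image observers would be equidistant from every point of the line,
    contrary to \<open>e3\<close>.\<close>
  have nr: "\<not> (a1 = a2 \<and> h1\<^sup>2 = h2\<^sup>2)"
  proof
    assume "a1 = a2 \<and> h1\<^sup>2 = h2\<^sup>2"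
    then have "cmod (of_real (\<tau> v0) - Complex a1 h1) = cmod (of_real (\<tau> v0) - Complex a2 h2)"
      by (simp add: cmod_def)
    then show False using e3[OF v0] wo[OF v0 o1] wo[OF v0 o2] by (simp add: w_def norm_mult)
  qed
  \<comment> \<open>Inversion turns the angle at \<open>v\<close> into the view from the image of
    \<open>p\<close> plus a constant, but only modulo full turns; the ranges leave three possible
    numbers of turns.\<close>
  have lift: "\<exists>m::int. m \<in> {-1,0,1} \<and> slant v p - slant v x = view a h (\<tau> v) + (Arg ((p - x) * d * \<i> * of_real h) + 2 * pi * of_int m)"
    if v: "v \<in> U" and p: "p \<noteq> x" "Im p < Im v" and o: "1 / (p - x) - 1 / (y - x) = Complex a h * d" and h: "h \<noteq> 0" for v p a h
  proof -
    define K where "K = (p - x) * d * \<i> * of_real h"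
    have "K \<noteq> 0" using p d0 h by (simp add: K_def)
    have "Im x < Im v" using lower[OF v] by auto
    then obtain \<rho> where r: "\<rho> > 0" "p - v = of_real \<rho> * cis (slant v p - slant v x) * (x - v)"
      using slant_ratio p(2) by blast
    obtain \<sigma> where s: "\<sigma> > 0" "of_real (\<tau> v) - Complex a h = - \<i> * of_real h * of_real \<sigma> * cis (view a h (\<tau> v))"
      using view_cis[OF h] by blast
    have "(p - v) / ((v - x) * (p - x)) = d * (- \<i> * of_real h * of_real \<sigma> * cis (view a h (\<tau> v)))"
      using wdiff[OF v p(1)] wo[OF v o] s(2) by simp
    then have "p - v = (v - x) * (p - x) * (d * (- \<i> * of_real h * of_real \<sigma> * cis (view a h (\<tau> v))))"
      using vx[OF v] p(1) by (simp add: divide_eq_eq mult.commute)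
    also have "\<dots> = of_real \<sigma> * cis (view a h (\<tau> v)) * K * (x - v)"
      by (simp add: K_def algebra_simps)
    also have "K = of_real (cmod K) * cis (Arg K)" by (rule rcis_cmod_Arg[symmetric, unfolded rcis_def])
    finally have "of_real \<rho> * cis (slant v p - slant v x) * (x - v) =
        of_real (\<sigma> * cmod K) * cis (view a h (\<tau> v) + Arg K) * (x - v)"
      unfolding r(2) by (simp add: mult_ac flip: cis_mult)
    then have "of_real \<rho> * cis (slant v p - slant v x) = of_real (\<sigma> * cmod K) * cis (view a h (\<tau> v) + Arg K)"
      using vx[OF v] by simp
    moreover have "\<bar>slant v p - slant v x - (view a h (\<tau> v) + Arg K)\<bar> < 4 * pi"
      using slant_bounds[of v p] slant_bounds[of v x] view_bounds[of a h "\<tau> v"] Arg_bounded[of K]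
      unfolding abs_less_iff by linarith
    ultimately obtain n :: int where "n \<in> {-1,0,1}" "slant v p - slant v x = view a h (\<tau> v) + Arg K + 2 * pi * of_int n"
      using cis_eqD[of \<rho> "slant v p - slant v x" "\<sigma> * cmod K"] r(1) s(1) \<open>K \<noteq> 0\<close> by (metis mult_pos_pos zero_less_norm_iff)
    then show ?thesis unfolding K_def[symmetric] by (intro exI[of _ n]) (simp add: add.assoc)
  qed
  define c1 c2 where "c1 = Arg ((z - x) * d * \<i> * of_real h1)" and "c2 = Arg ((z' - x) * d * \<i> * of_real h2)"
  have ex1: "\<forall>v\<in>U. \<exists>m::int. m \<in> {-1,0,1} \<and> slant v z - slant v x = view a1 h1 (\<tau> v) + (c1 + 2 * pi * of_int m)"
  proof
    fix v assume v: "v \<in> U"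
    show "\<exists>m::int. m \<in> {-1,0,1} \<and> slant v z - slant v x = view a1 h1 (\<tau> v) + (c1 + 2 * pi * of_int m)"
      unfolding c1_def using ne(2) lower[OF v] by (intro lift[OF v _ _ o1 h1]) blast+
  qed
  obtain m1 :: "complex \<Rightarrow> int" where m1: "\<forall>v\<in>U. m1 v \<in> {-1,0,1} \<and>
    slant v z - slant v x = view a1 h1 (\<tau> v) + (c1 + 2 * pi * of_int (m1 v))" using bchoice[OF ex1] by blast
  have ex2: "\<forall>v\<in>U. \<exists>m::int. m \<in> {-1,0,1} \<and> slant v z' - slant v x = view a2 h2 (\<tau> v) + (c2 + 2 * pi * of_int m)"
  proof
    fix v assume v: "v \<in> U"
    show "\<exists>m::int. m \<in> {-1,0,1} \<and> slant v z' - slant v x = view a2 h2 (\<tau> v) + (c2 + 2 * pi * of_int m)"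
      unfolding c2_def using ne(3) lower[OF v] by (intro lift[OF v _ _ o2 h2]) blast+
  qed
  obtain m2 :: "complex \<Rightarrow> int" where m2: "\<forall>v\<in>U. m2 v \<in> {-1,0,1} \<and>
    slant v z' - slant v x = view a2 h2 (\<tau> v) + (c2 + 2 * pi * of_int (m2 v))" using bchoice[OF ex2] by blast
  \<comment> \<open>Fixing the numbers of turns for both observers costs the factor 9.\<close>
  have fins: "finite ({-1,0,1::int} \<times> {-1,0,1::int})" by simp
  have "(\<lambda>v. (m1 v, m2 v)) ` U \<subseteq> {-1,0,1} \<times> {-1,0,1}" using m1 m2 by blast
  then obtain n where n: "card U \<le> card ({-1,0,1::int} \<times> {-1,0,1::int}) * card {v\<in>U. (m1 v, m2 v) = n}"
    by (rule pigeonhole_fibre[OF U(1) fins _ U(2)])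
  define U' where "U' = {v\<in>U. (m1 v, m2 v) = n}"
  have cU: "card U \<le> 9 * card U'" using n by (simp add: card_cartesian_product U'_def)
  define T where "T = \<tau> ` U'"
  have cT: "card T = card U'" unfolding T_def by (rule card_image) (use inj in \<open>auto simp: U'_def inj_on_def\<close>)
  have "real (card T) * R\<^sup>2 \<le> (real (card B))\<^sup>2 * (1 + 4 * real k / real m + 2 * (real m)\<^sup>2)"
  proof (rule squeeze_views[OF B _ h1 h2 nr R(1) _ _ m])
    show "finite T" using U by (simp add: T_def U'_def)
    fix t assume "t \<in> T"
    then obtain v where v: "v \<in> U" "m1 v = fst n" "m2 v = snd n" "t = \<tau> v" by (auto simp: T_def U'_def)
    have "slant v z - slant v x = view a1 h1 t + (c1 + 2 * pi * of_int (fst n))"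
      "slant v z' - slant v x = view a2 h2 t + (c2 + 2 * pi * of_int (snd n))"
      using m1 m2 v by (auto simp del: of_int_minus)
    then show "R \<le> real (card (shifts B k (view a1 h1 t + (c1 + 2 * pi * of_int (fst n)))))"
      "R \<le> real (card (shifts B k (view a2 h2 t + (c2 + 2 * pi * of_int (snd n)))))"
      using R(2,3)[OF v(1)] by simp_all
  qed
  moreover have "real (card U) * R\<^sup>2 \<le> 9 * (real (card T) * R\<^sup>2)"
  proof -
    have "real (card U) \<le> 9 * real (card T)" using of_nat_mono[OF cU, where ?'a = real] cT by simp
    then have "real (card U) * R\<^sup>2 \<le> 9 * real (card T) * R\<^sup>2" by (rule mult_right_mono) simp
    then show ?thesis by simp
  qed
  ultimately show ?thesis by linarith
qed

section \<open>Lines and circles as one family\<close>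

definition line_pts :: "complex set \<Rightarrow> complex \<Rightarrow> complex \<Rightarrow> complex set" where
  "line_pts P p q = {r\<in>P. \<exists>s. r = p + of_real s * (q - p)}"

text \<open>Lines (\<open>a = 0\<close>) and circles together, since inversions mix them. Triples
  with \<open>a = b = 0\<close> and nonzero \<open>c\<close> give the empty set; the zero triple,
  which gives the whole plane, is excluded in \<open>no_rich\<close>.\<close>

definition gcircle :: "real \<Rightarrow> complex \<Rightarrow> real \<Rightarrow> complex set" where
  "gcircle a b c = {v. a * (cmod v)\<^sup>2 + Re (b * v) + c = 0}"

definition no_rich :: "complex set \<Rightarrow> real \<Rightarrow> bool" where
  "no_rich P M \<longleftrightarrow> (\<forall>a b c. a \<noteq> 0 \<or> b \<noteq> 0 \<or> c \<noteq> 0 \<longrightarrow> real (card (P \<inter> gcircle a b c)) \<le> M)"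

text \<open>Multiplication by the square of \<open>cmod (v - x)\<close> turns the line equation for
  \<open>1 / (v - x)\<close> into the equation of a generalised circle with leading coefficient
  \<open>c\<close>.\<close>

lemma no_rich_inverted:
  assumes M: "no_rich P M" and P: "finite P" and e: "e \<noteq> 0" and x: "V \<subseteq> P" "x \<notin> V"
  shows "real (card {v\<in>V. Re (e / (v - x)) + c = 0}) \<le> M"
proof -
  define b where "b = cnj e - of_real (2 * c) * cnj x"
  define d where "d = c * (cmod x)\<^sup>2 - Re (cnj e * x)"
  have nz: "c \<noteq> 0 \<or> b \<noteq> 0 \<or> d \<noteq> 0" using e by (auto simp: b_def)
  have "{v\<in>V. Re (e / (v - x)) + c = 0} \<subseteq> P \<inter> gcircle c b d"
  proof
    fix v assume "v \<in> {v\<in>V. Re (e / (v - x)) + c = 0}"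
    then have v: "v \<in> V" and eq: "Re (e / (v - x)) + c = 0" by auto
    have vx: "v - x \<noteq> 0" using v x(2) by auto
    have "Re (e / (v - x)) * (cmod (v - x))\<^sup>2 = Re (e * cnj (v - x))"
      using vx by (simp add: complex_div_cnj[of e] Re_divide_of_real)
    then have "Re (e * cnj (v - x)) + c * (cmod (v - x))\<^sup>2 = (Re (e / (v - x)) + c) * (cmod (v - x))\<^sup>2"
      by (simp only: distrib_right)
    then have "Re (e * cnj (v - x)) + c * (cmod (v - x))\<^sup>2 = 0" using eq by simp
    moreover have "Re (e * cnj (v - x)) + c * (cmod (v - x))\<^sup>2 = c * (cmod v)\<^sup>2 + Re (b * v) + d"
      unfolding b_def d_def cmod_power2 by (simp add: power2_eq_square algebra_simps)
    ultimately show "v \<in> P \<inter> gcircle c b d" using v x(1) by (auto simp: gcircle_def)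
  qed
  then have "card {v\<in>V. Re (e / (v - x)) + c = 0} \<le> card (P \<inter> gcircle c b d)"
    by (rule card_mono[rotated]) (use P in simp)
  also have "real (card (P \<inter> gcircle c b d)) \<le> M" using M nz unfolding no_rich_def by blast
  finally show ?thesis by simp
qed

text \<open>The quotient is real if and only if \<open>1 / (v - x)\<close> lies on the line through
  the images of \<open>y\<close> and \<open>z\<close>, that is, \<open>v\<close> lies on the circle
  or line through \<open>x\<close>, \<open>y\<close>, \<open>z\<close>. For other \<open>v\<close>
  the observer of \<open>pencil_bound\<close> is off the image line.\<close>

lemma exceptional_line:
  assumes M: "no_rich P M" and P: "finite P" and x: "V \<subseteq> P" "x \<notin> V" and ne: "y \<noteq> z" "x \<noteq> y" "x \<noteq> z"
  shows "real (card {v\<in>V. Im ((1/(v-x) - 1/(y-x)) / (1/(z-x) - 1/(y-x))) = 0}) \<le> M"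
proof -
  define d where "d = 1/(z-x) - 1/(y-x)"
  have d: "d \<noteq> 0" using ne by (simp add: d_def frac_eq_eq)
  have "Im ((1/(v-x) - 1/(y-x)) / d) = Re ((- \<i> / d) / (v - x)) + (- Re (- \<i> / d * (1/(y-x))))" for v
  proof -
    have "(s - t) / d * (- \<i>) = (- \<i> / d) * s - (- \<i> / d) * t" for s t
      using d by (simp add: field_simps)
    from this[of "1/(v-x)" "1/(y-x)"]
    have "(1/(v-x) - 1/(y-x)) / d * (- \<i>) = (- \<i> / d) / (v - x) - (- \<i> / d * (1/(y-x)))" by simp
    moreover have "Im u = Re (u * (- \<i>))" for u by simp
    ultimately have "Im ((1/(v-x) - 1/(y-x)) / d) = Re ((- \<i> / d) / (v - x) - (- \<i> / d * (1/(y-x))))" by metis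
    then show ?thesis unfolding minus_complex.sel by linarith
  qed
  then have "{v\<in>V. Im ((1/(v-x) - 1/(y-x)) / d) = 0} = {v\<in>V. Re ((- \<i> / d) / (v - x)) + (- Re (- \<i> / d * (1/(y-x)))) = 0}"
    by (simp only:)
  moreover have "- \<i> / d \<noteq> 0" using d by simp
  ultimately show ?thesis unfolding d_def[symmetric] using no_rich_inverted[OF M P _ x] by (simp only:)
qed

text \<open>The images of these \<open>v\<close> lie on the perpendicular bisector of the images of
  \<open>z\<close> and \<open>z'\<close>, whose preimage lies on a circle or line. For other
  \<open>v\<close> the two observers of \<open>pencil_bound\<close> cannot be mirror images.\<close>

lemma exceptional_bisector:
  assumes M: "no_rich P M" and P: "finite P" and x: "V \<subseteq> P" "x \<notin> V" and ne: "z \<noteq> z'" "x \<noteq> z" "x \<noteq> z'"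
  shows "real (card {v\<in>V. cmod (1/(v-x) - 1/(z-x)) = cmod (1/(v-x) - 1/(z'-x))}) \<le> M"
proof -
  define a a' where "a = 1/(z-x)" and "a' = 1/(z'-x)"
  have d: "cnj (a' - a) \<noteq> 0" using ne by (simp add: a_def a'_def frac_eq_eq)
  define e where "e = 2 * cnj (a' - a)"
  have e: "e \<noteq> 0" using d by (simp only: e_def) simp
  have "cmod (w - a) = cmod (w - a') \<longleftrightarrow> Re (e * w) + ((cmod a)\<^sup>2 - (cmod a')\<^sup>2) = 0" for w
  proof -
    have "cmod (w - a) = cmod (w - a') \<longleftrightarrow> (cmod (w - a))\<^sup>2 = (cmod (w - a'))\<^sup>2" by simp
    also have "\<dots> \<longleftrightarrow> (cmod (w - a))\<^sup>2 - (cmod (w - a'))\<^sup>2 = 0" by simp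
    also have "(cmod (w - a))\<^sup>2 - (cmod (w - a'))\<^sup>2 = Re (e * w) + ((cmod a)\<^sup>2 - (cmod a')\<^sup>2)"
      unfolding e_def cmod_power2 by (simp add: power2_eq_square algebra_simps)
    finally show ?thesis .
  qed
  then have "{v\<in>V. cmod (1/(v-x) - a) = cmod (1/(v-x) - a')} = {v\<in>V. Re (e / (v-x)) + ((cmod a)\<^sup>2 - (cmod a')\<^sup>2) = 0}"
    by (simp only: times_divide_eq_right mult_1_right)
  then show ?thesis unfolding a_def[symmetric] a'_def[symmetric] using no_rich_inverted[OF M P e x] by (simp only:)
qed

lemma four_elements:
  assumes "3 < card C"
  obtains x y z z' where "x \<in> C" "y \<in> C" "z \<in> C" "z' \<in> C" "distinct [x,y,z,z']"
proof -
  have "4 \<le> card C" using assms by simp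
  then obtain S where S: "S \<subseteq> C" "card S = 4" by (meson obtain_subset_with_card_n)
  then obtain xs where xs: "set xs = S" "distinct xs" using finite_distinct_list[of S] card_ge_0_finite[of S] by auto
  then have "length xs = 4" using S distinct_card[of xs] by simp
  then obtain x y z z' where "xs = [x,y,z,z']" by (auto simp: numeral_eq_Suc length_Suc_conv)
  then show ?thesis using that[of x y z z'] xs S by auto
qed

text \<open>Each triple \<open>(v, q, b)\<close> defines the half-plane of points whose slant from
  \<open>v\<close> is at least \<open>slant v q + b\<close>. Points of a cluster are separated by
  few triples, so for most \<open>(v, q)\<close> their slants relative to \<open>q\<close> have
  small rank distance in \<open>B\<close>. Varying \<open>q\<close> gives at least
  \<open>card Q / (2 * K)\<close> representations of a difference of slants; the division by
  \<open>K\<close> accounts for the \<open>q\<close> that \<open>v\<close> sees in one direction.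
  One factor of the cube bounds the number of angles under which \<open>x\<close> and
  \<open>y\<close> are seen, the other two bound the points sharing such an angle.\<close>

lemma step_one:
  assumes P: "holds_angles P B" "finite P" and VQ: "V \<subseteq> P" "Q \<subseteq> P" "V \<noteq> {}" "Q \<noteq> {}"
    and low: "\<And>v q. v \<in> V \<Longrightarrow> q \<in> Q \<Longrightarrow> Im q < Im v"
    and M: "no_rich P M"
    and beck: "100 * real (card {(v,q). v \<in> V \<and> q \<in> Q \<and> K \<le> card (line_pts P v q)}) \<le> real (card V) * real (card Q)"
    and K: "1 \<le> K"
    and D: "D \<le> real (card V) * real (card Q) * real (card B)" "100 * D \<le> real k * (real (card V) * real (card Q))"
    and k: "1 \<le> k"
    and r: "(real (card Q))\<^sup>2 * (1 - D / (real (card V) * real (card Q) * real (card B))) ^ r < 1" "3 * (r\<^sup>2 + 1) < card Q"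
    and m: "1 \<le> (m::nat)"
  shows "(9/10 * real (card V) - 3 * M) * (real (card Q) / (2 * real K)) ^ 3 \<le>
     9 * (real (card B)) ^ 3 * (2 * real k + 1) * (1 + 4 * real k / real m + 2 * (real m)\<^sup>2)"
proof -
  note PD = holds_anglesD[OF P(1)]
  have fin: "finite V" "finite Q" "finite B" using VQ P PD(1) finite_subset by blast+
  define R where "R = real (card Q) / (2 * real K)"
  have R0: "0 \<le> R" by (simp add: R_def)
  define Z where "Z = 9 * ((real (card B))\<^sup>2 * (1 + 4 * real k / real m + 2 * (real m)\<^sup>2))"
  have Z0: "0 \<le> Z" by (simp add: Z_def)
  have sB: "slant v x - slant v q \<in> B" if "v \<in> V" "x \<in> Q" "q \<in> Q" for v x q
    using slant_diff_in[OF P(1), of v x q] that low VQ by blast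
  obtain v0 q0 where "v0 \<in> V" "q0 \<in> Q" using VQ by blast
  then have "0 \<in> B" using sB[of v0 q0 q0] by simp
  define W where "W = V \<times> Q \<times> B"
  have W: "finite W" "W \<noteq> {}" using fin VQ \<open>0 \<in> B\<close> by (auto simp: W_def)
  have cW: "real (card W) = real (card V) * real (card Q) * real (card B)" by (simp add: W_def card_cartesian_product)
  have "\<forall>w. \<exists>abc. \<forall>x. Im x < Im (fst w) \<longrightarrow>
      (slant (fst w) (fst (snd w)) + snd (snd w) \<le> slant (fst w) x \<longleftrightarrow> 0 \<le> fst abc * Re x + fst (snd abc) * Im x + snd (snd abc))"
    (is "\<forall>w. \<exists>abc. ?H w abc")
  proof
    fix w :: "complex \<times> complex \<times> real"
    obtain a b c where "\<And>x. Im x < Im (fst w) \<Longrightarrow> slant (fst w) (fst (snd w)) + snd (snd w) \<le> slant (fst w) x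
        \<longleftrightarrow> 0 \<le> a * Re x + b * Im x + c"
      by (rule slant_half_plane[of "fst w" "slant (fst w) (fst (snd w)) + snd (snd w)"]) (rule that)
    then show "\<exists>abc. ?H w abc" by (intro exI[of _ "(a,b,c)"]) simp
  qed
  then obtain f where f: "\<And>w. ?H w (f w)" by metis
  define sepc where "sepc = (\<lambda>x y v q. {b\<in>B. (slant v q + b \<le> slant v x) \<noteq> (slant v q + b \<le> slant v y)})"
  obtain C where C: "C \<subseteq> Q" "3 < card C" and close: "\<And>x y. x \<in> C \<Longrightarrow> y \<in> C \<Longrightarrow>
      real (card {w\<in>W. (0 \<le> fst (f w) * Re x + fst (snd (f w)) * Im x + snd (snd (f w))) \<noteq>
        (0 \<le> fst (f w) * Re y + fst (snd (f w)) * Im y + snd (snd (f w)))}) < D"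
    using cluster_exists[OF W fin(2) D(1)[folded cW] r(1)[folded cW] r(2),
        where a = "\<lambda>w. fst (f w)" and b = "\<lambda>w. fst (snd (f w))" and c = "\<lambda>w. snd (snd (f w))"] by blast
  have small: "100 * real (card {(v,q). v \<in> V \<and> q \<in> Q \<and> k \<le> card (sepc x y v q)}) \<le> real (card V) * real (card Q)"
    if xy: "x \<in> C" "y \<in> C" for x y
  proof -
    let ?S = "{(v,q). v \<in> V \<and> q \<in> Q \<and> k \<le> card (sepc x y v q)}"
    have finS: "finite ?S" by (rule finite_subset[of _ "V \<times> Q"]) (use fin in auto)
    have finc: "finite (sepc x y v q)" for v q using fin by (simp add: sepc_def)
    have "card ?S * k = (\<Sum>p\<in>?S. k)" by simp
    also have "\<dots> \<le> (\<Sum>p\<in>?S. card (sepc x y (fst p) (snd p)))" by (rule sum_mono) auto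
    also have "\<dots> = card (SIGMA p:?S. sepc x y (fst p) (snd p))" using finS finc by (simp add: card_SigmaI)
    also have "\<dots> \<le> card {w\<in>W. (0 \<le> fst (f w) * Re x + fst (snd (f w)) * Im x + snd (snd (f w))) \<noteq>
        (0 \<le> fst (f w) * Re y + fst (snd (f w)) * Im y + snd (snd (f w)))}" (is "_ \<le> card ?T")
    proof (rule card_inj_on_le[where f = "\<lambda>((v,q),b). (v,q,b)"])
      show "inj_on (\<lambda>((v,q),b). (v,q,b)) (SIGMA p:?S. sepc x y (fst p) (snd p))" by (auto simp: inj_on_def)
      show "finite ?T" using W by simp
      show "(\<lambda>((v,q),b). (v,q,b)) ` (SIGMA p:?S. sepc x y (fst p) (snd p)) \<subseteq> ?T"
      proof (rule image_subsetI)
        fix u assume "u \<in> (SIGMA p:?S. sepc x y (fst p) (snd p))"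
        then obtain v q b where u: "u = ((v,q),b)" "v \<in> V" "q \<in> Q" "b \<in> sepc x y v q" by auto
        have "Im x < Im v" "Im y < Im v" using low u(2) xy C(1) by auto
        then have "(slant v q + b \<le> slant v x \<longleftrightarrow> 0 \<le> fst (f (v,q,b)) * Re x + fst (snd (f (v,q,b))) * Im x + snd (snd (f (v,q,b))))"
          "(slant v q + b \<le> slant v y \<longleftrightarrow> 0 \<le> fst (f (v,q,b)) * Re y + fst (snd (f (v,q,b))) * Im y + snd (snd (f (v,q,b))))"
          using f[of "(v,q,b)"] by simp_all
        moreover have "b \<in> B" "(slant v q + b \<le> slant v x) \<noteq> (slant v q + b \<le> slant v y)"
          using u(4) by (simp_all add: sepc_def)
        ultimately show "(case u of (x, xa) \<Rightarrow> (case x of (v, q) \<Rightarrow> \<lambda>b. (v, q, b)) xa) \<in> ?T"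
          using u(1-3) by (simp add: W_def)
      qed
    qed
    finally have "real (card ?S * k) \<le> real (card ?T)" unfolding of_nat_le_iff .
    then have "real k * real (card ?S) < D" using close[OF xy] by (simp add: mult.commute)
    then have "real k * (100 * real (card ?S)) \<le> real k * (real (card V) * real (card Q))" using D(2) by linarith
    then show ?thesis using k by simp
  qed
  obtain x y z z' where xyz: "x \<in> C" "y \<in> C" "z \<in> C" "z' \<in> C" "distinct [x,y,z,z']" using four_elements[OF C(2)] .
  then have xQ: "x \<in> Q" "y \<in> Q" "z \<in> Q" "z' \<in> Q" using C(1) by auto
  define beta where "beta = (\<lambda>y. {(v,q). v \<in> V \<and> q \<in> Q \<and> k \<le> card (sepc x y v q)})"
  define rho where "rho = {(v,q). v \<in> V \<and> q \<in> Q \<and> K \<le> card (line_pts P v q)}"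
  \<comment> \<open>Four bad sets of density at most \<open>1/100\<close> each give the
    \<open>1/25\<close> of \<open>many_good_rows\<close>.\<close>
  define bad where "bad = rho \<union> (beta y \<union> (beta z \<union> beta z'))"
  have "card bad \<le> card rho + (card (beta y) + (card (beta z) + card (beta z')))"
    unfolding bad_def using card_Un_le[of rho "beta y \<union> (beta z \<union> beta z')"]
      card_Un_le[of "beta y" "beta z \<union> beta z'"] card_Un_le[of "beta z" "beta z'"] by linarith
  moreover have "100 * real (card (beta y)) \<le> real (card V) * real (card Q)"
    "100 * real (card (beta z)) \<le> real (card V) * real (card Q)"
    "100 * real (card (beta z')) \<le> real (card V) * real (card Q)"
    unfolding beta_def using small[OF xyz(1)] xyz by blast+
  moreover have "100 * real (card rho) \<le> real (card V) * real (card Q)" using beck by (simp only: rho_def)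
  ultimately have cbad: "25 * real (card bad) \<le> real (card V) * real (card Q)" by linarith
  have subbad: "bad \<subseteq> V \<times> Q" by (auto simp: bad_def rho_def beta_def)
  define V' where "V' = {v\<in>V. real (card Q) / 2 \<le> real (card {q\<in>Q. (v,q) \<notin> bad})}"
  have cV': "9/10 * real (card V) \<le> real (card V')"
    unfolding V'_def by (rule many_good_rows[OF fin(1,2) VQ(4) subbad cbad])
  have Rep: "R \<le> real (card (shifts B k (slant v u - slant v x)))" if v: "v \<in> V'" and u: "u \<in> {y,z,z'}" for v u
  proof -
    have vV: "v \<in> V" using v by (simp add: V'_def)
    have uQ: "u \<in> Q" using u xQ by blast
    define G where "G = {q\<in>Q. (v,q) \<notin> bad}"
    have finG: "finite G" using fin by (simp add: G_def)
    have G: "real (card Q) / 2 \<le> real (card G)" using v by (simp add: V'_def G_def)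
    let ?h = "\<lambda>q. slant v x - slant v q"
    \<comment> \<open>Points \<open>q\<close> with the same slant lie on one line through
      \<open>v\<close>, and this line has fewer than \<open>K\<close> points because
      \<open>(v, q1)\<close> is not in \<open>rho\<close>.\<close>
    have "card G \<le> K * card (?h ` G)"
    proof (rule card_le_fibres[OF finG])
      fix t assume "t \<in> ?h ` G"
      then obtain q1 where q1: "q1 \<in> G" "?h q1 = t" by blast
      have "(v,q1) \<notin> rho" "q1 \<in> Q" using q1 by (auto simp: G_def bad_def)
      then have lt: "card (line_pts P v q1) < K" using vV by (auto simp: rho_def not_le)
      have "{q\<in>G. ?h q = t} \<subseteq> line_pts P v q1"
      proof
        fix q assume q: "q \<in> {q\<in>G. ?h q = t}"
        then have qQ: "q \<in> Q" by (simp add: G_def)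
        obtain \<rho> where "q - v = of_real \<rho> * cis (slant v q - slant v q1) * (q1 - v)"
          using slant_ratio[OF low[OF vV qQ] low[OF vV \<open>q1 \<in> Q\<close>]] by blast
        moreover have "slant v q - slant v q1 = 0" using q q1(2) by auto
        ultimately have "q - v = of_real \<rho> * (q1 - v)" by simp
        then have "q = v + of_real \<rho> * (q1 - v)" by (metis add.commute diff_add_cancel)
        then show "q \<in> line_pts P v q1" using qQ VQ by (auto simp: line_pts_def)
      qed
      then have "card {q\<in>G. ?h q = t} \<le> card (line_pts P v q1)"
        by (rule card_mono[rotated]) (use P in \<open>simp add: line_pts_def\<close>)
      then show "card {q\<in>G. ?h q = t} \<le> K" using lt by linarith
    qed
    also have "card (?h ` G) \<le> card (shifts B k (slant v u - slant v x))"
    proof (rule card_mono)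
      show "?h ` G \<subseteq> shifts B k (slant v u - slant v x)"
      proof (rule image_subsetI)
        fix q assume q: "q \<in> G"
        then have qQ: "q \<in> Q" and nb: "(v,q) \<notin> beta u" using u by (auto simp: G_def bad_def)
        then have lt: "card (sepc x u v q) < k" using vV by (auto simp: beta_def not_le)
        define b1 b2 where "b1 = slant v x - slant v q" and "b2 = slant v u - slant v q"
        have b12: "b1 \<in> B" "b2 \<in> B" using sB[OF vV] xQ uQ qQ by (auto simp: b1_def b2_def)
        \<comment> \<open>\<open>sepc\<close> describes a half-open interval while
          \<open>shifts\<close> uses the closed one; the missing lower end is paid for by the strict
          bound on \<open>card (sepc x u v q)\<close>.\<close>
        have "B \<inter> {min b1 b2..max b1 b2} \<subseteq> insert (min b1 b2) (sepc x u v q)"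
          by (auto simp: sepc_def b1_def b2_def)
        then have "card (B \<inter> {min b1 b2..max b1 b2}) \<le> card (insert (min b1 b2) (sepc x u v q))"
          by (rule card_mono[rotated]) (use fin in \<open>simp add: sepc_def\<close>)
        also have "\<dots> \<le> Suc (card (sepc x u v q))" by (rule card_insert_le_m1) auto
        finally have "card (B \<inter> {min b1 b2..max b1 b2}) \<le> k" using lt by linarith
        moreover have "b1 + (slant v u - slant v x) = b2" by (simp add: b1_def b2_def)
        ultimately have "b1 \<in> shifts B k (slant v u - slant v x)" using b12 by (simp add: shifts_def)
        then show "slant v x - slant v q \<in> shifts B k (slant v u - slant v x)" by (simp add: b1_def)
      qed
    qed (use fin in simp)
    finally have "card G \<le> K * card (shifts B k (slant v u - slant v x))" by simp
    then have "real (card G) \<le> real K * real (card (shifts B k (slant v u - slant v x)))"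
      by (simp only: of_nat_le_iff flip: of_nat_mult)
    then have "real (card Q) / 2 \<le> real K * real (card (shifts B k (slant v u - slant v x)))" using G by linarith
    then show ?thesis using K by (simp add: R_def divide_le_eq mult_ac)
  qed
  have xV: "x \<notin> V" using low xQ by blast
  define E1 where "E1 = {v\<in>V. Im ((1/(v-x) - 1/(y-x)) / (1/(z-x) - 1/(y-x))) = 0}"
  define E2 where "E2 = {v\<in>V. Im ((1/(v-x) - 1/(y-x)) / (1/(z'-x) - 1/(y-x))) = 0}"
  define E3 where "E3 = {v\<in>V. cmod (1/(v-x) - 1/(z-x)) = cmod (1/(v-x) - 1/(z'-x))}"
  have E: "real (card E1) \<le> M" "real (card E2) \<le> M" "real (card E3) \<le> M"
    unfolding E1_def E2_def E3_def using xyz(5)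
    by (intro exceptional_line[OF M P(2) VQ(1) xV] exceptional_bisector[OF M P(2) VQ(1) xV]; simp)+
  define V'' where "V'' = V' - (E1 \<union> (E2 \<union> E3))"
  have fV: "finite V'" "finite V''" "V'' \<subseteq> V" using fin by (auto simp: V''_def V'_def)
  have "V' \<subseteq> V'' \<union> (E1 \<union> (E2 \<union> E3))" by (auto simp: V''_def)
  then have "card V' \<le> card (V'' \<union> (E1 \<union> (E2 \<union> E3)))"
    by (rule card_mono[rotated]) (use fin fV in \<open>auto simp: E1_def E2_def E3_def\<close>)
  also have "\<dots> \<le> card V'' + (card E1 + (card E2 + card E3))"
    using card_Un_le[of V'' "E1 \<union> (E2 \<union> E3)"] card_Un_le[of E1 "E2 \<union> E3"] card_Un_le[of E2 E3] by linarith
  finally have cV'': "9/10 * real (card V) - 3 * M \<le> real (card V'')" using E cV' by linarith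
  have main: "real (card V'') * R ^ 3 \<le> real (card B) * (2 * real k + 1) * Z"
  proof (cases "V'' = {}")
    case True
    then show ?thesis using Z0 by simp
  next
    case False
    let ?g = "\<lambda>v. slant v y - slant v x"
    have "finite (?g ` V'')" using fV by simp
    then obtain g where "g \<in> ?g ` V''" and g: "card V'' \<le> card (?g ` V'') * card {v\<in>V''. ?g v = g}"
      by (rule pigeonhole_fibre[OF fV(2) _ order_refl False])
    define U where "U = {v\<in>V''. ?g v = g}"
    have U: "finite U" "U \<noteq> {}" using fV \<open>g \<in> ?g ` V''\<close> by (auto simp: U_def)
    have X: "real (card (?g ` V'')) * R \<le> real (card B) * (2 * real k + 1)"
    proof (rule card_differences_le[OF fin(3)])
      fix d assume "d \<in> ?g ` V''"
      then obtain v where "v \<in> V'" "d = ?g v" by (auto simp: V''_def)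
      then show "R \<le> real (card (shifts B k d))" using Rep[of v y] by simp
    qed (use fV in simp)
    have Y: "real (card U) * R\<^sup>2 \<le> Z"
      unfolding Z_def
    proof (rule pencil_bound[OF PD(1,2) U])
      show "x \<noteq> y" "x \<noteq> z" "x \<noteq> z'" "y \<noteq> z" "y \<noteq> z'" "z \<noteq> z'" using xyz(5) by auto
      fix v assume v: "v \<in> U"
      then have v2: "v \<in> V''" "v \<in> V'" "v \<in> V" "v \<notin> E1" "v \<notin> E2" "v \<notin> E3" using fV by (auto simp: U_def V''_def)
      show "Im x < Im v \<and> Im y < Im v \<and> Im z < Im v \<and> Im z' < Im v" using low[OF v2(3)] xQ by blast
      show "slant v y - slant v x = g" using v by (simp add: U_def)
      show "Im ((1/(v-x) - 1/(y-x)) / (1/(z-x) - 1/(y-x))) \<noteq> 0" using v2 unfolding E1_def by blast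
      show "Im ((1/(v-x) - 1/(y-x)) / (1/(z'-x) - 1/(y-x))) \<noteq> 0" using v2 unfolding E2_def by blast
      show "cmod (1/(v-x) - 1/(z-x)) \<noteq> cmod (1/(v-x) - 1/(z'-x))" using v2 unfolding E3_def by blast
      show "R \<le> real (card (shifts B k (slant v z - slant v x)))"
        "R \<le> real (card (shifts B k (slant v z' - slant v x)))" using Rep[OF v2(2)] by blast+
    qed (use R0 m in auto)
    have "real (card V'') \<le> real (card (?g ` V'')) * real (card U)"
      using g by (simp only: U_def of_nat_le_iff flip: of_nat_mult)
    then have "real (card V'') * R ^ 3 \<le> real (card (?g ` V'')) * real (card U) * R ^ 3"
      by (rule mult_right_mono) (use R0 in simp)
    also have "\<dots> = (real (card (?g ` V'')) * R) * (real (card U) * R\<^sup>2)"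
      by (simp add: power2_eq_square power3_eq_cube)
    also have "\<dots> \<le> (real (card B) * (2 * real k + 1)) * Z"
      by (rule mult_mono[OF X Y]) (use R0 in simp_all)
    finally show ?thesis .
  qed
  have "(9/10 * real (card V) - 3 * M) * R ^ 3 \<le> real (card V'') * R ^ 3"
    using cV'' R0 by (intro mult_right_mono) simp_all
  also note main
  also have "real (card B) * (2 * real k + 1) * Z =
     9 * (real (card B)) ^ 3 * (2 * real k + 1) * (1 + 4 * real k / real m + 2 * (real m)\<^sup>2)"
    unfolding Z_def by (simp add: power2_eq_square power3_eq_cube)
  finally show ?thesis unfolding R_def .
qed

section \<open>Incidences and halving for complex point sets\<close>

lemma shear_exists:
  assumes "finite (P :: complex set)"
  obtains t where "inj_on (\<lambda>z. Re z + t * Im z) P"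
proof -
  define S where "S = (\<lambda>(p,q). - (Re p - Re q) / (Im p - Im q)) ` (P \<times> P)"
  have "finite S" using assms by (simp add: S_def)
  then obtain t where t: "t \<notin> S" using ex_new_if_finite[OF infinite_UNIV_char_0] by blast
  have "inj_on (\<lambda>z. Re z + t * Im z) P"
  proof (rule inj_onI)
    fix p q assume pq: "p \<in> P" "q \<in> P" "Re p + t * Im p = Re q + t * Im q"
    then have e: "t * (Im p - Im q) = - (Re p - Re q)" by (simp add: right_diff_distrib)
    show "p = q"
    proof (cases "Im p = Im q")
      case True
      then show ?thesis using e by (simp add: complex_eq_iff)
    next
      case False
      have "t = t * (Im p - Im q) / (Im p - Im q)" using False by simp
      also have "\<dots> = - (Re p - Re q) / (Im p - Im q)" unfolding e ..
      finally have "t \<in> S" unfolding S_def using pq by (intro image_eqI[of _ _ "(p,q)"]) auto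
      with t show ?thesis by simp
    qed
  qed
  then show ?thesis by (rule that)
qed

text \<open>A shear makes the first coordinates distinct, so that no line through two points is
  vertical, and it preserves collinearity.\<close>

lemma few_complex_pairs_on_rich_lines:
  assumes P: "finite P" and M: "no_rich P M" and J: "2 * 3 ^ J \<le> M" "M < 2 * 3 ^ Suc J"
  shows "real (card {(p,q). p \<in> P \<and> q \<in> P \<and> p \<noteq> q \<and> 2 * 3 ^ L \<le> card (line_pts P p q)})
    \<le> 9 * real (card P) * real J * M + 24 * (real (card P))\<^sup>2 * (3/4) ^ L"
proof -
  obtain t where t: "inj_on (\<lambda>z. Re z + t * Im z) P" using shear_exists[OF P] .
  define S where "S = (\<lambda>z. (Re z + t * Im z, Im z))"
  have inj: "inj_on fst (S ` P)" using t by (auto simp: inj_on_def S_def)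
  have injS: "inj_on S P" using t by (auto simp: inj_on_def S_def)
  have cS: "card (S ` P) = card P" by (rule card_image[OF injS])
  have pts_eq: "{u\<in>S ` P. on_line l u} = S ` {z\<in>P. on_line l (S z)}" for l by auto
  have pts: "pts (S ` P) l = card {z\<in>P. on_line l (S z)}" for l
    unfolding pts_eq by (rule card_image) (use injS in \<open>auto simp: inj_on_def\<close>)
  have "real (pts (S ` P) l) \<le> M" for l
  proof -
    obtain a b where l: "l = (a,b)" by fastforce
    have "{z\<in>P. on_line l (S z)} = P \<inter> gcircle 0 (Complex a (1 - a * t)) b"
      by (auto simp: on_line_def S_def l gcircle_def algebra_simps)
    moreover have "Complex a (1 - a * t) \<noteq> 0" by (auto simp: complex_eq_iff)
    ultimately show ?thesis unfolding pts using M unfolding no_rich_def by metis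
  qed
  from few_pairs_on_rich_lines[OF finite_imageI[OF P] inj this J, of L]
  have le: "real (card {(p,q). p \<in> S ` P \<and> q \<in> S ` P \<and> p \<noteq> q \<and> 2 * 3 ^ L \<le> pts (S ` P) (line_through p q)})
    \<le> 9 * real (card P) * real J * M + 24 * (real (card P))\<^sup>2 * (3/4) ^ L" (is "real (card ?T) \<le> _")
    unfolding cS .
  have "card {(p,q). p \<in> P \<and> q \<in> P \<and> p \<noteq> q \<and> 2 * 3 ^ L \<le> card (line_pts P p q)} \<le> card ?T" (is "card ?A \<le> _")
  proof (rule card_inj_on_le[where f = "\<lambda>(p,q). (S p, S q)"])
    show "inj_on (\<lambda>(p,q). (S p, S q)) ?A" using injS by (auto simp: inj_on_def)
    show "finite ?T" by (rule finite_subset[of _ "(S ` P) \<times> (S ` P)"]) (use P in auto)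
    show "(\<lambda>(p,q). (S p, S q)) ` ?A \<subseteq> ?T"
    proof (rule image_subsetI)
      fix u assume "u \<in> ?A"
      then obtain p q where u: "u = (p,q)" and pq: "p \<in> P" "q \<in> P" "p \<noteq> q" and c: "2 * 3 ^ L \<le> card (line_pts P p q)"
        by blast
      have ne: "fst (S p) \<noteq> fst (S q)" using pq t by (auto simp: S_def dest: inj_onD)
      define l where "l = line_through (S p) (S q)"
      have on: "on_line l (S p)" "on_line l (S q)" using on_line_through[OF ne] by (simp_all add: l_def)
      have "line_pts P p q \<subseteq> {z\<in>P. on_line l (S z)}"
      proof
        fix r assume "r \<in> line_pts P p q"
        then obtain s where r: "r \<in> P" "r = p + of_real s * (q - p)" by (auto simp: line_pts_def)
        have a: "fst (S r) = (1 - s) * fst (S p) + s * fst (S q)" "snd (S r) = (1 - s) * snd (S p) + s * snd (S q)"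
          by (simp_all add: r(2) S_def algebra_simps)
        have "snd (S r) = (1 - s) * (fst l * fst (S p) + snd l) + s * (fst l * fst (S q) + snd l)"
          using a(2) on by (simp add: on_line_def)
        also have "\<dots> = fst l * fst (S r) + snd l" unfolding a(1) by (simp add: algebra_simps)
        finally show "r \<in> {z\<in>P. on_line l (S z)}" using r(1) by (simp add: on_line_def)
      qed
      then have "card (line_pts P p q) \<le> pts (S ` P) l" unfolding pts
        by (rule card_mono[rotated]) (use P in simp)
      then have "2 * 3 ^ L \<le> pts (S ` P) l" using c by linarith
      moreover have "S p \<noteq> S q" using ne by auto
      ultimately show "(case u of (p, q) \<Rightarrow> (S p, S q)) \<in> ?T" using pq by (simp add: u l_def)
    qed
  qed
  then have "real (card ?A) \<le> real (card ?T)" unfolding of_nat_le_iff .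
  then show ?thesis using le by linarith
qed

lemma power_bracket:
  fixes x :: real assumes "1 \<le> x"
  obtains J :: nat where "3 ^ J \<le> x" "x < 3 ^ Suc J" "real J \<le> ln x"
proof -
  obtain n where n: "x < 3 ^ n" using real_arch_pow[of 3 x] by auto
  define j where "j = (LEAST n. x < 3 ^ n)"
  have j: "x < 3 ^ j" unfolding j_def by (rule LeastI[of _ n]) (rule n)
  then have "j \<noteq> 0" using assms by (cases j) auto
  then obtain J where J: "j = Suc J" by (cases j) auto
  have le: "3 ^ J \<le> x"
  proof (rule ccontr)
    assume "\<not> ?thesis"
    then have "j \<le> J" unfolding j_def by (intro Least_le) simp
    then show False using J by simp
  qed
  have "1 \<le> ln (3::real)" using exp_le by (simp add: ln_ge_iff)
  then have "real J * 1 \<le> real J * ln 3" by (rule mult_left_mono) simp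
  also have "\<dots> = ln (3 ^ J)" by (simp add: ln_realpow)
  also have "\<dots> \<le> ln x" using le assms by (subst ln_le_cancel_iff) auto
  finally show ?thesis using that[of J] le j J by simp
qed

text \<open>The cut is made at the median height. At most \<open>M\<close> points lie on the cutting
  line, since it is not rich; they are counted into \<open>Q\<close>.\<close>

lemma half_split:
  assumes P: "finite P" "P \<noteq> {}" and M: "no_rich P M"
  obtains V Q where "V \<subseteq> P" "Q \<subseteq> P" "\<And>v q. v \<in> V \<Longrightarrow> q \<in> Q \<Longrightarrow> Im q < Im v"
    "real (card P) / 2 \<le> real (card Q)" "real (card P) / 2 - M \<le> real (card V)"
proof -
  define k where "k = (card P + 1) div 2"
  have cP: "1 \<le> card P" using P by (simp add: Suc_le_eq card_gt_0_iff)
  have k: "1 \<le> k" "k \<le> card P" using cP by (auto simp: k_def)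
  define y where "y = rank_value P k Im"
  define Q V where "Q = {p\<in>P. Im p \<le> y}" and "V = {p\<in>P. y < Im p}"
  have q: "k \<le> card Q" using rank_value(2)[OF P(1) k, of Im] by (simp add: Q_def y_def)
  have lt: "card {p\<in>P. Im p < y} < k" using rank_value(4)[OF P(1) k, of Im] by (simp add: y_def)
  have lev: "real (card {p\<in>P. Im p = y}) \<le> M"
  proof -
    have "{p\<in>P. Im p = y} = P \<inter> gcircle 0 (- \<i>) (- y)" by (auto simp: gcircle_def)
    then show ?thesis using M unfolding no_rich_def by (metis complex_i_not_zero neg_equal_0_iff_equal)
  qed
  have "P = V \<union> ({p\<in>P. Im p < y} \<union> {p\<in>P. Im p = y})" by (auto simp: V_def)
  then have "card P \<le> card V + (card {p\<in>P. Im p < y} + card {p\<in>P. Im p = y})"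
    by (metis (no_types, lifting) add_left_mono card_Un_le order_trans)
  then have "real (card P) \<le> real (card V) + real (card {p\<in>P. Im p < y}) + real (card {p\<in>P. Im p = y})" by linarith
  moreover have "real (card {p\<in>P. Im p < y}) \<le> real (card P) / 2" using lt by (simp add: k_def)
  ultimately have "real (card P) / 2 - M \<le> real (card V)" using lev by linarith
  moreover have "real (card P) / 2 \<le> real (card Q)" using q by (simp add: k_def)
  ultimately show ?thesis by (intro that[of V Q]) (auto simp: V_def Q_def)
qed

section \<open>Choice of the parameters for large \<open>n\<close>\<close>

lemma eventually_sizes:
  shows "eventually (\<lambda>n::nat. 2 \<le> real n powr (19/20)) sequentially"
    "eventually (\<lambda>n::nat. 30 * real n powr (19/20) \<le> real n) sequentially"
    "eventually (\<lambda>n::nat. 10800 * (ln (real n) * real n powr (19/20)) \<le> real n) sequentially"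
    "eventually (\<lambda>n::nat. sqrt (real n) / 5 \<le> sqrt (real n) / 4 - 1) sequentially"
    "eventually (\<lambda>n::nat. 15 * ln (real n) \<le> sqrt (real n)) sequentially"
    "eventually (\<lambda>n::nat. 2 \<le> sqrt (real n) * ln (real n)) sequentially"
  by real_asymp+

text \<open>With a rank bound of order \<open>sqrt n * ln n\<close> the gap bound
  \<open>n powr (1/6)\<close> balances \<open>k\<^sup>2 / m\<close> against
  \<open>k * m\<^sup>2\<close>; both are \<open>n powr (5/6)\<close> up to logarithms.\<close>

lemma eventually_final:
  assumes "c > (0::real)"
  shows "eventually (\<lambda>n::nat. 9 * 22 ^ 3 * (2 * (34000 * (sqrt (real n) * ln (real n))) + 1) *
     (1 + 4 * (34000 * (sqrt (real n) * ln (real n))) / real n powr (1/6) + 2 * (real n powr (1/6) + 1)\<^sup>2) < c * real n) sequentially"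
  using assms by real_asymp

text \<open>For a rank bound of order \<open>n\<close> the balancing gap bound is
  \<open>n powr (1/3)\<close>; the left side then has order \<open>n powr (8/3)\<close>, the right
  side \<open>n powr (57/20)\<close>.\<close>

lemma eventually_rich:
  shows "eventually (\<lambda>n::nat. (22 * real n)\<^sup>2 * (1 + 4 * (22 * real n) / real n powr (1/3) + 2 * (real n powr (1/3) + 1)\<^sup>2) < (real n powr (19/20) - 2) ^ 3) sequentially"
    "eventually (\<lambda>n::nat. 3 \<le> real n powr (19/20)) sequentially"
  by real_asymp+

theorem eventually_rich_circle:
  "eventually (\<lambda>n. \<forall>P B. finite P \<and> card P = n \<and> holds_angles P B \<and> card B \<le> 22 * n \<longrightarrow>
     \<not> no_rich P (real n powr (19/20))) sequentially"
proof -
  \<comment> \<open>The exponent 40 makes \<open>24 * (3/4) ^ 40\<close> at most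
    \<open>1/1200\<close>; together with the same amount for the other term this meets the density
    \<open>1/100\<close> of pairs, as \<open>card V * card Q\<close> is at least
    \<open>x\<^sup>2 / 6\<close>.\<close>
  define K :: nat where "K = 2 * 3 ^ 40"
  have K: "1 \<le> K" by (simp add: K_def)
  \<comment> \<open>Lower bound for the left side of \<open>step_one\<close>, divided by
    \<open>x ^ 4\<close>: after the exceptional points are removed, \<open>V\<close> still
    contributes \<open>1/5 * x\<close>, and \<open>card Q / (2 * K)\<close> is at least
    \<open>x / (4 * K)\<close>.\<close>
  define c where "c = 1/5 * (1 / (4 * real K)) ^ 3"
  have c: "c > 0" using K by (simp add: c_def)
  show ?thesis
    using eventually_sizes eventually_final[OF c] eventually_ge_at_top[of 20]
  proof eventually_elim
    case (elim n)
    define x where "x = real n"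
    have x20: "x \<ge> 20" using elim(8) by (simp add: x_def)
    define M where "M = x powr (19/20)"
    have M2: "2 \<le> M" and M30: "30 * M \<le> x" and Mln: "10800 * (ln x * M) \<le> x"
      using elim(1-3) by (simp_all add: x_def M_def)
    show ?case
    proof (intro allI impI notI)
      fix P B assume "finite P \<and> card P = n \<and> holds_angles P B \<and> card B \<le> 22 * n"
      then have P: "finite P" "card P = n" "holds_angles P B" and B: "card B \<le> 22 * n" by auto
      assume "no_rich P (real n powr (19/20))"
      then have M: "no_rich P M" by (simp add: M_def x_def)
      have cP: "real (card P) = x" using P by (simp add: x_def)
      have "P \<noteq> {}" using cP x20 by auto
      then obtain V Q where VQ: "V \<subseteq> P" "Q \<subseteq> P" "\<And>v q. v \<in> V \<Longrightarrow> q \<in> Q \<Longrightarrow> Im q < Im v"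
        "x / 2 \<le> real (card Q)" "x / 2 - M \<le> real (card V)" using half_split[OF P(1) _ M] cP by metis
      have cV: "x / 3 \<le> real (card V)" using VQ(5) M30 by linarith
      have fin: "finite V" "finite Q" using VQ P finite_subset by blast+
      have ne: "V \<noteq> {}" "Q \<noteq> {}" using cV VQ(4) x20 by auto
      have fB: "finite B" by (rule holds_anglesD(1)[OF P(3)])
      have "0 \<in> B"
      proof -
        obtain v q where vq: "v \<in> V" "q \<in> Q" using ne by blast
        then have "v \<in> P" "q \<in> P" "q \<noteq> v" using VQ(1-3) by (blast, blast, fastforce)
        then show ?thesis using holds_anglesD(3)[OF P(3), of v q v 0 1] by simp
      qed
      then have N0: "real (card B) > 0" using fB by (auto simp: card_gt_0_iff)
      have N22: "real (card B) \<le> 22 * x" using of_nat_mono[OF B, where ?'a = real] by (simp add: x_def)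
      define W where "W = real (card V) * real (card Q) * real (card B)"
      have W0: "W > 0" unfolding W_def using cV VQ(4) x20 N0 by (intro mult_pos_pos) auto
      \<comment> \<open>Small enough for \<open>3 * (r\<^sup>2 + 1) < card Q\<close>, so that some
        class of the cluster argument has four points.\<close>
      define r where "r = nat \<lfloor>sqrt x / 4\<rfloor>"
      have sq: "sqrt x \<ge> 0" "sqrt x * sqrt x = x" using x20 by simp_all
      have r1: "real r \<le> sqrt x / 4" "sqrt x / 4 - 1 < real r" unfolding r_def using sq(1) by linarith+
      have r2: "sqrt x / 5 \<le> real r" using r1(2) elim(4) by (simp add: x_def)
      have lnx: "1 \<le> ln x" using x20 exp_le by (simp add: ln_ge_iff)
      have sq15: "15 * ln x \<le> sqrt x" using elim(5) by (simp add: x_def)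
      have r0: "real r > 0" using r2 sq15 lnx by linarith
      \<comment> \<open>Chosen such that \<open>(1 - \<delta>) ^ r\<close> is at most
        \<open>1 / x ^ 3\<close>, which beats the at most \<open>x ^ 2\<close> pairs to be
        separated.\<close>
      define \<delta> where "\<delta> = 3 * ln x / real r"
      have d1: "\<delta> \<le> 1" using r2 sq15 r0 by (simp add: \<delta>_def divide_le_eq)
      have d0: "0 \<le> \<delta>" using lnx r0 by (simp add: \<delta>_def)
      have d2: "\<delta> \<le> 15 * ln x / sqrt x"
      proof -
        have "sqrt x > 0" using x20 by simp
        have "3 * ln x / real r \<le> 3 * ln x / (sqrt x / 5)"
          by (rule divide_left_mono[OF r2]) (use lnx r0 x20 \<open>sqrt x > 0\<close> in auto)
        then show ?thesis by (simp add: \<delta>_def)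
      qed
      \<comment> \<open>The rank bound must reach \<open>100 * \<delta> * card B\<close> for the
        density \<open>1/100\<close>; since \<open>r\<close> is of order \<open>sqrt x\<close>, this
        is of order \<open>sqrt x * ln x\<close>.\<close>
      define k where "k = nat \<lceil>100 * \<delta> * real (card B)\<rceil> + 1"
      have nn: "0 \<le> 100 * \<delta> * real (card B)" using d0 by simp
      have k1: "100 * \<delta> * real (card B) \<le> real k" "real k \<le> 100 * \<delta> * real (card B) + 2"
        unfolding k_def using nn by linarith+
      define k' where "k' = 34000 * (sqrt x * ln x)"
      have kk: "real k \<le> k'"
      proof -
        have "100 * \<delta> * real (card B) \<le> 100 * (15 * ln x / sqrt x) * (22 * x)"
          by (intro mult_mono) (use d2 d0 N22 lnx sq x20 in auto)
        also have "\<dots> = 33000 * (x / sqrt x * ln x)" by simp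
        also have "x / sqrt x = sqrt x" using x20 by (simp add: real_div_sqrt)
        finally have "real k \<le> 33000 * (sqrt x * ln x) + 2" using k1(2) by linarith
        moreover have "2 \<le> sqrt x * ln x" using elim(6) by (simp add: x_def)
        ultimately show ?thesis unfolding k'_def by linarith
      qed
      define m where "m = nat \<lceil>x powr (1/6)\<rceil>"
      have x6: "1 \<le> x powr (1/6)" using x20 by (intro ge_one_powr_ge_zero) auto
      have m: "x powr (1/6) \<le> real m" "real m \<le> x powr (1/6) + 1" unfolding m_def using x6 by linarith+
      have "1 \<le> real m" using m(1) x6 by linarith
      then have m1: "1 \<le> m" by simp
      have beck: "100 * real (card {(v,q). v \<in> V \<and> q \<in> Q \<and> K \<le> card (line_pts P v q)}) \<le> real (card V) * real (card Q)"
      proof -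
        obtain J where J: "3 ^ J \<le> M / 2" "M / 2 < 3 ^ Suc J" "real J \<le> ln (M / 2)" using power_bracket[of "M / 2"] M2 by auto
        have "ln (M / 2) \<le> ln x" using M2 M30 x20 by (subst ln_le_cancel_iff) auto
        then have Jl: "real J \<le> ln x" using J(3) by linarith
        have "card {(v,q). v \<in> V \<and> q \<in> Q \<and> K \<le> card (line_pts P v q)} \<le>
            card {(p,q). p \<in> P \<and> q \<in> P \<and> p \<noteq> q \<and> K \<le> card (line_pts P p q)}" (is "card ?L \<le> card ?R")
        proof (rule card_mono)
          show "finite ?R" by (rule finite_subset[of _ "P \<times> P"]) (use P in auto)
          show "?L \<subseteq> ?R" using VQ(1,2,3) by fastforce
        qed
        then have "real (card ?L) \<le> real (card ?R)" unfolding of_nat_le_iff .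
        also have "\<dots> \<le> 9 * x * real J * M + 24 * x\<^sup>2 * (3/4) ^ 40"
          using few_complex_pairs_on_rich_lines[OF P(1) M, of J 40] J unfolding cP K_def by simp
        also have "9 * x * real J * M \<le> 9 * x * ln x * M"
          using Jl x20 M2 by (intro mult_right_mono mult_left_mono) auto
        also have "9 * x * ln x * M = 9 * x * (ln x * M)" by simp
        also have "\<dots> \<le> 9 * x * (x / 10800)" using Mln x20 by (intro mult_left_mono) auto
        also have "9 * x * (x / 10800) = x\<^sup>2 / 1200" by (simp add: power2_eq_square)
        also have "24 * x\<^sup>2 * (3/4) ^ 40 \<le> 24 * x\<^sup>2 * (1 / 28800)"
          by (rule mult_left_mono) (simp_all add: power_divide)
        finally have "real (card ?L) \<le> x\<^sup>2 / 1200 + 24 * x\<^sup>2 * (1 / 28800)" by simp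
        then have "100 * real (card ?L) \<le> x / 3 * (x / 2)" by (simp add: power2_eq_square)
        also have "\<dots> \<le> real (card V) * real (card Q)" using cV VQ(4) x20 by (intro mult_mono) auto
        finally show ?thesis .
      qed
      have rr: "(real (card Q))\<^sup>2 * (1 - W * \<delta> / W) ^ r < 1"
      proof -
        have "W * \<delta> / W = \<delta>" using W0 by simp
        moreover have "(1 - \<delta>) ^ r \<le> exp (- \<delta>) ^ r"
          using exp_ge_add_one_self[of "- \<delta>"] d1 by (intro power_mono) auto
        moreover have "exp (- \<delta>) ^ r = exp (- (3 * ln x))" using r0 by (simp add: \<delta>_def flip: exp_of_nat_mult)
        moreover have "exp (- (3 * ln x)) = 1 / x ^ 3"
        proof -
          have "exp (3 * ln x) = x ^ 3" using x20 exp_of_nat_mult[of 3 "ln x"] by simp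
          then show ?thesis by (simp add: exp_minus inverse_eq_divide)
        qed
        moreover have "(real (card Q))\<^sup>2 \<le> x\<^sup>2"
        proof (rule power_mono)
          have "card Q \<le> card P" by (rule card_mono[OF P(1) VQ(2)])
          then show "real (card Q) \<le> x" using cP by linarith
        qed simp
        ultimately have "(real (card Q))\<^sup>2 * (1 - W * \<delta> / W) ^ r \<le> x\<^sup>2 * (1 / x ^ 3)"
          using d1 by (simp only:) (intro mult_mono; simp)
        also have "\<dots> = 1 / x" using x20 by (simp add: power2_eq_square power3_eq_cube)
        also have "\<dots> < 1" using x20 by simp
        finally show ?thesis .
      qed
      have rQ: "3 * (r\<^sup>2 + 1) < card Q"
      proof -
        have "(real r)\<^sup>2 \<le> (sqrt x / 4)\<^sup>2" using r1(1) by (intro power_mono) auto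
        also have "\<dots> = x / 16" using sq x20 by (simp add: power_divide)
        finally have "real (3 * (r\<^sup>2 + 1)) < real (card Q)" using VQ(4) x20 by simp
        then show ?thesis unfolding of_nat_less_iff .
      qed
      have "(9/10 * real (card V) - 3 * M) * (real (card Q) / (2 * real K)) ^ 3 \<le>
         9 * (real (card B)) ^ 3 * (2 * real k + 1) * (1 + 4 * real k / real m + 2 * (real m)\<^sup>2)"
      proof (rule step_one[OF P(3,1) VQ(1,2) ne VQ(3) M beck K _ _ _ _ rQ m1])
        show "W * \<delta> \<le> real (card V) * real (card Q) * real (card B)"
          unfolding W_def[symmetric] using d1 W0 by simp
        have "100 * (W * \<delta>) = (100 * \<delta> * real (card B)) * (real (card V) * real (card Q))"
          by (simp add: W_def)
        also have "\<dots> \<le> real k * (real (card V) * real (card Q))" using k1(1) by (intro mult_right_mono) auto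
        finally show "100 * (W * \<delta>) \<le> real k * (real (card V) * real (card Q))" .
        show "1 \<le> k" by (simp add: k_def)
        show "(real (card Q))\<^sup>2 * (1 - W * \<delta> / (real (card V) * real (card Q) * real (card B))) ^ r < 1"
          using rr unfolding W_def .
      qed
      also have "\<dots> \<le> 9 * (22 * x) ^ 3 * (2 * k' + 1) * (1 + 4 * k' / x powr (1/6) + 2 * (x powr (1/6) + 1)\<^sup>2)"
        by (intro mult_mono add_mono order_refl power_mono frac_le) (use N22 kk m x6 x20 in auto)
      also have "\<dots> = x ^ 3 * (9 * 22 ^ 3 * (2 * k' + 1) * (1 + 4 * k' / x powr (1/6) + 2 * (x powr (1/6) + 1)\<^sup>2))"
        unfolding power_mult_distrib by (simp only: mult_ac)
      also have "\<dots> < x ^ 3 * (c * x)"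
        using elim(7) x20 by (intro mult_strict_left_mono) (simp_all add: k'_def x_def)
      also have "\<dots> = (1/5 * x) * (x / (4 * real K)) ^ 3"
        unfolding c_def power_divide by simp
      also have "\<dots> \<le> (9/10 * real (card V) - 3 * M) * (real (card Q) / (2 * real K)) ^ 3"
      proof (intro mult_mono power_mono)
        show "1/5 * x \<le> 9/10 * real (card V) - 3 * M" using cV M30 by linarith
        then show "0 \<le> 9/10 * real (card V) - 3 * M" using x20 by linarith
        have "x / (4 * real K) = (x / 2) / (2 * real K)" by simp
        also have "\<dots> \<le> real (card Q) / (2 * real K)" by (rule divide_right_mono[OF VQ(4)]) simp
        finally show "x / (4 * real K) \<le> real (card Q) / (2 * real K)" .
      qed (use x20 in auto)
      finally show False by simp
    qed
  qed
qed

section \<open>Points off a rich line or circle\<close>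

text \<open>By \<open>rich_line\<close> any two points off the line are equal or mirror images of
  each other in it, and three distinct points cannot be pairwise mirror images.\<close>

lemma rich_line_exceptions:
  assumes P: "finite P" "holds_angles P B" and b: "b \<noteq> 0" and m: "1 \<le> (m::nat)"
    and big: "(real (card B))\<^sup>2 * (1 + 4 * real (card B) / real m + 2 * (real m)\<^sup>2) < real (card (P \<inter> gcircle 0 b c)) ^ 3"
  shows "card (P - gcircle 0 b c) \<le> 2"
proof (rule ccontr)
  assume "\<not> card (P - gcircle 0 b c) \<le> 2"
  then obtain u1 u2 u3 where u: "u1 \<in> P - gcircle 0 b c" "u2 \<in> P - gcircle 0 b c" "u3 \<in> P - gcircle 0 b c"
    "u1 \<noteq> u2" "u1 \<noteq> u3" "u2 \<noteq> u3" by (rule card_ge_3E)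
  \<comment> \<open>In the coordinate \<open>b * v\<close> the line is vertical with real part
    \<open>- c\<close>, and \<open>Im (b * v)\<close> is the parameter along it.\<close>
  define d p where "d = \<i> / b" and "p = - of_real c / b"
  have d: "d \<noteq> 0" using b by (simp add: d_def)
  define T where "T = (\<lambda>v. Im (b * v)) ` (P \<inter> gcircle 0 b c)"
  have v: "v = p + of_real (Im (b * v)) * d" if "v \<in> gcircle 0 b c" for v
  proof -
    have "Re (b * v) = - c" using that by (simp add: gcircle_def)
    then have "b * v = - of_real c + of_real (Im (b * v)) * \<i>" by (intro complex_eqI) (simp_all only: complex_eq_iff, simp_all)
    then have "v = (- of_real c + of_real (Im (b * v)) * \<i>) / b" using b by (metis nonzero_mult_div_cancel_left)
    then show ?thesis unfolding p_def d_def add_divide_distrib times_divide_eq_right .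
  qed
  have inj: "inj_on (\<lambda>v. Im (b * v)) (P \<inter> gcircle 0 b c)"
    using v by (intro inj_onI) (metis IntD2)
  have cT: "card T = card (P \<inter> gcircle 0 b c)" unfolding T_def by (rule card_image[OF inj])
  have T: "finite T" using P by (simp add: T_def)
  have TP: "p + of_real t * d \<in> P" if "t \<in> T" for t
    using that v unfolding T_def by fastforce
  have obs: "(u - p) / d = Complex (Im (b * u)) (- (Re (b * u) + c))" for u
  proof -
    have "(u - p) / d = (b * u + of_real c) / \<i>" using b by (simp add: p_def d_def field_simps)
    also have "\<dots> = Complex (Im (b * u)) (- (Re (b * u) + c))" by (simp add: complex_eq_iff Re_divide Im_divide)
    finally show ?thesis .
  qed
  have off: "- (Re (b * u) + c) \<noteq> 0" if "u \<in> P - gcircle 0 b c" for u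
    using that unfolding gcircle_def by auto
  have same: "Im (b * u) = Im (b * u') \<and> (- (Re (b * u) + c))\<^sup>2 = (- (Re (b * u') + c))\<^sup>2"
    if uu: "u \<in> P - gcircle 0 b c" "u' \<in> P - gcircle 0 b c" for u u'
  proof (rule ccontr)
    assume n: "\<not> ?thesis"
    have "real (card T) * (real (card T))\<^sup>2 \<le> (real (card B))\<^sup>2 * (1 + 4 * real (card B) / real m + 2 * (real m)\<^sup>2)"
      by (rule rich_line[OF P(2) d T TP _ _ obs obs off[OF uu(1)] off[OF uu(2)] n m]) (use uu in auto)
    moreover have "real (card T) * (real (card T))\<^sup>2 = real (card T) ^ 3" by (simp add: power2_eq_square power3_eq_cube)
    ultimately show False using big cT by simp
  qed
  have eq: "u = u'" if "Im (b * u) = Im (b * u')" "Re (b * u) + c = Re (b * u') + c" for u u'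
  proof -
    have "b * u = b * u'" using that by (intro complex_eqI) simp_all
    then show ?thesis using b by simp
  qed
  have "Re (b * u1) + c = Re (b * u2) + c \<or> Re (b * u1) + c = Re (b * u3) + c \<or> Re (b * u2) + c = Re (b * u3) + c"
    using same[OF u(1,2)] same[OF u(1,3)] unfolding power2_eq_iff by linarith
  then show False using eq same[OF u(1,2)] same[OF u(1,3)] same[OF u(2,3)] u(4-6) by metis
qed

text \<open>One point \<open>p\<close> of the circle becomes the centre of inversion, and a second
  one is lost in \<open>rich_circle\<close>, where \<open>z = y\<close> gives no angle; hence the
  subtraction of 2.\<close>

lemma rich_circle_exceptions:
  assumes P: "finite P" "holds_angles P B" and \<rho>: "\<rho> > 0" and m: "1 \<le> (m::nat)"
    and K: "2 \<le> real (card (P \<inter> {v. cmod (v - z) = \<rho>}))"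
    and big: "(real (card B))\<^sup>2 * (1 + 4 * real (card B) / real m + 2 * (real m)\<^sup>2) < (real (card (P \<inter> {v. cmod (v - z) = \<rho>})) - 2) ^ 3"
    and x: "x \<in> P" "cmod (x - z) \<noteq> \<rho>"
  shows "x = z"
proof (rule ccontr)
  assume xz: "x \<noteq> z"
  let ?C = "P \<inter> {v. cmod (v - z) = \<rho>}"
  have finC: "finite ?C" using P by simp
  have "?C \<noteq> {}"
  proof
    assume e: "?C = {}"
    show False using K unfolding e by simp
  qed
  then obtain p where p: "p \<in> P" "cmod (p - z) = \<rho>" by blast
  define q where "q = p - z"
  have q: "q \<noteq> 0" "cmod q = \<rho>" using p \<rho> by (auto simp: q_def)
  define T where "T = (\<lambda>v. Im (q / (v - p))) ` (?C - {p})"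
  \<comment> \<open>On the circle \<open>w\<close> satisfies \<open>cmod (w + 1) = 1\<close>, which
    for nonzero \<open>w\<close> is the equation \<open>Re (1 / w) = -1/2\<close> of the image
    line.\<close>
  have v: "v = p + q / Complex (-1/2) (Im (q / (v - p)))" if "v \<in> ?C - {p}" for v
  proof -
    define w where "w = (v - p) / q"
    have w0: "w \<noteq> 0" using that q by (simp add: w_def)
    have qw: "q * w = v - p" using q by (simp add: w_def)
    have "v - z = q * (w + 1)" unfolding distrib_left qw by (simp add: q_def)
    then have "\<rho> = \<rho> * cmod (w + 1)" using that q(2) by (simp add: norm_mult)
    then have "cmod (w + 1) = 1" using \<rho> by simp
    then have "(cmod (w + 1))\<^sup>2 = 1" by simp
    then have "2 * Re w + (cmod w)\<^sup>2 = 0" unfolding cmod_power2 by (simp add: power2_eq_square algebra_simps)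
    moreover have "(cmod w)\<^sup>2 \<noteq> 0" using w0 by simp
    moreover have "Re (1 / w) = Re w / (cmod w)\<^sup>2" by (simp add: Re_divide cmod_power2)
    ultimately have "Re (1 / w) = -1/2" by (simp add: divide_eq_eq)
    moreover have "1 / w = q / (v - p)" by (simp add: w_def)
    ultimately have c: "Complex (-1/2) (Im (q / (v - p))) = q / (v - p)" by (simp add: complex_eq_iff)
    have "v - p \<noteq> 0" using that by auto
    then show ?thesis unfolding c using q(1) by simp
  qed
  have inj: "inj_on (\<lambda>v. Im (q / (v - p))) (?C - {p})"
  proof (rule inj_onI)
    fix u w assume uw: "u \<in> ?C - {p}" "w \<in> ?C - {p}" "Im (q / (u - p)) = Im (q / (w - p))"
    show "u = w" using v[OF uw(1)] v[OF uw(2)] unfolding uw(3) by (rule trans[OF _ sym])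
  qed
  have "card T = card (?C - {p})" unfolding T_def by (rule card_image[OF inj])
  also have "\<dots> = card ?C - 1" using p finC by simp
  finally have cT: "real (card T) = real (card ?C) - 1" using K by (simp add: of_nat_diff)
  have T: "finite T" using P by (simp add: T_def)
  have TP: "p + q / Complex (-1/2) t \<in> P" if t: "t \<in> T" for t
  proof -
    obtain u where u: "u \<in> ?C - {p}" "t = Im (q / (u - p))" using t unfolding T_def by blast
    then show ?thesis using v[OF u(1)] by simp
  qed
  have "real (card T) * (real (card T) - 1)\<^sup>2 \<le> (real (card B))\<^sup>2 * (1 + 4 * real (card B) / real m + 2 * (real m)\<^sup>2)"
    by (rule rich_circle[OF P(2) q(1) p(1) T TP x(1) _ _ m]) (use x(2) xz q(2) in \<open>simp_all add: q_def\<close>)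
  moreover have "(real (card ?C) - 2) * (real (card ?C) - 2)\<^sup>2 \<le> real (card T) * (real (card T) - 1)\<^sup>2"
    unfolding cT using K by (intro mult_mono) auto
  moreover have "(real (card ?C) - 2) * (real (card ?C) - 2)\<^sup>2 = (real (card ?C) - 2) ^ 3"
    by (simp add: power2_eq_square power3_eq_cube)
  ultimately show False using big by linarith
qed

theorem eventually_structure:
  "eventually (\<lambda>n. \<forall>P B. finite P \<and> card P = n \<and> holds_angles P B \<and> card B \<le> 22 * n \<longrightarrow>
     (\<exists>b c. b \<noteq> 0 \<and> card (P - gcircle 0 b c) \<le> 2) \<or> (\<exists>z \<rho>. \<rho> > 0 \<and> (\<forall>v\<in>P. cmod (v - z) = \<rho> \<or> v = z))) sequentially"
  using eventually_rich_circle eventually_rich eventually_ge_at_top[of 1]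
proof eventually_elim
  case (elim n)
  define x where "x = real n"
  define M where "M = x powr (19/20)"
  have x1: "1 \<le> x" using elim(4) by (simp add: x_def)
  have M3: "3 \<le> M" using elim(3) by (simp add: M_def x_def)
  show ?case
  proof (intro allI impI)
    fix P B assume "finite P \<and> card P = n \<and> holds_angles P B \<and> card B \<le> 22 * n"
    then have P: "finite P" "card P = n" "holds_angles P B" and B: "card B \<le> 22 * n" by auto
    have "\<not> no_rich P M" unfolding M_def x_def
      by (rule elim(1)[rule_format, OF conjI[OF P(1) conjI[OF P(2) conjI[OF P(3) B]]]])
    then obtain a b c where abc: "a \<noteq> 0 \<or> b \<noteq> 0 \<or> c \<noteq> 0" and rich: "M < real (card (P \<inter> gcircle a b c))"
      unfolding no_rich_def by (meson not_le)
    define m where "m = nat \<lceil>x powr (1/3)\<rceil>"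
    have x3: "1 \<le> x powr (1/3)" using x1 by (intro ge_one_powr_ge_zero) auto
    have m: "x powr (1/3) \<le> real m" "real m \<le> x powr (1/3) + 1" unfolding m_def using x3 by linarith+
    then have m1: "1 \<le> m" using x3 by linarith
    have N22: "real (card B) \<le> 22 * x" using of_nat_mono[OF B, where ?'a = real] by (simp add: x_def)
    have "(real (card B))\<^sup>2 * (1 + 4 * real (card B) / real m + 2 * (real m)\<^sup>2) \<le>
      (22 * x)\<^sup>2 * (1 + 4 * (22 * x) / x powr (1/3) + 2 * (x powr (1/3) + 1)\<^sup>2)"
      by (intro mult_mono add_mono order_refl power_mono frac_le) (use N22 m x3 x1 in auto)
    also have "\<dots> < (M - 2) ^ 3" using elim(2) by (simp add: M_def x_def)
    finally have lt: "(real (card B))\<^sup>2 * (1 + 4 * real (card B) / real m + 2 * (real m)\<^sup>2) < (M - 2) ^ 3" .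
    show "(\<exists>b c. b \<noteq> 0 \<and> card (P - gcircle 0 b c) \<le> 2) \<or> (\<exists>z \<rho>. \<rho> > 0 \<and> (\<forall>v\<in>P. cmod (v - z) = \<rho> \<or> v = z))"
    proof (cases "a = 0")
      case True
      have b: "b \<noteq> 0"
      proof
        assume "b = 0"
        then have "gcircle a b c = {}" using abc True by (auto simp: gcircle_def)
        then show False using rich M3 by simp
      qed
      have "(M - 2) ^ 3 \<le> real (card (P \<inter> gcircle 0 b c)) ^ 3" using rich M3 True by (intro power_mono) auto
      then have "(real (card B))\<^sup>2 * (1 + 4 * real (card B) / real m + 2 * (real m)\<^sup>2) < real (card (P \<inter> gcircle 0 b c)) ^ 3"
        using lt by linarith
      then have "card (P - gcircle 0 b c) \<le> 2" by (rule rich_line_exceptions[OF P(1,3) b m1])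
      then show ?thesis using b by blast
    next
      case False
      \<comment> \<open>Completing the square gives the centre \<open>z\<close> and the squared
        radius \<open>D\<close>; a nonpositive \<open>D\<close> leaves at most one point.\<close>
      define z where "z = - cnj b / of_real (2 * a)"
      define D where "D = (cmod z)\<^sup>2 - c / a"
      have circ: "v \<in> gcircle a b c \<longleftrightarrow> (cmod (v - z))\<^sup>2 = D" for v
      proof -
        have bz: "b = - of_real (2 * a) * cnj z" using False by (simp add: z_def)
        have "a * (cmod v)\<^sup>2 + Re (b * v) + c = a * ((cmod (v - z))\<^sup>2 - (cmod z)\<^sup>2) + c"
          unfolding bz cmod_power2 by (simp add: power2_eq_square algebra_simps)
        also have "\<dots> = a * ((cmod (v - z))\<^sup>2 - D)"
        proof -
          have "a * (c / a) = c" using False by simp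
          then show ?thesis unfolding D_def right_diff_distrib by linarith
        qed
        finally have e: "a * (cmod v)\<^sup>2 + Re (b * v) + c = a * ((cmod (v - z))\<^sup>2 - D)" .
        have "v \<in> gcircle a b c \<longleftrightarrow> a * ((cmod (v - z))\<^sup>2 - D) = 0" unfolding gcircle_def mem_Collect_eq e ..
        then show ?thesis using False by simp
      qed
      have "D > 0"
      proof (rule ccontr)
        assume "\<not> D > 0"
        have "P \<inter> gcircle a b c \<subseteq> {z}"
        proof
          fix v assume "v \<in> P \<inter> gcircle a b c"
          then have "(cmod (v - z))\<^sup>2 \<le> 0" using circ \<open>\<not> D > 0\<close> by auto
          then show "v \<in> {z}" by simp
        qed
        then have "card (P \<inter> gcircle a b c) \<le> 1" using card_mono[of "{z}"] by fastforce
        then show False using rich M3 by simp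
      qed
      have "(cmod (v - z))\<^sup>2 = D \<longleftrightarrow> cmod (v - z) = sqrt D" for v
      proof
        assume "(cmod (v - z))\<^sup>2 = D"
        then show "cmod (v - z) = sqrt D" by (metis norm_ge_zero real_sqrt_unique)
      next
        assume e: "cmod (v - z) = sqrt D"
        show "(cmod (v - z))\<^sup>2 = D" unfolding e using \<open>D > 0\<close> by simp
      qed
      then have "gcircle a b c = {v. cmod (v - z) = sqrt D}" using circ by blast
      then have rich': "M < real (card (P \<inter> {v. cmod (v - z) = sqrt D}))" using rich by simp
      have "(M - 2) ^ 3 \<le> (real (card (P \<inter> {v. cmod (v - z) = sqrt D})) - 2) ^ 3"
        using rich' M3 by (intro power_mono) auto
      then have big: "(real (card B))\<^sup>2 * (1 + 4 * real (card B) / real m + 2 * (real m)\<^sup>2)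
          < (real (card (P \<inter> {v. cmod (v - z) = sqrt D})) - 2) ^ 3" using lt by linarith
      have two: "2 \<le> real (card (P \<inter> {v. cmod (v - z) = sqrt D}))" using rich' M3 by linarith
      have "sqrt D > 0" using \<open>D > 0\<close> by simp
      then have "\<forall>v\<in>P. cmod (v - z) = sqrt D \<or> v = z"
        using rich_circle_exceptions[OF P(1,3) _ m1 two big] by blast
      then show ?thesis using \<open>D > 0\<close> by (intro disjI2 exI[of _ z] exI[of _ "sqrt D"]) simp
    qed
  qed
qed

subsection \<open>Concyclic points\<close>

definition cangle :: "complex \<Rightarrow> complex \<Rightarrow> complex \<Rightarrow> real" where
  "cangle p q r = arccos (Re ((p - q) * cnj (r - q)) / (cmod (p - q) * cmod (r - q)))"

definition cangles :: "complex set \<Rightarrow> real set" where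
  "cangles X = {cangle p q r | p q r. p \<in> X \<and> q \<in> X \<and> r \<in> X \<and> p \<noteq> q \<and> q \<noteq> r \<and> p \<noteq> r}"

lemma cangles_I: "p \<in> X \<Longrightarrow> q \<in> X \<Longrightarrow> r \<in> X \<Longrightarrow> p \<noteq> q \<Longrightarrow> q \<noteq> r \<Longrightarrow> p \<noteq> r \<Longrightarrow> cangle p q r \<in> cangles X"
  unfolding cangles_def by blast

lemma finite_cangles: "finite X \<Longrightarrow> finite (cangles X)"
proof -
  assume X: "finite X"
  have "cangles X \<subseteq> (\<lambda>u. cangle (fst u) (fst (snd u)) (snd (snd u))) ` (X \<times> X \<times> X)"
  proof
    fix a assume "a \<in> cangles X"
    then obtain p q r where "p \<in> X" "q \<in> X" "r \<in> X" "a = cangle p q r" unfolding cangles_def by blast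
    then show "a \<in> (\<lambda>u. cangle (fst u) (fst (snd u)) (snd (snd u))) ` (X \<times> X \<times> X)"
      by (intro image_eqI[of _ _ "(p,q,r)"]) simp_all
  qed
  then show ?thesis using X finite_subset by blast
qed

lemma cangle_rays:
  assumes "p - q = of_real r * u * cis a" "p' - q = of_real s * u * cis b" "r > 0" "s > 0" "u \<noteq> 0" "\<bar>a - b\<bar> \<le> pi"
  shows "cangle p q p' = \<bar>a - b\<bar>"
proof -
  have "(p - q) * cnj (p' - q) = of_real (r * s) * (u * cnj u) * (cis a * cnj (cis b))"
    unfolding assms(1,2) by simp
  also have "u * cnj u = of_real ((cmod u)\<^sup>2)" by (rule complex_norm_square[symmetric])
  also have "cis a * cnj (cis b) = cis (a - b)" by (simp add: cis_cnj cis_mult)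
  finally have "Re ((p - q) * cnj (p' - q)) = r * s * (cmod u)\<^sup>2 * cos (a - b)"
    by (simp flip: of_real_mult)
  moreover have "cmod (p - q) * cmod (p' - q) = r * s * (cmod u)\<^sup>2"
    unfolding assms(1,2) using assms(3,4) by (simp add: norm_mult power2_eq_square)
  moreover have "r * s * (cmod u)\<^sup>2 \<noteq> 0" using assms by simp
  ultimately have "cangle p q p' = arccos (cos (a - b))" unfolding cangle_def by simp
  also have "cos (a - b) = cos \<bar>a - b\<bar>" by simp
  also have "arccos (cos \<bar>a - b\<bar>) = \<bar>a - b\<bar>" using assms(6) by (intro arccos_cos) auto
  finally show ?thesis .
qed

text \<open>The differences from \<open>x\<close> to the larger elements and those from the smaller
  elements to \<open>Max X\<close> are \<open>card X - 1\<close> distinct members of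
  \<open>A\<close>, hence all of \<open>A\<close>. Those of the second kind exceed
  \<open>Max X - x\<close>, so \<open>Min A\<close> is the gap that follows
  \<open>x\<close>.\<close>

lemma equal_gaps:
  assumes X: "finite X" and A: "finite A" "card A \<le> card X - 1"
    and diff: "\<And>x y. x \<in> X \<Longrightarrow> y \<in> X \<Longrightarrow> x < y \<Longrightarrow> y - x \<in> A"
    and x: "x \<in> X" "y \<in> X" "x < y"
  shows "nxt X x = x + Min A"
proof -
  define C where "C = (\<lambda>y. y - x) ` {y\<in>X. x < y} \<union> (\<lambda>w. Max X - w) ` {w\<in>X. w < x}"
  have ne: "X \<noteq> {}" using x by auto
  have le: "y \<le> Max X" if "y \<in> X" for y using X that by simp
  have mx: "Max X \<in> X" using X ne by simp
  have finC: "finite C" using X by (simp add: C_def)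
  have "C \<subseteq> A"
  proof
    fix c assume "c \<in> C"
    then consider y where "y \<in> X" "x < y" "c = y - x" | w where "w \<in> X" "w < x" "c = Max X - w"
      unfolding C_def by blast
    then show "c \<in> A"
    proof cases
      case 1
      then show ?thesis using diff x by blast
    next
      case 2
      then have "w < Max X" using le[OF x(1)] by simp
      then show ?thesis using diff[OF 2(1) mx] 2 by simp
    qed
  qed
  moreover have "card C = card X - 1"
  proof -
    have "(\<lambda>y. y - x) ` {y\<in>X. x < y} \<inter> (\<lambda>w. Max X - w) ` {w\<in>X. w < x} = {}"
      using le by fastforce
    then have "card C = card ((\<lambda>y. y - x) ` {y\<in>X. x < y}) + card ((\<lambda>w. Max X - w) ` {w\<in>X. w < x})"
      unfolding C_def by (intro card_Un_disjoint) (use X in auto)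
    also have "\<dots> = card {y\<in>X. x < y} + card {w\<in>X. w < x}"
      by (intro arg_cong2[of _ _ _ _ "(+)"] card_image) (auto simp: inj_on_def)
    also have "\<dots> = card ({y\<in>X. x < y} \<union> {w\<in>X. w < x})"
      by (rule card_Un_disjoint[symmetric]) (use X in auto)
    also have "{y\<in>X. x < y} \<union> {w\<in>X. w < x} = X - {x}" by auto
    finally show ?thesis using x(1) X by simp
  qed
  ultimately have CA: "C = A" using A by (intro card_seteq) auto
  have nx: "nxt X x \<in> X" "x < nxt X x" using nxt[OF X x(2,3)] by auto
  have "Min A = nxt X x - x"
    unfolding CA[symmetric]
  proof (rule Min_eqI[OF finC])
    show "nxt X x - x \<in> C" using nx by (auto simp: C_def)
    fix c assume "c \<in> C"
    then consider y where "y \<in> X" "x < y" "c = y - x" | w where "w \<in> X" "w < x" "c = Max X - w"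
      unfolding C_def by blast
    then show "nxt X x - x \<le> c"
    proof cases
      case 1
      then show ?thesis using nxt(3)[OF X 1(1,2)] by simp
    next
      case 2
      then show ?thesis using le[OF nx(1)] by simp
    qed
  qed
  then show ?thesis by simp
qed

lemma card_differences_ge:
  fixes X A :: "real set"
  assumes X: "finite X" "X \<noteq> {}" and A: "finite A"
    and diff: "\<And>x y. x \<in> X \<Longrightarrow> y \<in> X \<Longrightarrow> x < y \<Longrightarrow> y - x \<in> A"
  shows "card X - 1 \<le> card (A \<inter> {0<..Max X - Min X})"
proof -
  have m: "Min X \<in> X" using X by simp
  have "(\<lambda>y. y - Min X) ` (X - {Min X}) \<subseteq> A \<inter> {0<..Max X - Min X}"
  proof (rule image_subsetI)
    fix y assume y: "y \<in> X - {Min X}"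
    then have yX: "y \<in> X" by simp
    have le: "Min X \<le> y" "y \<le> Max X" using X(1) yX by simp_all
    have "y \<noteq> Min X" using y by blast
    then have lt: "Min X < y" using le(1) by simp
    then have "y - Min X \<in> A" using diff[OF m yX] by blast
    moreover have "0 < y - Min X" "y - Min X \<le> Max X - Min X" using lt le(2) by linarith+
    ultimately show "y - Min X \<in> A \<inter> {0<..Max X - Min X}"
      by (intro IntI greaterThanAtMost_iff[THEN iffD2] conjI)
  qed
  then have "card ((\<lambda>y. y - Min X) ` (X - {Min X})) \<le> card (A \<inter> {0<..Max X - Min X})"
    by (rule card_mono[rotated]) (use A in simp)
  moreover have "card ((\<lambda>y. y - Min X) ` (X - {Min X})) = card (X - {Min X})"
    by (rule card_image) (simp add: inj_on_def)
  moreover have "card (X - {Min X}) = card X - 1" by (rule card_Diff_singleton[OF m])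
  ultimately show ?thesis by linarith
qed

section \<open>Almost collinear sets\<close>

text \<open>From the point \<open>x\<close> off the line, at least \<open>card X - 2\<close> points
  on it are seen and give at least \<open>card X - 3\<close> angles strictly between 0 and
  \<open>pi\<close>; three collinear points add 0 and \<open>pi\<close>.\<close>

lemma cangles_line:
  assumes X: "finite X" and b: "b \<noteq> 0" and off: "card (X - gcircle 0 b c) \<le> 2" and x: "x \<in> X" "x \<notin> gcircle 0 b c"
    and n: "5 \<le> card X"
  shows "card X - 1 \<le> card (cangles X)"
proof -
  define d p where "d = \<i> / b" and "p = - of_real c / b"
  have d: "d \<noteq> 0" using b by (simp add: d_def)
  define T where "T = {t. p + of_real t * d \<in> X}"
  have inj: "inj (\<lambda>t. p + of_real t * d)" using d by (intro injI) simp
  have T: "finite T" unfolding T_def using finite_vimageI[OF X inj] by (simp add: vimage_def)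
  have on: "X \<inter> gcircle 0 b c \<subseteq> (\<lambda>t. p + of_real t * d) ` T"
  proof
    fix v assume v: "v \<in> X \<inter> gcircle 0 b c"
    then have "Re (b * v) = - c" by (simp add: gcircle_def)
    then have "b * v = - of_real c + of_real (Im (b * v)) * \<i>" by (intro complex_eqI) (simp_all only: complex_eq_iff, simp_all)
    then have "v = (- of_real c + of_real (Im (b * v)) * \<i>) / b" using b by (metis nonzero_mult_div_cancel_left)
    then have e: "v = p + of_real (Im (b * v)) * d" unfolding p_def d_def add_divide_distrib times_divide_eq_right .
    show "v \<in> (\<lambda>t. p + of_real t * d) ` T"
    proof (rule image_eqI[where x = "Im (b * v)"])
      show "v = p + of_real (Im (b * v)) * d" by (rule e)
      show "Im (b * v) \<in> T" using v e[symmetric] unfolding T_def by simp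
    qed
  qed
  have "card X \<le> card (X \<inter> gcircle 0 b c) + card (X - gcircle 0 b c)"
    using card_Un_le[of "X \<inter> gcircle 0 b c" "X - gcircle 0 b c"] by (simp only: Int_Diff_Un)
  then have "card X - 2 \<le> card (X \<inter> gcircle 0 b c)" using off by linarith
  also have "\<dots> \<le> card ((\<lambda>t. p + of_real t * d) ` T)" by (rule card_mono[OF _ on]) (use T in simp)
  also have "\<dots> \<le> card T" by (rule card_image_le[OF T])
  finally have cT: "card X - 2 \<le> card T" .
  obtain t1 t2 t3 where tt: "t1 \<in> T" "t2 \<in> T" "t3 \<in> T" "t1 < t2" "t2 < t3"
  proof -
    have "\<not> card T \<le> 2" using cT n by linarith
    then obtain a b c where "a \<in> T" "b \<in> T" "c \<in> T" "a \<noteq> b" "a \<noteq> c" "b \<noteq> c" by (rule card_ge_3E)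
    then consider "a < b" "b < c" | "a < c" "c < b" | "b < a" "a < c" | "b < c" "c < a" | "c < a" "a < b" | "c < b" "b < a"
      by linarith
    then show ?thesis using \<open>a \<in> T\<close> \<open>b \<in> T\<close> \<open>c \<in> T\<close> that by cases blast+
  qed
  define a h where "a = Re ((x - p) / d)" and "h = Im ((x - p) / d)"
  have xp: "x = p + Complex a h * d" using d by (simp add: a_def h_def)
  have h: "h \<noteq> 0"
  proof
    assume "h = 0"
    then have "Complex a h = of_real a" by (simp add: complex_eq_iff)
    then have "b * x = - of_real c + of_real a * \<i>" unfolding xp p_def d_def using b by (simp add: distrib_left right_diff_distrib)
    then have "Re (b * x) = - c" by (simp only: plus_complex.sel uminus_complex.sel Re_complex_of_real) simp
    then show False using x(2) by (simp add: gcircle_def)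
  qed
  have ang: "\<bar>view a h s - view a h t\<bar> \<in> cangles X" if st: "s \<in> T" "t \<in> T" "s \<noteq> t" for s t
  proof -
    have ray: "\<exists>r>0. p + of_real s * d - x = of_real r * (- \<i> * of_real h * d) * cis (view a h s)" for s
    proof -
      obtain r where r: "r > 0" "of_real s - Complex a h = - \<i> * of_real h * of_real r * cis (view a h s)"
        using view_cis[OF h] by blast
      have "p + of_real s * d - x = (of_real s - Complex a h) * d" by (simp add: xp algebra_simps)
      also have "\<dots> = of_real r * (- \<i> * of_real h * d) * cis (view a h s)" unfolding r(2) by simp
      finally show ?thesis using r(1) by blast
    qed
    obtain r where r: "r > 0" "p + of_real s * d - x = of_real r * (- \<i> * of_real h * d) * cis (view a h s)" using ray by blast
    obtain r' where r': "r' > 0" "p + of_real t * d - x = of_real r' * (- \<i> * of_real h * d) * cis (view a h t)" using ray by blast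
    have "cangle (p + of_real s * d) x (p + of_real t * d) = \<bar>view a h s - view a h t\<bar>"
      by (rule cangle_rays[OF r(2) r'(2) r(1) r'(1)])
        (use h d view_bounds[of a h s] view_bounds[of a h t] in \<open>simp, linarith\<close>)
    moreover have "p + of_real s * d \<noteq> p + of_real t * d" using st(3) d by simp
    moreover have "p + of_real t * d \<noteq> x" for t
    proof
      assume "p + of_real t * d = x"
      then have "of_real t = Complex a h" using d by (simp add: xp)
      then show False using h by (simp add: complex_eq_iff)
    qed
    ultimately show ?thesis using cangles_I[of "p + of_real s * d" X x "p + of_real t * d"] st x(1) unfolding T_def
      by (metis mem_Collect_eq)
  qed
  define Y where "Y = view a h ` T"
  have cY: "card Y = card T" unfolding Y_def by (rule card_image) (use inj_view[OF h] in \<open>auto intro: inj_on_subset\<close>)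
  have Y: "finite Y" "Y \<noteq> {}" using T tt by (auto simp: Y_def)
  define G where "G = cangles X \<inter> {0<..Max Y - Min Y}"
  have cG: "card Y - 1 \<le> card G" unfolding G_def
  proof (rule card_differences_ge[OF Y finite_cangles[OF X]])
    fix u w assume "u \<in> Y" "w \<in> Y" "u < w"
    then obtain s t where "s \<in> T" "t \<in> T" "u = view a h s" "w = view a h t" by (auto simp: Y_def)
    then show "w - u \<in> cangles X" using ang[of t s] \<open>u < w\<close> by fastforce
  qed
  have lt: "Max Y - Min Y < pi"
  proof -
    have "Max Y \<in> Y" "Min Y \<in> Y" using Y by auto
    then obtain s t where "Max Y = view a h s" "Min Y = view a h t" unfolding Y_def by blast
    then show ?thesis using view_bounds[of a h s] view_bounds[of a h t] by linarith
  qed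
  have mem: "0 \<in> cangles X" "pi \<in> cangles X"
  proof -
    let ?v = "\<lambda>t. p + of_real t * d"
    have v: "?v t1 \<in> X" "?v t2 \<in> X" "?v t3 \<in> X" using tt by (simp_all add: T_def)
    have ne: "?v t1 \<noteq> ?v t2" "?v t2 \<noteq> ?v t3" "?v t1 \<noteq> ?v t3" using tt d by simp_all
    have "cangle (?v t2) (?v t1) (?v t3) = \<bar>0 - 0\<bar>"
      by (rule cangle_rays[of _ _ "t2 - t1" d _ _ "t3 - t1"]) (use tt d in \<open>simp_all add: algebra_simps\<close>)
    then show "0 \<in> cangles X" using cangles_I[OF v(2,1,3) ne(1)[symmetric] ne(3,2)] by simp
    have "cangle (?v t1) (?v t2) (?v t3) = \<bar>pi - 0\<bar>"
      by (rule cangle_rays[of _ _ "t2 - t1" d _ _ "t3 - t2"]) (use tt d in \<open>simp_all add: algebra_simps\<close>)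
    then show "pi \<in> cangles X" using cangles_I[OF v ne] by simp
  qed
  have fG: "finite G" using finite_cangles[OF X] by (simp add: G_def)
  have "insert 0 (insert pi G) \<subseteq> cangles X" using mem by (auto simp: G_def)
  then have "card (insert 0 (insert pi G)) \<le> card (cangles X)" by (rule card_mono[OF finite_cangles[OF X]])
  moreover have "0 \<notin> insert pi G" "pi \<notin> G" using lt by (auto simp: G_def)
  then have "card (insert 0 (insert pi G)) = Suc (Suc (card G))" using fG by simp
  ultimately show ?thesis using cG cT cY n by linarith
qed

section \<open>Points on a circle in half-angle coordinates\<close>

text \<open>\<open>cis t - cis s\<close> is \<open>2 * sin ((t - s) / 2)\<close> times
  \<open>\<i> * cis ((s + t) / 2)\<close>. From the point with parameter \<open>s\<close>, the one
  with parameter \<open>t\<close> thus has direction \<open>t / 2\<close> up to a fixed rotation,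
  which is the inscribed angle theorem.\<close>

lemma circle_ray:
  assumes "s < t" "t < s + 2 * pi" "\<rho> > 0"
  shows "\<exists>r>0. (z + of_real \<rho> * cis t) - (z + of_real \<rho> * cis s) = of_real r * (\<i> * cis (s / 2)) * cis (t / 2)"
proof -
  define m k where "m = (t + s) / 2" and "k = (t - s) / 2"
  have k: "0 < k" "k < pi" using assms by (auto simp: k_def)
  have t: "t = m + k" "s = m - k" by (simp_all add: m_def k_def field_simps)
  have "cis t - cis s = of_real (2 * sin k) * (\<i> * cis m)"
    unfolding t by (simp add: complex_eq_iff cos_add cos_diff sin_add sin_diff)
  moreover have "cis m = cis (s / 2) * cis (t / 2)" by (simp add: cis_mult m_def add_divide_distrib add.commute)
  ultimately have "(z + of_real \<rho> * cis t) - (z + of_real \<rho> * cis s) = of_real (\<rho> * (2 * sin k)) * (\<i> * cis (s / 2)) * cis (t / 2)"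
    by (simp add: mult.assoc flip: right_diff_distrib)
  moreover have "\<rho> * (2 * sin k) > 0" using sin_gt_zero[OF k] assms(3) by simp
  ultimately show ?thesis by blast
qed

text \<open>The centre lies in the direction of the antipode, so it behaves like a further point
  with parameter \<open>s + pi\<close>.\<close>

lemma centre_ray:
  "z - (z + of_real \<rho> * cis s) = of_real \<rho> * (\<i> * cis (s / 2)) * cis ((s + pi) / 2)"
proof -
  have "cis (s / 2) * cis ((s + pi) / 2) = cis (s + pi / 2)" by (simp add: cis_mult field_simps)
  also have "\<dots> = cis s * \<i>" by (simp flip: cis_mult)
  finally have e: "cis (s / 2) * cis ((s + pi) / 2) = cis s * \<i>" .
  have "of_real \<rho> * (\<i> * cis (s / 2)) * cis ((s + pi) / 2) = of_real \<rho> * \<i> * (cis (s / 2) * cis ((s + pi) / 2))" by simp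
  also have "\<dots> = z - (z + of_real \<rho> * cis s)" unfolding e by (simp add: mult_ac)
  finally show ?thesis by simp
qed

text \<open>The sorted arguments are continued periodically: in an infinite increasing sequence the
  other points seen from index \<open>i\<close> are those strictly between \<open>i\<close> and
  \<open>i + card X\<close>, without wrap-around.\<close>

lemma circle_enumeration:
  assumes X: "finite X" "X \<noteq> {}" and c: "\<And>v. v \<in> X \<Longrightarrow> cmod (v - z) = \<rho>" and \<rho>: "\<rho> > 0"
  obtains \<theta> :: "nat \<Rightarrow> real" where "strict_mono \<theta>" "\<And>i. \<theta> (i + card X) = \<theta> i + 2 * pi"
    "\<And>i. z + of_real \<rho> * cis (\<theta> i) \<in> X" "X = (\<lambda>i. z + of_real \<rho> * cis (\<theta> i)) ` {..<card X}"
proof -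
  define n where "n = card X"
  have n: "n > 0" using X by (simp add: n_def card_gt_0_iff)
  define S where "S = (\<lambda>v. Arg (v - z)) ` X"
  have v: "v = z + of_real \<rho> * cis (Arg (v - z))" if "v \<in> X" for v
    using rcis_cmod_Arg[of "v - z"] c[OF that] unfolding rcis_def by (simp add: algebra_simps)
  have "card S = n" unfolding S_def n_def
    by (rule card_image) (metis (no_types, lifting) inj_onI v)
  define xs where "xs = sorted_list_of_set S"
  have fS: "finite S" using X by (simp add: S_def)
  have xs: "sorted_wrt (<) xs" "set xs = S" "length xs = n"
    using fS \<open>card S = n\<close> by (simp_all add: xs_def)
  define \<theta> where "\<theta> = (\<lambda>i. xs ! (i mod n) + 2 * pi * real (i div n))"
  have rng: "- pi < xs ! i" "xs ! i \<le> pi" if "i < n" for i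
  proof -
    have "xs ! i \<in> S" using that xs by (metis nth_mem)
    then show "- pi < xs ! i" "xs ! i \<le> pi" using Arg_bounded by (auto simp: S_def)
  qed
  show ?thesis
  proof (rule that[of \<theta>])
    show "strict_mono \<theta>"
      unfolding strict_mono_Suc_iff
    proof
      fix i
      have il: "i mod n < n" using n by simp
      show "\<theta> i < \<theta> (Suc i)"
      proof (cases "Suc (i mod n) = n")
        case True
        then have m: "Suc i mod n = 0" "Suc i div n = Suc (i div n)" by (simp_all add: mod_Suc div_Suc)
        have "xs ! (i mod n) < xs ! 0 + 2 * pi" using rng[OF il] rng[OF n] by linarith
        then show ?thesis unfolding \<theta>_def m by (simp add: distrib_left)
      next
        case False
        then have m: "Suc i mod n = Suc (i mod n)" "Suc i div n = i div n" by (simp_all add: mod_Suc div_Suc)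
        have "xs ! (i mod n) < xs ! Suc (i mod n)"
          using sorted_wrt_nth_less[OF xs(1), of "i mod n" "Suc (i mod n)"] il False xs(3) by simp
        then show ?thesis unfolding \<theta>_def m by simp
      qed
    qed
    show "\<theta> (i + card X) = \<theta> i + 2 * pi" for i
      using n by (simp add: \<theta>_def distrib_left flip: n_def)
    have cis: "cis (\<theta> i) = cis (xs ! (i mod n))" for i
      unfolding \<theta>_def by (simp add: complex_eq_iff cos_add sin_add mult.commute[of _ "2 * pi"] mult.assoc)
       (use cos_2npi[of "i div n"] sin_2npi[of "i div n"] in \<open>simp add: mult_ac\<close>)
    show mem: "z + of_real \<rho> * cis (\<theta> i) \<in> X" for i
    proof -
      have "xs ! (i mod n) \<in> S" using n xs by (metis mod_less_divisor nth_mem)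
      then obtain u where u: "u \<in> X" "xs ! (i mod n) = Arg (u - z)" unfolding S_def by blast
      show ?thesis unfolding cis u(2) using v[OF u(1)] u(1) by simp
    qed
    show "X = (\<lambda>i. z + of_real \<rho> * cis (\<theta> i)) ` {..<card X}"
    proof
      show "X \<subseteq> (\<lambda>i. z + of_real \<rho> * cis (\<theta> i)) ` {..<card X}"
      proof
        fix u assume u: "u \<in> X"
        then have "Arg (u - z) \<in> set xs" by (simp add: xs(2) S_def)
        then obtain i where i: "i < n" "xs ! i = Arg (u - z)" using xs(3) by (metis in_set_conv_nth)
        have "u = z + of_real \<rho> * cis (\<theta> i)" unfolding cis using i v[OF u] by simp
        then show "u \<in> (\<lambda>i. z + of_real \<rho> * cis (\<theta> i)) ` {..<card X}" using i(1) by (auto simp: n_def)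
      qed
    qed (use mem in blast)
  qed
qed

definition winding :: "nat \<Rightarrow> (nat \<Rightarrow> real) \<Rightarrow> bool" where
  "winding n \<theta> \<longleftrightarrow> strict_mono \<theta> \<and> (\<forall>i. \<theta> (i + n) = \<theta> i + 2 * pi)"

abbreviation circ :: "complex \<Rightarrow> real \<Rightarrow> real \<Rightarrow> complex" where
  "circ z \<rho> t \<equiv> z + of_real \<rho> * cis t"

lemma winding_window:
  assumes "winding n \<theta>" "i < j" "j < i + n"
  shows "\<theta> i < \<theta> j" "\<theta> j < \<theta> i + 2 * pi"
proof -
  have sm: "strict_mono \<theta>" and p: "\<theta> (i + n) = \<theta> i + 2 * pi" using assms(1) by (auto simp: winding_def)
  show "\<theta> i < \<theta> j" using strict_monoD[OF sm assms(2)] .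
  show "\<theta> j < \<theta> i + 2 * pi" using strict_monoD[OF sm assms(3)] p by simp
qed

lemma circ_neq: "s < t \<Longrightarrow> t < s + 2 * pi \<Longrightarrow> \<rho> > 0 \<Longrightarrow> circ z \<rho> t \<noteq> circ z \<rho> s"
  using circle_ray[of s t \<rho> z] by auto

lemma inscribed_angle:
  assumes "s < t" "t < s + 2 * pi" "s < u" "u < s + 2 * pi" "\<rho> > 0"
  shows "cangle (circ z \<rho> t) (circ z \<rho> s) (circ z \<rho> u) = \<bar>t - u\<bar> / 2"
proof -
  obtain r where r: "r > 0" "circ z \<rho> t - circ z \<rho> s = of_real r * (\<i> * cis (s / 2)) * cis (t / 2)"
    using circle_ray[OF assms(1,2,5)] by blast
  obtain r' where r': "r' > 0" "circ z \<rho> u - circ z \<rho> s = of_real r' * (\<i> * cis (s / 2)) * cis (u / 2)"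
    using circle_ray[OF assms(3,4,5)] by blast
  have "cangle (circ z \<rho> t) (circ z \<rho> s) (circ z \<rho> u) = \<bar>t / 2 - u / 2\<bar>"
    by (rule cangle_rays[OF r(2) r'(2) r(1) r'(1)]) (use assms in auto)
  then show ?thesis by (simp add: diff_divide_distrib[symmetric])
qed

lemma central_angle:
  assumes "s < t" "t < s + 2 * pi" "\<rho> > 0"
  shows "cangle (circ z \<rho> t) (circ z \<rho> s) z = \<bar>t - (s + pi)\<bar> / 2"
    "cangle z (circ z \<rho> s) (circ z \<rho> t) = \<bar>t - (s + pi)\<bar> / 2"
proof -
  obtain r where r: "r > 0" "circ z \<rho> t - circ z \<rho> s = of_real r * (\<i> * cis (s / 2)) * cis (t / 2)"
    using circle_ray[OF assms] by blast
  have "t / 2 - (s + pi) / 2 \<le> pi" "- (t / 2 - (s + pi) / 2) \<le> pi" using assms pi_gt_zero by argo+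
  then have "\<bar>t / 2 - (s + pi) / 2\<bar> \<le> pi" by (rule abs_leI)
  then have "cangle (circ z \<rho> t) (circ z \<rho> s) z = \<bar>t / 2 - (s + pi) / 2\<bar>"
    "cangle z (circ z \<rho> s) (circ z \<rho> t) = \<bar>(s + pi) / 2 - t / 2\<bar>"
    by (intro cangle_rays[OF r(2) centre_ray r(1) assms(3)] cangle_rays[OF centre_ray r(2) assms(3) r(1)]; simp)+
  then show "cangle (circ z \<rho> t) (circ z \<rho> s) z = \<bar>t - (s + pi)\<bar> / 2"
    "cangle z (circ z \<rho> s) (circ z \<rho> t) = \<bar>t - (s + pi)\<bar> / 2" by (auto simp: field_simps abs_if)
qed

lemma winding_angles:
  assumes w: "winding n \<theta>" and \<rho>: "\<rho> > 0" and X: "\<And>i. circ z \<rho> (\<theta> i) \<in> X"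
    and ij: "i < j" "j < i + n" "i < k" "k < i + n" "\<theta> j < \<theta> k"
  shows "\<theta> k / 2 - \<theta> j / 2 \<in> cangles X"
proof -
  note W = winding_window[OF w]
  have "cangle (circ z \<rho> (\<theta> k)) (circ z \<rho> (\<theta> i)) (circ z \<rho> (\<theta> j)) = \<theta> k / 2 - \<theta> j / 2"
    using inscribed_angle[OF W[OF ij(3,4)] W[OF ij(1,2)] \<rho>, of z] ij(5) by simp
  moreover have "circ z \<rho> (\<theta> k) \<noteq> circ z \<rho> (\<theta> i)" "circ z \<rho> (\<theta> j) \<noteq> circ z \<rho> (\<theta> i)"
    by (rule circ_neq[OF W[OF ij(3,4)] \<rho>] circ_neq[OF W[OF ij(1,2)] \<rho>])+
  moreover have "circ z \<rho> (\<theta> k) \<noteq> circ z \<rho> (\<theta> j)"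
    by (rule circ_neq[OF ij(5) _ \<rho>]) (use W[OF ij(3,4)] W[OF ij(1,2)] in linarith)
  ultimately show ?thesis using cangles_I[OF X X X] by metis
qed

lemma winding_inj: "winding n \<theta> \<Longrightarrow> inj \<theta>"
  unfolding winding_def by (auto intro: strict_mono_imp_inj_on)

lemma winding_half_card:
  assumes "winding n \<theta>" "1 \<le> n"
  shows "card ((\<lambda>j. \<theta> j / 2) ` {i<..<i + n}) = n - 1"
  using card_image[of "\<lambda>j. \<theta> j / 2" "{i<..<i + n}"] winding_inj[OF assms(1)] by (simp add: inj_on_def inj_def)

text \<open>From the point with index 0 the others have \<open>n - 1\<close> directions in an
  interval shorter than \<open>pi\<close>, and the differences to the smallest one are
  angles.\<close>

lemma concyclic_bound:
  assumes w: "winding n \<theta>" and \<rho>: "\<rho> > 0" and X: "\<And>i. circ z \<rho> (\<theta> i) \<in> X" and fX: "finite X" and n: "2 \<le> n"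
  shows "n - 2 \<le> card (cangles X \<inter> {0<..<pi})"
proof -
  let ?Y = "(\<lambda>j. \<theta> j / 2) ` {0<..<0 + n}"
  have "\<theta> 1 / 2 \<in> ?Y" using n by auto
  then have Y: "finite ?Y" "?Y \<noteq> {}" by auto
  have "card ?Y - 1 \<le> card (cangles X \<inter> {0<..Max ?Y - Min ?Y})"
  proof (rule card_differences_ge[OF Y finite_cangles[OF fX]])
    fix x y assume "x \<in> ?Y" "y \<in> ?Y" "x < y"
    then obtain j k where jk: "0 < j" "j < 0 + n" "x = \<theta> j / 2" "0 < k" "k < 0 + n" "y = \<theta> k / 2" by auto
    then have "\<theta> j < \<theta> k" using \<open>x < y\<close> by simp
    then show "y - x \<in> cangles X" unfolding jk(3,6) by (rule winding_angles[OF w \<rho> X jk(1,2,4,5)])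
  qed
  also have "\<dots> \<le> card (cangles X \<inter> {0<..<pi})"
  proof (rule card_mono)
    show "finite (cangles X \<inter> {0<..<pi})" using finite_cangles[OF fX] by simp
    have "Max ?Y \<in> ?Y" "Min ?Y \<in> ?Y" by (rule Max_in[OF Y], rule Min_in[OF Y])
    then obtain j k where "0 < j" "j < 0 + n" "Max ?Y = \<theta> j / 2" "0 < k" "k < 0 + n" "Min ?Y = \<theta> k / 2" by auto
    then have "Max ?Y - Min ?Y < pi" using winding_window[OF w, of 0 j] winding_window[OF w, of 0 k] by linarith
    then show "cangles X \<inter> {0<..Max ?Y - Min ?Y} \<subseteq> cangles X \<inter> {0<..<pi}" by auto
  qed
  finally show ?thesis using winding_half_card[OF w, of 0] n by simp
qed

text \<open>Applied at every point, \<open>equal_gaps\<close> shows that the step after its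
  successor is \<open>2 * \<delta>\<close>, with one \<open>\<delta>\<close> for all points because
  it is the least angle of the whole set.\<close>

lemma concyclic_extremal:
  assumes w: "winding n \<theta>" and \<rho>: "\<rho> > 0" and X: "\<And>i. circ z \<rho> (\<theta> i) \<in> X" and fX: "finite X" and n: "3 \<le> n"
    and A: "card (cangles X) \<le> n - 2"
  obtains t where "\<And>i. \<theta> i = t + 2 * pi * real i / real n"
proof -
  define \<delta> where "\<delta> = Min (cangles X)"
  have per: "\<theta> (i + n) = \<theta> i + 2 * pi" for i using w by (simp add: winding_def)
  have step: "\<theta> (i + 2) = \<theta> (i + 1) + 2 * \<delta>" for i
  proof -
    let ?Y = "(\<lambda>j. \<theta> j / 2) ` {i<..<i + n}"
    have mem: "\<theta> (i + 1) / 2 \<in> ?Y" "\<theta> (i + 2) / 2 \<in> ?Y" using n by auto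
    have lt: "\<theta> (i + 1) / 2 < \<theta> (i + 2) / 2" using w by (simp add: winding_def strict_mono_less)
    have fY: "finite ?Y" by simp
    have nx: "nxt ?Y (\<theta> (i + 1) / 2) = \<theta> (i + 1) / 2 + \<delta>"
      unfolding \<delta>_def
    proof (rule equal_gaps[OF fY finite_cangles[OF fX] _ _ mem lt])
      show "card (cangles X) \<le> card ?Y - 1" using winding_half_card[OF w, of i] n A by simp
      fix x y assume "x \<in> ?Y" "y \<in> ?Y" "x < y"
      then obtain j k where jk: "i < j" "j < i + n" "x = \<theta> j / 2" "i < k" "k < i + n" "y = \<theta> k / 2" by auto
      then have "\<theta> j < \<theta> k" using \<open>x < y\<close> by simp
      then show "y - x \<in> cangles X" unfolding jk(3,6) by (rule winding_angles[OF w \<rho> X jk(1,2,4,5)])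
    qed
    have "nxt ?Y (\<theta> (i + 1) / 2) = \<theta> (i + 2) / 2"
    proof (rule antisym)
      show "nxt ?Y (\<theta> (i + 1) / 2) \<le> \<theta> (i + 2) / 2" by (rule nxt(3)[OF fY mem(2) lt])
      obtain j where j: "i < j" "nxt ?Y (\<theta> (i + 1) / 2) = \<theta> j / 2" using nxt(1)[OF fY mem(2) lt] by auto
      have "\<theta> (i + 1) < \<theta> j" using nxt(2)[OF fY mem(2) lt] j(2) by simp
      then have "i + 1 < j" using w by (simp add: winding_def strict_mono_less)
      then have "\<theta> (i + 2) \<le> \<theta> j" using w by (simp add: winding_def strict_mono_less_eq)
      then show "\<theta> (i + 2) / 2 \<le> nxt ?Y (\<theta> (i + 1) / 2)" using j(2) by simp
    qed
    then show ?thesis using nx by simp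
  qed
  have ar: "\<theta> (1 + k) = \<theta> 1 + 2 * \<delta> * real k" for k
  proof (induction k)
    case (Suc k)
    then show ?case using step[of k] by (simp add: algebra_simps)
  qed simp
  have d: "2 * pi = 2 * \<delta> * real n" using ar[of n] per[of 1] by simp
  then have d': "2 * \<delta> = 2 * pi / real n" using n by (simp add: eq_divide_eq)
  \<comment> \<open>The recursion starts at index 1; index 0 is reached through the period.\<close>
  have "\<theta> i = (\<theta> 1 - 2 * \<delta>) + 2 * pi * real i / real n" for i
  proof -
    have "i + n = 1 + (i + n - 1)" using n by simp
    then have "\<theta> (i + n) = \<theta> 1 + 2 * \<delta> * real (i + n - 1)" using ar by metis
    also have "real (i + n - 1) = real i + real n - 1" using n by (simp add: of_nat_diff)
    also have "2 * \<delta> * (real i + real n - 1) = 2 * \<delta> * real i + 2 * \<delta> * real n - 2 * \<delta>" by (simp add: algebra_simps)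
    finally have "\<theta> i = (\<theta> 1 - 2 * \<delta>) + 2 * \<delta> * real i" using per[of i] d by linarith
    then show ?thesis unfolding d' by simp
  qed
  then show ?thesis by (rule that)
qed

text \<open>With the centre each point has \<open>m\<close> directions, the extra one being its
  antipode, so \<open>m - 1\<close> angles would again force equal gaps. The points would be equally
  spaced and yet an antipode would lie strictly inside a gap.\<close>

lemma concyclic_with_centre:
  assumes w: "winding m \<theta>" and \<rho>: "\<rho> > 0" and X: "\<And>i. circ z \<rho> (\<theta> i) \<in> X" and z: "z \<in> X" and fX: "finite X" and m: "4 \<le> m"
  shows "m \<le> card (cangles X)"
proof (rule ccontr)
  assume "\<not> m \<le> card (cangles X)"
  then have A: "card (cangles X) \<le> m - 1" by simp
  have sm: "strict_mono \<theta>" and per: "\<And>i. \<theta> (i + m) = \<theta> i + 2 * pi" using w by (auto simp: winding_def)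
  note W = winding_window[OF w]
  have zne: "circ z \<rho> t \<noteq> z" for t using \<rho> by simp
  \<comment> \<open>An antipodal pair would produce the angles 0 and \<open>pi\<close> on top of the
    \<open>m - 2\<close> inscribed ones.\<close>
  have no_antipode: "\<theta> j \<noteq> \<theta> i + pi" if ij: "i < j" "j < i + m" for i j
  proof
    assume e: "\<theta> j = \<theta> i + pi"
    have cij: "circ z \<rho> (\<theta> j) \<noteq> circ z \<rho> (\<theta> i)" by (rule circ_neq[OF W[OF ij] \<rho>])
    have "cangle (circ z \<rho> (\<theta> j)) (circ z \<rho> (\<theta> i)) z = 0" using central_angle(1)[OF W[OF ij] \<rho>, of z] e by simp
    then have 0: "0 \<in> cangles X" using cangles_I[OF X X z cij zne zne] by metis
    have ci: "circ z \<rho> (\<theta> i) - z = of_real \<rho> * cis (\<theta> i) * cis 0" "circ z \<rho> (\<theta> j) - z = of_real \<rho> * cis (\<theta> i) * cis pi"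
      unfolding e by (simp_all flip: cis_mult)
    have "cangle (circ z \<rho> (\<theta> i)) z (circ z \<rho> (\<theta> j)) = \<bar>0 - pi\<bar>"
      by (rule cangle_rays[OF ci \<rho> \<rho>]) auto
    then have 1: "pi \<in> cangles X" using cangles_I[OF X z X zne zne[symmetric] cij[symmetric]] by simp
    have "insert 0 (insert pi (cangles X \<inter> {0<..<pi})) \<subseteq> cangles X" using 0 1 by auto
    then have "card (insert 0 (insert pi (cangles X \<inter> {0<..<pi}))) \<le> card (cangles X)"
      by (rule card_mono[OF finite_cangles[OF fX]])
    moreover have "card (insert 0 (insert pi (cangles X \<inter> {0<..<pi}))) = Suc (Suc (card (cangles X \<inter> {0<..<pi})))"
      using finite_cangles[OF fX] by simp
    moreover have "m - 2 \<le> card (cangles X \<inter> {0<..<pi})" by (rule concyclic_bound[OF w \<rho> X fX]) (use m in simp)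
    ultimately show False using A m by linarith
  qed
  define \<delta> where "\<delta> = Min (cangles X)"
  define Y where "Y = (\<lambda>i. insert ((\<theta> i + pi) / 2) ((\<lambda>j. \<theta> j / 2) ` {i<..<i + m}))"
  have fY: "finite (Y i)" for i by (simp add: Y_def)
  have cY: "card (Y i) = m" for i
  proof -
    have "(\<theta> i + pi) / 2 \<notin> (\<lambda>j. \<theta> j / 2) ` {i<..<i + m}"
    proof
      assume "(\<theta> i + pi) / 2 \<in> (\<lambda>j. \<theta> j / 2) ` {i<..<i + m}"
      then obtain j where "i < j" "j < i + m" "(\<theta> i + pi) / 2 = \<theta> j / 2" by auto
      then show False using no_antipode[of i j] by simp
    qed
    then show ?thesis using winding_half_card[OF w, of i] m by (simp add: Y_def)
  qed
  have diff: "y - x \<in> cangles X" if xy: "x \<in> Y i" "y \<in> Y i" "x < y" for i x y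
  proof -
    have cen: "\<bar>\<theta> j - (\<theta> i + pi)\<bar> / 2 \<in> cangles X" if ij: "i < j" "j < i + m" for j
    proof -
      have cij: "circ z \<rho> (\<theta> j) \<noteq> circ z \<rho> (\<theta> i)" by (rule circ_neq[OF W[OF ij] \<rho>])
      then show ?thesis using cangles_I[OF X X z cij zne zne] central_angle(1)[OF W[OF ij] \<rho>, of z] by simp
    qed
    consider j k where "i < j" "j < i + m" "x = \<theta> j / 2" "i < k" "k < i + m" "y = \<theta> k / 2"
      | j where "i < j" "j < i + m" "x = \<theta> j / 2" "y = (\<theta> i + pi) / 2"
      | k where "x = (\<theta> i + pi) / 2" "i < k" "k < i + m" "y = \<theta> k / 2"
      using xy unfolding Y_def by auto
    then show ?thesis
    proof cases
      case 1
      then have "\<theta> j < \<theta> k" using xy(3) by simp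
      then show ?thesis unfolding 1(3,6) by (rule winding_angles[OF w \<rho> X 1(1,2,4,5)])
    next
      case 2
      then have "\<bar>\<theta> j - (\<theta> i + pi)\<bar> / 2 = y - x" using xy(3) by (simp add: diff_divide_distrib[symmetric])
      then show ?thesis using cen[OF 2(1,2)] by (simp only:)
    next
      case 3
      then have "\<bar>\<theta> k - (\<theta> i + pi)\<bar> / 2 = y - x" using xy(3) by (simp add: diff_divide_distrib[symmetric])
      then show ?thesis using cen[OF 3(2,3)] by (simp only:)
    qed
  qed
  have nx: "nxt (Y i) (\<theta> j / 2) = \<theta> j / 2 + \<delta>" "\<theta> j / 2 \<in> Y i" "\<theta> (Suc j) / 2 \<in> Y i" "\<theta> j / 2 < \<theta> (Suc j) / 2"
    if ij: "i < j" "Suc j < i + m" for i j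
  proof -
    show m: "\<theta> j / 2 \<in> Y i" "\<theta> (Suc j) / 2 \<in> Y i" using ij by (auto simp: Y_def)
    show lt: "\<theta> j / 2 < \<theta> (Suc j) / 2" using sm by (simp add: strict_mono_less)
    show "nxt (Y i) (\<theta> j / 2) = \<theta> j / 2 + \<delta>" unfolding \<delta>_def
    proof (rule equal_gaps[OF fY finite_cangles[OF fX] _ _ m lt])
      show "card (cangles X) \<le> card (Y i) - 1" unfolding cY by (rule A)
    qed (rule diff)
  qed
  \<comment> \<open>The next direction after \<open>\<theta> j / 2\<close> belongs to the next point
    or to the antipode of the observer \<open>i\<close>.\<close>
  have alt: "\<theta> (Suc j) = \<theta> j + 2 * \<delta> \<or> \<theta> j + 2 * \<delta> = \<theta> i + pi" if ij: "i < j" "Suc j < i + m" for i j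
  proof -
    note N = nx[OF ij]
    have "\<theta> j / 2 + \<delta> \<in> Y i" "\<theta> j / 2 + \<delta> \<le> \<theta> (Suc j) / 2" "\<theta> j / 2 < \<theta> j / 2 + \<delta>"
      using nxt[OF fY N(3,4)] unfolding N(1) by auto
    then consider k where "\<theta> j / 2 + \<delta> = \<theta> k / 2" "\<theta> j < \<theta> k" "\<theta> k \<le> \<theta> (Suc j)" | "\<theta> j / 2 + \<delta> = (\<theta> i + pi) / 2"
      unfolding Y_def by auto
    then show ?thesis
    proof cases
      case 1
      then have "j < k" "k \<le> Suc j" using sm by (simp_all add: strict_mono_less strict_mono_less_eq)
      then have "k = Suc j" by simp
      then show ?thesis using 1 by simp
    next
      case 2
      then show ?thesis by simp
    qed
  qed
  \<comment> \<open>The gap after \<open>j\<close> is seen from the observers \<open>j - 1\<close>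
    and \<open>j + 2 - m\<close>. They are different since \<open>m \<ge> 4\<close>, so their
    antipodes cannot both be at \<open>\<theta> j + 2 * \<delta>\<close>. The restriction
    \<open>m \<le> j\<close> keeps the natural subtraction exact.\<close>
  have step: "\<theta> (Suc j) = \<theta> j + 2 * \<delta>" if j: "m \<le> j" for j
  proof (rule ccontr)
    assume "\<theta> (Suc j) \<noteq> \<theta> j + 2 * \<delta>"
    moreover have "j - 1 < j" "Suc j < j - 1 + m" "j + 2 - m < j" "Suc j < j + 2 - m + m" using m j by auto
    ultimately have "\<theta> (j - 1) = \<theta> (j + 2 - m)" using alt[of "j - 1" j] alt[of "j + 2 - m" j] by auto
    then have "j - 1 = j + 2 - m" using winding_inj[OF w] by (simp add: inj_eq)
    then show False using m j by simp
  qed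
  have ar: "\<theta> (m + k) = \<theta> m + 2 * \<delta> * real k" for k
  proof (induction k)
    case (Suc k)
    then show ?case using step[of "m + k"] by (simp add: algebra_simps)
  qed simp
  have d: "2 * pi = 2 * \<delta> * real m" using ar[of m] per[of m] by simp
  have d0: "\<delta> > 0"
  proof (rule ccontr)
    assume "\<not> \<delta> > 0"
    then have "2 * \<delta> * real m \<le> 0" by (simp add: mult_nonpos_nonneg)
    then show False using d pi_gt_zero by linarith
  qed
  \<comment> \<open>The antipode of point \<open>m\<close> lies strictly between points
    \<open>m + h\<close> and \<open>m + h + 1\<close>, less than \<open>2 * \<delta>\<close> after
    the former, against \<open>equal_gaps\<close>.\<close>
  define h where "h = m div 2"
  have h: "2 * h \<le> m" "m < 2 * (h + 1)" "0 < h" "Suc h < m" using m by (auto simp: h_def)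
  have ij: "m < m + h" "Suc (m + h) < m + m" using h by auto
  have "2 * \<delta> * real h \<le> \<delta> * real m"
  proof -
    have "real (2 * h) \<le> real m" using h(1) unfolding of_nat_le_iff .
    then have "\<delta> * real (2 * h) \<le> \<delta> * real m" using d0 by (intro mult_left_mono) auto
    then show ?thesis by simp
  qed
  then have "\<theta> (m + h) \<le> \<theta> m + pi" using ar[of h] d by linarith
  moreover have "\<theta> (m + h) \<noteq> \<theta> m + pi" using no_antipode[of m "m + h"] ij by simp
  ultimately have lt: "\<theta> (m + h) / 2 < (\<theta> m + pi) / 2" by simp
  have "\<delta> * real m < 2 * \<delta> * real (Suc h)"
  proof -
    have "real m < real (2 * (h + 1))" using h(2) unfolding of_nat_less_iff .
    then have "\<delta> * real m < \<delta> * real (2 * (h + 1))" using d0 by (intro mult_strict_left_mono) auto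
    also have "\<delta> * real (2 * (h + 1)) = 2 * \<delta> * real (Suc h)" by simp
    finally show ?thesis .
  qed
  then have gt: "\<theta> m + pi < \<theta> (Suc (m + h))" using ar[of "Suc h"] d by simp
  have "(\<theta> m + pi) / 2 \<in> Y m" by (simp add: Y_def)
  from nxt(3)[OF fY this lt] have "\<theta> (m + h) / 2 + \<delta> \<le> (\<theta> m + pi) / 2" unfolding nx(1)[OF ij] .
  moreover have "\<theta> (Suc (m + h)) = \<theta> (m + h) + 2 * \<delta>" using step[of "m + h"] by simp
  ultimately show False using gt by simp
qed

text \<open>From a vertex the others have equally spaced directions, \<open>pi / n\<close> apart, so
  the angles are the multiples of \<open>pi / n\<close> with factors 1 to
  \<open>n - 2\<close>.\<close>

lemma regular_angles:
  assumes n: "3 \<le> n" and \<rho>: "\<rho> > 0" and X: "X = (\<lambda>k. circ z \<rho> (t + 2 * pi * real k / real n)) ` {..<n}"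
  shows "card (cangles X) = n - 2"
proof -
  define \<theta> where "\<theta> = (\<lambda>k. t + 2 * pi * real k / real n)"
  have n0: "real n > 0" using n by simp
  have w: "winding n \<theta>"
    unfolding winding_def
  proof
    show "strict_mono \<theta>" unfolding strict_mono_def \<theta>_def using n0 by (auto intro!: divide_strict_right_mono)
    show "\<forall>i. \<theta> (i + n) = \<theta> i + 2 * pi" unfolding \<theta>_def using n0 by (simp add: add_divide_distrib distrib_left)
  qed
  have wrap: "circ z \<rho> (\<theta> (k + n)) = circ z \<rho> (\<theta> k)" for k
    using w by (simp add: winding_def complex_eq_iff)
  have Xeq: "X = (\<lambda>k. circ z \<rho> (\<theta> k)) ` {..<n}" using X by (simp add: \<theta>_def)
  have mem: "circ z \<rho> (\<theta> k) \<in> X" for k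
  proof (induction k rule: less_induct)
    case (less k)
    show ?case
    proof (cases "k < n")
      case False
      then have "circ z \<rho> (\<theta> (k - n)) \<in> X" using less[of "k - n"] n by simp
      moreover have "k - n + n = k" using False by simp
      ultimately show ?thesis using wrap[of "k - n"] by metis
    next
      case True
      then show ?thesis unfolding Xeq by blast
    qed
  qed
  have diff: "\<theta> j / 2 - \<theta> k / 2 = (real j - real k) * (pi / real n)" for j k
  proof -
    have "\<theta> i / 2 = t / 2 + real i * (pi / real n)" for i by (simp add: \<theta>_def add_divide_distrib)
    then show ?thesis by (simp only: left_diff_distrib)
  qed
  have "cangles X = (\<lambda>k. real k * (pi / real n)) ` {1..n - 2}"
  proof
    show "(\<lambda>k. real k * (pi / real n)) ` {1..n - 2} \<subseteq> cangles X"
    proof (rule image_subsetI)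
      fix k assume k: "k \<in> {1..n - 2}"
      then have kk: "(0::nat) < 1" "1 < 0 + n" "0 < k + 1" "k + 1 < 0 + n" using n by auto
      have "\<theta> 1 < \<theta> (k + 1)" using w k by (simp add: winding_def strict_mono_less)
      from winding_angles[OF w \<rho> mem kk this]
      show "real k * (pi / real n) \<in> cangles X" unfolding diff by simp
    qed
    show "cangles X \<subseteq> (\<lambda>k. real k * (pi / real n)) ` {1..n - 2}"
    proof
      fix a assume "a \<in> cangles X"
      then obtain p q r where pqr: "p \<in> X" "q \<in> X" "r \<in> X" "p \<noteq> q" "q \<noteq> r" "p \<noteq> r" and a: "a = cangle p q r"
        unfolding cangles_def by blast
      obtain i where i: "i < n" "q = circ z \<rho> (\<theta> i)" using pqr(2) unfolding Xeq by blast
      have lift: "\<exists>j. i < j \<and> j < i + n \<and> u = circ z \<rho> (\<theta> j)" if u: "u \<in> X" "u \<noteq> q" for u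
      proof -
        obtain j where j: "j < n" "u = circ z \<rho> (\<theta> j)" using u(1) unfolding Xeq by blast
        then have "j \<noteq> i" using u(2) i by auto
        then consider "i < j" | "j < i" by linarith
        then show ?thesis
        proof cases
          case 1
          then show ?thesis using j by auto
        next
          case 2
          then show ?thesis using j i wrap[of j, symmetric] by (intro exI[of _ "j + n"]) simp
        qed
      qed
      obtain j where j: "i < j" "j < i + n" "p = circ z \<rho> (\<theta> j)" using lift[OF pqr(1,4)] by blast
      obtain k where k: "i < k" "k < i + n" "r = circ z \<rho> (\<theta> k)" using lift[OF pqr(3) pqr(5)[symmetric]] by blast
      have jk: "j \<noteq> k" using j k pqr(6) by auto
      have "a = \<bar>\<theta> j - \<theta> k\<bar> / 2" unfolding a j(3) k(3) i(2)
        by (rule inscribed_angle[OF winding_window[OF w j(1,2)] winding_window[OF w k(1,2)] \<rho>])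
      also have "\<dots> = \<bar>\<theta> j / 2 - \<theta> k / 2\<bar>" by (simp add: diff_divide_distrib[symmetric])
      also have "\<dots> = \<bar>real j - real k\<bar> * (pi / real n)" unfolding diff abs_mult using n0 by simp
      finally have a2: "a = \<bar>real j - real k\<bar> * (pi / real n)" .
      define d where "d = (if j < k then k - j else j - k)"
      have "real d = \<bar>real j - real k\<bar>" by (auto simp: d_def of_nat_diff)
      moreover have "d \<in> {1..n - 2}" using j k jk by (auto simp: d_def)
      ultimately show "a \<in> (\<lambda>k. real k * (pi / real n)) ` {1..n - 2}" unfolding a2
        by (intro image_eqI[of _ _ d]) simp_all
    qed
  qed
  moreover have "card ((\<lambda>k. real k * (pi / real n)) ` {1..n - 2}) = card {1..n - 2}"
    by (rule card_image) (use n0 in \<open>simp add: inj_on_def\<close>)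
  ultimately show ?thesis by simp
qed

subsection \<open>Transfer to the real plane\<close>

text \<open>Angles are compared as real numbers; up to five half turns in either direction are enough to
  reach every real of absolute value at most \<open>10\<close>.\<close>

definition lifts :: "real set \<Rightarrow> real set" where
  "lifts A = (\<lambda>(a,j,s). s * a + of_int j * pi) ` (insert 0 A \<times> {-5..5::int} \<times> {1,-1})"

lemma card_lifts:
  assumes "finite A"
  shows "finite (lifts A)" "card (lifts A) \<le> 22 * (card A + 1)"
proof -
  have fin: "finite (insert 0 A \<times> {-5..5::int} \<times> {1,-1::real})" using assms by simp
  then show "finite (lifts A)" unfolding lifts_def by (rule finite_imageI)
  have "card (lifts A) \<le> card (insert 0 A \<times> {-5..5::int} \<times> {1,-1::real})"
    unfolding lifts_def by (rule card_image_le[OF fin])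
  \<comment> \<open>Eleven multiples of \<open>pi\<close> times two signs; the inserted angle 0
    accounts for the case \<open>p = r\<close> of \<open>holds_angles\<close>.\<close>
  also have "\<dots> = card (insert 0 A) * 22" by (simp add: card_cartesian_product)
  also have "\<dots> \<le> (card A + 1) * 22" by (rule mult_le_mono1) (simp add: card_insert_if assms)
  finally show "card (lifts A) \<le> 22 * (card A + 1)" by simp
qed

lemma lifts_uminus: "x \<in> lifts A \<Longrightarrow> - x \<in> lifts A"
proof -
  assume "x \<in> lifts A"
  then obtain a j s where x: "x = s * a + of_int j * pi" "a \<in> insert 0 A" "j \<in> {-5..5::int}" "s \<in> {1,-1}"
    unfolding lifts_def by (force simp del: insert_iff)
  show ?thesis unfolding lifts_def
    by (rule image_eqI[where x = "(a,-j,-s)"]) (use x in \<open>auto simp: x(1)\<close>)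
qed

text \<open>The product of sines vanishes if and only if \<open>d\<close> is \<open>a\<close> or
  \<open>- a\<close> modulo \<open>pi\<close>. The multiple of \<open>pi\<close> has size at most
  \<open>10 + pi\<close>, which is below \<open>6 * pi\<close>.\<close>

lemma in_lifts:
  assumes "a \<in> insert 0 A" "0 \<le> a" "a \<le> pi" "\<bar>d\<bar> \<le> 10" "sin (d + a) * sin (d - a) = 0"
  shows "d \<in> lifts A"
proof -
  have "\<exists>s\<in>{1,-1}. sin (d - s * a) = 0" using assms(5) by auto
  then obtain s :: real where s: "s \<in> {1,-1}" "sin (d - s * a) = 0" by blast
  then obtain j :: int where j: "d - s * a = of_int j * pi" by (auto simp: sin_zero_iff_int2)
  have "\<bar>s * a\<bar> \<le> pi" using s(1) assms(2,3) by auto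
  then have le: "\<bar>of_int j * pi\<bar> \<le> 10 + pi" unfolding j[symmetric] using assms(4) by linarith
  have "\<bar>j\<bar> < 6"
  proof (rule ccontr)
    assume "\<not> \<bar>j\<bar> < 6"
    then have "6 \<le> \<bar>real_of_int j\<bar>" by linarith
    then have "6 * pi \<le> \<bar>real_of_int j\<bar> * pi" by (rule mult_right_mono) simp
    also have "\<dots> = \<bar>of_int j * pi\<bar>" by (simp add: abs_mult)
    finally show False using le pi_gt3 by linarith
  qed
  then have "j \<in> {-5..5}" by auto
  moreover have "d = s * a + of_int j * pi" using j by linarith
  ultimately show ?thesis unfolding lifts_def using s(1) assms(1) by (intro image_eqI[where x = "(a,j,s)"]) auto
qed

text \<open>Since \<open>\<rho>\<close> may be negative and \<open>cangle\<close> has no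
  orientation, only \<open>(cos a)\<^sup>2 = (cos d)\<^sup>2\<close> is available, and this is what
  \<open>in_lifts\<close> needs.\<close>

lemma holds_angles_lifts:
  assumes X: "finite X"
  shows "holds_angles X (lifts (cangles X))"
  unfolding holds_angles_def
proof (intro conjI ballI allI impI)
  show "finite (lifts (cangles X))" by (rule card_lifts(1)[OF finite_cangles[OF X]])
  show "- x \<in> lifts (cangles X)" if "x \<in> lifts (cangles X)" for x by (rule lifts_uminus[OF that])
  fix p q r d \<rho> assume pqr: "p \<in> X" "q \<in> X" "r \<in> X" "q \<noteq> p" "q \<noteq> r" and d: "\<bar>d\<bar> \<le> 10"
    and e: "r - q = of_real \<rho> * cis d * (p - q)"
  have \<rho>: "\<rho> \<noteq> 0" using e pqr by auto
  show "d \<in> lifts (cangles X)"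
  proof (cases "p = r")
    case True
    then have "of_real \<rho> * cis d = 1" using e pqr by simp
    then have "Im (of_real \<rho> * cis d) = 0" by simp
    then have "sin d = 0" using \<rho> by simp
    then show ?thesis using in_lifts[of 0 "cangles X" d] d by simp
  next
    case False
    define a where "a = cangle p q r"
    have "(p - q) * cnj (r - q) = of_real \<rho> * cis (- d) * ((p - q) * cnj (p - q))"
      unfolding e by (simp add: cis_cnj)
    also have "(p - q) * cnj (p - q) = of_real ((cmod (p - q))\<^sup>2)" by (rule complex_norm_square[symmetric])
    finally have "Re ((p - q) * cnj (r - q)) = \<rho> * cos d * (cmod (p - q))\<^sup>2" by simp
    moreover have "cmod (p - q) * cmod (r - q) = \<bar>\<rho>\<bar> * (cmod (p - q))\<^sup>2"
      unfolding e by (simp add: norm_mult power2_eq_square)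
    moreover have "(cmod (p - q))\<^sup>2 \<noteq> 0" using pqr by simp
    ultimately have "Re ((p - q) * cnj (r - q)) / (cmod (p - q) * cmod (r - q)) = \<rho> * cos d / \<bar>\<rho>\<bar>" by simp
    also have "\<dots> = sgn \<rho> * cos d" using \<rho> by (simp add: sgn_if)
    finally have a: "a = arccos (sgn \<rho> * cos d)" unfolding a_def cangle_def by simp
    have sg: "sgn \<rho> = 1 \<or> sgn \<rho> = -1" using \<rho> by (simp add: sgn_if)
    have b: "-1 \<le> sgn \<rho> * cos d" "sgn \<rho> * cos d \<le> 1" using sg by auto
    have ca: "cos a = sgn \<rho> * cos d" unfolding a by (rule cos_arccos[OF b])
    have c2: "(cos a)\<^sup>2 = (cos d)\<^sup>2" unfolding ca using sg by auto
    have "sin (d + a) * sin (d - a) = (sin d)\<^sup>2 * (cos a)\<^sup>2 - (cos d)\<^sup>2 * (sin a)\<^sup>2"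
      by (simp add: sin_add sin_diff power2_eq_square algebra_simps)
    also have "\<dots> = 0" unfolding c2 sin_squared_eq by simp
    finally have z: "sin (d + a) * sin (d - a) = 0" .
    have "a \<in> cangles X" unfolding a_def by (rule cangles_I) (use pqr False in auto)
    then show ?thesis using in_lifts[OF _ _ _ d z, of "cangles X"] arccos_lbound[OF b] arccos_ubound[OF b] unfolding a[symmetric] by blast
  qed
qed

text \<open>At most \<open>n - 2\<close> angles give at most \<open>22 * (n - 1)\<close> lifted
  ones, so \<open>eventually_structure\<close> applies. Almost collinear sets, and concyclic sets
  with their centre, have at least \<open>n - 1\<close> angles, so only concyclic sets
  remain.\<close>

theorem complex_characterisation:
  "\<exists>N. \<forall>n\<ge>N. \<forall>X. finite X \<and> card X = n \<and> (\<forall>b c. b \<noteq> 0 \<longrightarrow> \<not> X \<subseteq> gcircle 0 b c) \<and>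
    card (cangles X) \<le> n - 2 \<longrightarrow> card (cangles X) = n - 2 \<and>
      (\<exists>z \<rho> t. \<rho> > 0 \<and> X = (\<lambda>k. circ z \<rho> (t + 2 * pi * real k / real n)) ` {..<n})"
proof -
  obtain N0 where N0: "\<And>n P B. N0 \<le> n \<Longrightarrow> finite P \<and> card P = n \<and> holds_angles P B \<and> card B \<le> 22 * n \<Longrightarrow>
     (\<exists>b c. b \<noteq> 0 \<and> card (P - gcircle 0 b c) \<le> 2) \<or> (\<exists>z \<rho>. \<rho> > 0 \<and> (\<forall>v\<in>P. cmod (v - z) = \<rho> \<or> v = z))"
    using eventually_structure unfolding eventually_sequentially by metis
  show ?thesis
  proof (intro exI[of _ "max N0 10"] allI impI, elim conjE)
    fix n and X :: "complex set"
    assume n: "max N0 10 \<le> n" and X: "finite X" "card X = n"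
      and "\<forall>b c. b \<noteq> 0 \<longrightarrow> \<not> X \<subseteq> gcircle 0 b c" and A: "card (cangles X) \<le> n - 2"
    then have nc: "\<And>b c. b \<noteq> 0 \<Longrightarrow> \<not> X \<subseteq> gcircle 0 b c" by blast
    have n10: "10 \<le> n" "N0 \<le> n" using n by auto
    have "card (lifts (cangles X)) \<le> 22 * (card (cangles X) + 1)" by (rule card_lifts(2)[OF finite_cangles[OF X(1)]])
    also have "\<dots> \<le> 22 * n" using A n10 by simp
    finally have str: "(\<exists>b c. b \<noteq> 0 \<and> card (X - gcircle 0 b c) \<le> 2) \<or> (\<exists>z \<rho>. \<rho> > 0 \<and> (\<forall>v\<in>X. cmod (v - z) = \<rho> \<or> v = z))"
      using N0[OF n10(2), of X "lifts (cangles X)"] X holds_angles_lifts[OF X(1)] by blast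
    have "\<not> (\<exists>b c. b \<noteq> 0 \<and> card (X - gcircle 0 b c) \<le> 2)"
    proof
      assume "\<exists>b c. b \<noteq> 0 \<and> card (X - gcircle 0 b c) \<le> 2"
      then obtain b c where b: "b \<noteq> 0" "card (X - gcircle 0 b c) \<le> 2" by blast
      obtain x where x: "x \<in> X" "x \<notin> gcircle 0 b c" using nc[OF b(1), of c] by blast
      have "card X - 1 \<le> card (cangles X)" by (rule cangles_line[OF X(1) b x]) (use X n10 in simp)
      then show False using A X n10 by linarith
    qed
    then obtain z \<rho> where \<rho>: "\<rho> > 0" and on: "\<And>v. v \<in> X \<Longrightarrow> cmod (v - z) = \<rho> \<or> v = z" using str by blast
    have "z \<notin> X"
    proof
      assume z: "z \<in> X"
      define X' where "X' = X - {z}"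
      have c: "card X' = n - 1" using X z by (simp add: X'_def)
      have "X' \<noteq> {}" using c n10 by auto
      then have X': "finite X'" "X' \<noteq> {}" "\<And>v. v \<in> X' \<Longrightarrow> cmod (v - z) = \<rho>"
        using X(1) on by (simp_all add: X'_def) blast
      obtain \<theta> where th: "strict_mono \<theta>" "\<And>i. \<theta> (i + card X') = \<theta> i + 2 * pi" "\<And>i. circ z \<rho> (\<theta> i) \<in> X'"
        using circle_enumeration[OF X' \<rho>] by metis
      have w: "winding (n - 1) \<theta>" using th(1,2) c by (simp add: winding_def)
      have "n - 1 \<le> card (cangles X)"
        by (rule concyclic_with_centre[OF w \<rho> _ z X(1)]) (use th(3) n10 in \<open>auto simp: X'_def\<close>)
      then show False using A n10 by linarith
    qed
    then have c: "cmod (v - z) = \<rho>" if "v \<in> X" for v using on[OF that] that by blast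
    have ne: "X \<noteq> {}" using X n10 by auto
    obtain \<theta> where th: "strict_mono \<theta>" "\<And>i. \<theta> (i + card X) = \<theta> i + 2 * pi" "\<And>i. circ z \<rho> (\<theta> i) \<in> X"
        "X = (\<lambda>i. circ z \<rho> (\<theta> i)) ` {..<card X}"
      using circle_enumeration[OF X(1) ne c \<rho>] by metis
    have w: "winding n \<theta>" using th(1,2) X(2) by (simp add: winding_def)
    have "n - 2 \<le> card (cangles X \<inter> {0<..<pi})" by (rule concyclic_bound[OF w \<rho> th(3) X(1)]) (use n10 in simp)
    also have "\<dots> \<le> card (cangles X)" by (rule card_mono[OF finite_cangles[OF X(1)]]) simp
    finally have eq: "card (cangles X) = n - 2" using A by simp
    have n3: "3 \<le> n" using n10 by simp
    obtain t where t: "\<And>i. \<theta> i = t + 2 * pi * real i / real n"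
      using concyclic_extremal[OF w \<rho> th(3) X(1) n3 A] by metis
    have "X = (\<lambda>k. circ z \<rho> (t + 2 * pi * real k / real n)) ` {..<n}" using th(4) unfolding t X(2) .
    then show "card (cangles X) = n - 2 \<and> (\<exists>z \<rho> t. \<rho> > 0 \<and> X = (\<lambda>k. circ z \<rho> (t + 2 * pi * real k / real n)) ` {..<n})"
      using eq \<rho> by blast
  qed
qed

section \<open>Identification of the real plane with the complex numbers\<close>

definition plane :: "real ^ 2 \<Rightarrow> complex" where "plane v = Complex (v $ 1) (v $ 2)"

lemma inj_plane: "inj plane"
  by (auto simp: inj_def plane_def vec_eq_iff forall_2)

lemma plane_simps:
  "plane (u - v) = plane u - plane v" "norm v = cmod (plane v)" "u \<bullet> v = Re (plane u * cnj (plane v))"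
  by (simp_all add: plane_def complex_eq_iff norm_vec_def L2_set_def inner_vec_def sum_2 cmod_def)

lemma plane_polar: "plane (c + \<rho> *\<^sub>R vector [cos t, sin t]) = circ (plane c) \<rho> t"
  by (simp add: plane_def complex_eq_iff)

lemma angle_set_eq: "angle_set P = cangles (plane ` P)"
proof -
  have e: "angle_at p q r = cangle (plane p) (plane q) (plane r)" for p q r
    unfolding angle_at_def vangle_def cangle_def plane_simps by simp
  have ne: "plane p \<noteq> plane q \<longleftrightarrow> p \<noteq> q" for p q using inj_plane by (simp add: inj_eq)
  show ?thesis
  proof
    show "angle_set P \<subseteq> cangles (plane ` P)"
    proof
      fix a assume "a \<in> angle_set P"
      then obtain p q r where "a = angle_at p q r" "p \<in> P" "q \<in> P" "r \<in> P" "p \<noteq> q" "q \<noteq> r" "p \<noteq> r"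
        unfolding angle_set_def by blast
      then show "a \<in> cangles (plane ` P)" unfolding e by (metis cangles_I imageI ne)
    qed
    show "cangles (plane ` P) \<subseteq> angle_set P"
    proof
      fix a assume "a \<in> cangles (plane ` P)"
      then obtain p q r where "a = cangle (plane p) (plane q) (plane r)" "p \<in> P" "q \<in> P" "r \<in> P"
        "plane p \<noteq> plane q" "plane q \<noteq> plane r" "plane p \<noteq> plane r" unfolding cangles_def by blast
      then show "a \<in> angle_set P" unfolding angle_set_def e[symmetric] by blast
    qed
  qed
qed

lemma collinear_plane:
  assumes "b \<noteq> 0" "plane ` P \<subseteq> gcircle 0 b c"
  shows "collinear P"
  unfolding collinear_def
\<comment> \<open>\<open>Re (b * v)\<close> is \<open>Re b * x - Im b * y\<close> for
  \<open>v\<close> with coordinates \<open>x\<close>, \<open>y\<close>, so the line has direction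
  \<open>(Im b, Re b)\<close>.\<close>
proof (intro exI[of _ "vector [Im b, Re b] :: real ^ 2"] ballI)
  fix x y assume xy: "x \<in> P" "y \<in> P"
  have l: "Re b * v $ 1 - Im b * v $ 2 + c = 0" if "v \<in> P" for v
    using assms(2) that by (auto simp: gcircle_def plane_def)
  have e: "Re b * (x $ 1 - y $ 1) = Im b * (x $ 2 - y $ 2)" using l[OF xy(1)] l[OF xy(2)] by (simp add: right_diff_distrib)
  show "\<exists>k. x - y = k *\<^sub>R vector [Im b, Re b]"
  proof (cases "Im b = 0")
    case True
    then have r: "Re b \<noteq> 0" using assms(1) by (simp add: complex_eq_iff)
    then have "x $ 1 - y $ 1 = 0" using e True by simp
    then show ?thesis using True r
      by (intro exI[of _ "(x $ 2 - y $ 2) / Re b"]) (simp add: vec_eq_iff forall_2)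
  next
    case False
    have "x $ 2 - y $ 2 = (Im b * (x $ 2 - y $ 2)) / Im b" using False by simp
    also have "\<dots> = (x $ 1 - y $ 1) / Im b * Re b" unfolding e[symmetric] by simp
    finally show ?thesis using False
      by (intro exI[of _ "(x $ 1 - y $ 1) / Im b"]) (simp add: vec_eq_iff forall_2)
  qed
qed

lemma regular_iff_plane:
  "regular_polygon_vertices n P \<longleftrightarrow> 3 \<le> n \<and>
    (\<exists>z \<rho> t. \<rho> > 0 \<and> plane ` P = (\<lambda>k. circ z \<rho> (t + 2 * pi * real k / real n)) ` {..<n})"
proof -
  have "P = {c + \<rho> *\<^sub>R vector [cos (t + 2 * pi * real k / real n), sin (t + 2 * pi * real k / real n)] | k. k < n} \<longleftrightarrow>
      plane ` P = (\<lambda>k. circ (plane c) \<rho> (t + 2 * pi * real k / real n)) ` {..<n}" (is "P = ?S \<longleftrightarrow> _") for c \<rho> t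
  proof -
    have "?S = (\<lambda>k. c + \<rho> *\<^sub>R vector [cos (t + 2 * pi * real k / real n), sin (t + 2 * pi * real k / real n)]) ` {..<n}"
      by blast
    then have "plane ` ?S = (\<lambda>k. circ (plane c) \<rho> (t + 2 * pi * real k / real n)) ` {..<n}"
      by (simp only: image_image plane_polar)
    moreover have "P = ?S \<longleftrightarrow> plane ` P = plane ` ?S" by (rule inj_image_eq_iff[OF inj_plane, symmetric])
    ultimately show ?thesis by (simp only:)
  qed
  then have r: "regular_polygon_vertices n P \<longleftrightarrow> 3 \<le> n \<and>
      (\<exists>c \<rho> t. \<rho> > 0 \<and> plane ` P = (\<lambda>k. circ (plane c) \<rho> (t + 2 * pi * real k / real n)) ` {..<n})"
    unfolding regular_polygon_vertices_def by (simp only:)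
  have "surj plane"
    by (rule surjI[of _ "\<lambda>z. vector [Re z, Im z]"]) (simp add: plane_def)
  then have "(\<exists>c. Q (plane c)) \<longleftrightarrow> (\<exists>z. Q z)" for Q by (metis surjD)
  from this[of "\<lambda>z. \<exists>\<rho> t. \<rho> > 0 \<and> plane ` P = (\<lambda>k. circ z \<rho> (t + 2 * pi * real k / real n)) ` {..<n}"]
  show ?thesis unfolding r by (simp only:)
qed

theorem theorem2:
  shows "\<exists>n\<^sub>0 :: nat. \<forall>n \<ge> n\<^sub>0.
    (\<forall>P :: (real ^ 2) set. finite P \<and> card P = n \<and> \<not> collinear P \<longrightarrow>
       card (angle_set P) \<ge> n - 2) \<and>
    (\<forall>P :: (real ^ 2) set. finite P \<and> card P = n \<and> \<not> collinear P \<longrightarrow>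
       (card (angle_set P) = n - 2 \<longleftrightarrow> regular_polygon_vertices n P))"
proof -
  obtain N where N: "\<forall>n\<ge>N. \<forall>X. finite X \<and> card X = n \<and> (\<forall>b c. b \<noteq> 0 \<longrightarrow> \<not> X \<subseteq> gcircle 0 b c) \<and>
    card (cangles X) \<le> n - 2 \<longrightarrow> card (cangles X) = n - 2 \<and>
      (\<exists>z \<rho> t. \<rho> > 0 \<and> X = (\<lambda>k. circ z \<rho> (t + 2 * pi * real k / real n)) ` {..<n})"
    using complex_characterisation by (rule exE)
  show ?thesis
  proof (intro exI[of _ "max N 3"] allI impI conjI)
    fix n and P :: "(real ^ 2) set"
    assume n: "max N 3 \<le> n" and P: "finite P \<and> card P = n \<and> \<not> collinear P"
    have X: "N \<le> n" "finite (plane ` P)" "card (plane ` P) = n"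
      using n P card_image[of plane P] inj_plane by (auto intro: inj_on_subset)
    have nc: "\<not> plane ` P \<subseteq> gcircle 0 b c" if "b \<noteq> 0" for b c using collinear_plane[OF that] P by blast
    have key: "card (angle_set P) \<le> n - 2 \<Longrightarrow> card (angle_set P) = n - 2 \<and> regular_polygon_vertices n P"
      using N[rule_format, of n "plane ` P"] X nc n unfolding angle_set_eq regular_iff_plane by simp
    \<comment> \<open>Fewer than \<open>n - 2\<close> angles would satisfy the premise of
      \<open>key\<close> and hence be exactly \<open>n - 2\<close>.\<close>
    show "card (angle_set P) \<ge> n - 2" using key by linarith
    show "card (angle_set P) = n - 2 \<longleftrightarrow> regular_polygon_vertices n P"
    proof
      assume "card (angle_set P) = n - 2"
      then show "regular_polygon_vertices n P" using key by simp
    next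
      assume "regular_polygon_vertices n P"
      then obtain z \<rho> t where "3 \<le> n" "\<rho> > 0" "plane ` P = (\<lambda>k. circ z \<rho> (t + 2 * pi * real k / real n)) ` {..<n}"
        unfolding regular_iff_plane by blast
      then show "card (angle_set P) = n - 2" unfolding angle_set_eq by (rule regular_angles)
    qed
  qed
qed

end
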